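(* Let $(M,g)$ be a smooth, connected, complete Riemannian manifold without boundary, and let $K\subset M$ be a closed nonempty subset with distance function $d_K$. Then: (1) $d_K$ is the unique viscosity solution of $$\begin{cases}|\nabla u|-1=0 & \text{in } M\setminus K,\\ u=0 & \text{on } K\end{cases}$$ in the class of continuous functions $u:M\to\mathbb{R}$ that are bounded from below. (2) $d_K^2/2$ is the unique viscosity solution of $$\begin{cases}|\nabla u|^2-2u=0 & \text{in } M,\\ u=0 & \text{on } K\end{cases}$$ in the class of continuous functions $u:M\to\mathbb{R}$ whose zero set is exactly $K$.
   Context: $d$ is the distance on $M$ induced by $g$, and $d_K(x)=\inf_{y\in K}d(x,y)$. For a continuous function $u$ on an open set $\Omega\subset M$ and $x\in\Omega$, the superdifferential is $\partial^+u(x)=\{d\varphi(x) : \varphi\in C^1,\ \varphi-u \text{ has a local minimum at } x\}\subset T_x^*M$, and the subdifferential is $\partial^-u(x)=\{d\varphi(x) : \varphi\in C^1,\ \varphi-u\text{ has a local maximum at }x\}\subset T_x^*M$. For a continuous function $H:T^*\Omega\times\mathbb{R}\to\mathbb{R}$, a continuous function $u:\Omega\to\mathbb{R}$ is a viscosity solution of $H(x,du(x),u(x))=0$ in $\Omega$ if for every $x\in\Omega$: $H(x,v,u(x))\le 0$ for all $v\in\partial^+u(x)$, and $H(x,v,u(x))\ge 0$ for all $v\in\partial^-u(x)$. Differentials and gradients are identified through $g$, and $|\cdot|$ is the norm induced by $g$. The boundary conditions "$u=0$ on $K$" are meant pointwise. *)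

theory Defs
  imports "HOL-Analysis.Analysis"
begin

section \<open>Differentiability classes on open subsets of a Euclidean space\<close>

text \<open>On an open set \<^term>\<open>S\<close>, \<open>Ck_on k S f\<close> says that \<open>f\<close> is \<open>C\<^sup>k\<close>. The derivative is
  required to be \<open>C\<^sup>k\<close> in each fixed direction, which in finite dimension is the same as
  being \<open>C\<^sup>k\<close> as an operator-valued map.\<close>

primrec Ck_on :: "nat \<Rightarrow> 'e::euclidean_space set \<Rightarrow> ('e \<Rightarrow> 'f::real_normed_vector) \<Rightarrow> bool" where
  "Ck_on 0 S f \<longleftrightarrow> continuous_on S f"
| "Ck_on (Suc k) S f \<longleftrightarrow>
     (\<forall>x\<in>S. f differentiable (at x)) \<and>
     (\<forall>v. Ck_on k S (\<lambda>x. frechet_derivative f (at x) v))"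

definition smooth_on :: "'e::euclidean_space set \<Rightarrow> ('e \<Rightarrow> 'f::real_normed_vector) \<Rightarrow> bool" where
  "smooth_on S f \<longleftrightarrow> (\<forall>k. Ck_on k S f)"


section \<open>Smooth manifolds\<close>

text \<open>A chart is a pair of its domain and its coordinate map; the values of the map outside the
  domain are irrelevant.\<close>

type_synonym ('m, 'e) chart = "'m set \<times> ('m \<Rightarrow> 'e)"

abbreviation chart_inv :: "('m, 'e) chart \<Rightarrow> 'e \<Rightarrow> 'm" where
  "chart_inv c \<equiv> inv_into (fst c) (snd c)"

definition charts_at :: "('m, 'e) chart set \<Rightarrow> 'm \<Rightarrow> ('m, 'e) chart set" where
  "charts_at A x = {c \<in> A. x \<in> fst c}"

text \<open>The manifold is the whole type \<^typ>\<open>'m\<close>. As all charts are onto open subsets of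
  the full Euclidean space, it has no boundary.\<close>

locale smooth_manifold =
  fixes A :: "('m::{t2_space, second_countable_topology}, 'e::euclidean_space) chart set"
  assumes open_domain: "c \<in> A \<Longrightarrow> open (fst c)"
    and open_image: "c \<in> A \<Longrightarrow> open (snd c ` fst c)"
    and chart_homeomorphism:
      "c \<in> A \<Longrightarrow> homeomorphism (fst c) (snd c ` fst c) (snd c) (chart_inv c)"
    and smooth_transition:
      "\<lbrakk>c \<in> A; d \<in> A\<rbrakk> \<Longrightarrow> smooth_on (snd c ` (fst c \<inter> fst d)) (snd d \<circ> chart_inv c)"
    and charts_cover: "(\<Union>c\<in>A. fst c) = UNIV"

text \<open>A tangent vector at \<open>x\<close> is the family of its coordinate vectors in all charts around \<open>x\<close>,
  which transform by the derivatives of the coordinate changes. The value \<open>0\<close> for all other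
  charts makes the representation unique, so that the tangent space is a vector space under
  the pointwise operations.\<close>

type_synonym ('m, 'e) tangent = "('m, 'e) chart \<Rightarrow> 'e"

definition tangent_space ::
    "('m, 'e::euclidean_space) chart set \<Rightarrow> 'm \<Rightarrow> ('m, 'e) tangent set" where
  "tangent_space A x =
     {v. (\<forall>c. c \<notin> charts_at A x \<longrightarrow> v c = 0) \<and>
         (\<forall>c\<in>charts_at A x. \<forall>d\<in>charts_at A x.
            v d = frechet_derivative (snd d \<circ> chart_inv c) (at (snd c x)) (v c))}"

text \<open>The tangent vector at \<open>x\<close> with coordinates \<open>a\<close> in the chart \<open>c\<close> around \<open>x\<close>.\<close>

definition tangent_of_coords ::
    "('m, 'e::euclidean_space) chart set \<Rightarrow> ('m, 'e) chart \<Rightarrow> 'm \<Rightarrow> 'e \<Rightarrow> ('m, 'e) tangent" where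
  "tangent_of_coords A c x a =
     (\<lambda>d. if d \<in> charts_at A x
          then frechet_derivative (snd d \<circ> chart_inv c) (at (snd c x)) a else 0)"

definition C1_function_on ::
    "('m, 'e::euclidean_space) chart set \<Rightarrow> 'm set \<Rightarrow> ('m \<Rightarrow> real) \<Rightarrow> bool" where
  "C1_function_on A W \<phi> \<longleftrightarrow> (\<forall>c\<in>A. Ck_on 1 (snd c ` (fst c \<inter> W)) (\<phi> \<circ> chart_inv c))"

text \<open>Covectors at \<open>x\<close> are linear forms on the tangent space, extended by \<open>0\<close> to the
  whole type. On tangent vectors at \<open>x\<close> the differential does not depend on the chosen chart.\<close>

type_synonym ('m, 'e) cotangent = "('m, 'e) tangent \<Rightarrow> real"

definition differential ::
    "('m, 'e::euclidean_space) chart set \<Rightarrow> ('m \<Rightarrow> real) \<Rightarrow> 'm \<Rightarrow> ('m, 'e) cotangent" where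
  "differential A \<phi> x =
     (\<lambda>v. if v \<in> tangent_space A x
          then let c = (SOME c. c \<in> charts_at A x)
               in frechet_derivative (\<phi> \<circ> chart_inv c) (at (snd c x)) (v c)
          else 0)"


section \<open>Riemannian metrics\<close>

type_synonym ('m, 'e) metric_tensor = "'m \<Rightarrow> ('m, 'e) tangent \<Rightarrow> ('m, 'e) tangent \<Rightarrow> real"

locale riemannian_manifold = smooth_manifold A
  for A :: "('m::{t2_space, second_countable_topology}, 'e::euclidean_space) chart set" +
  fixes g :: "('m, 'e) metric_tensor"
  assumes metric_add:
      "\<lbrakk>u \<in> tangent_space A x; v \<in> tangent_space A x; w \<in> tangent_space A x\<rbrakk>
       \<Longrightarrow> g x (\<lambda>c. u c + v c) w = g x u w + g x v w"
    and metric_scale: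
      "\<lbrakk>u \<in> tangent_space A x; w \<in> tangent_space A x\<rbrakk>
       \<Longrightarrow> g x (\<lambda>c. r *\<^sub>R u c) w = r * g x u w"
    and metric_sym:
      "\<lbrakk>u \<in> tangent_space A x; w \<in> tangent_space A x\<rbrakk> \<Longrightarrow> g x u w = g x w u"
    and metric_pos:
      "\<lbrakk>u \<in> tangent_space A x; u \<noteq> (\<lambda>c. 0)\<rbrakk> \<Longrightarrow> g x u u > 0"
    and metric_smooth:
      "c \<in> A \<Longrightarrow> smooth_on (snd c ` fst c)
         (\<lambda>y. g (chart_inv c y) (tangent_of_coords A c (chart_inv c y) a)
                                (tangent_of_coords A c (chart_inv c y) b))"

definition tangent_norm :: "('m, 'e) metric_tensor \<Rightarrow> 'm \<Rightarrow> ('m, 'e) tangent \<Rightarrow> real" where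
  "tangent_norm g x v = sqrt (g x v v)"

text \<open>The tangent vector identified with the covector \<open>\<omega>\<close> through \<open>g\<close>; for
  \<open>\<omega> = d\<phi>(x)\<close> it is the gradient of \<open>\<phi>\<close>.\<close>

definition sharp ::
    "('m, 'e::euclidean_space) chart set \<Rightarrow> ('m, 'e) metric_tensor \<Rightarrow> 'm
     \<Rightarrow> ('m, 'e) cotangent \<Rightarrow> ('m, 'e) tangent" where
  "sharp A g x \<omega> =
     (THE w. w \<in> tangent_space A x \<and> (\<forall>v\<in>tangent_space A x. \<omega> v = g x w v))"

definition cotangent_norm ::
    "('m, 'e::euclidean_space) chart set \<Rightarrow> ('m, 'e) metric_tensor \<Rightarrow> 'm
     \<Rightarrow> ('m, 'e) cotangent \<Rightarrow> real" where
  "cotangent_norm A g x \<omega> = tangent_norm g x (sharp A g x \<omega>)"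


section \<open>Riemannian distance\<close>

text \<open>On each closed piece the coordinate derivatives (one-sided at the end points) exist and are
  continuous up to the end points.\<close>

definition C1_curve_on ::
    "('m::topological_space, 'e::euclidean_space) chart set \<Rightarrow> real \<Rightarrow> real \<Rightarrow> (real \<Rightarrow> 'm) \<Rightarrow> bool"
  where
  "C1_curve_on A a b \<gamma> \<longleftrightarrow> continuous_on {a..b} \<gamma> \<and>
     (\<forall>c\<in>A. \<exists>D. continuous_on {t \<in> {a..b}. \<gamma> t \<in> fst c} D \<and>
        (\<forall>t\<in>{a..b}. \<gamma> t \<in> fst c \<longrightarrow>
           ((snd c \<circ> \<gamma>) has_vector_derivative D t) (at t within {a..b})))"

definition piecewise_C1_path ::
    "('m::topological_space, 'e::euclidean_space) chart set \<Rightarrow> (real \<Rightarrow> 'm) \<Rightarrow> bool" where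
  "piecewise_C1_path A \<gamma> \<longleftrightarrow> path \<gamma> \<and>
     (\<exists>(n::nat) ts. ts 0 = 0 \<and> ts n = 1 \<and>
        (\<forall>i<n. ts i < ts (Suc i) \<and> C1_curve_on A (ts i) (ts (Suc i)) \<gamma>))"

text \<open>For a piecewise \<open>C\<^sup>1\<close> path the velocity is meaningful except at finitely many
  parameters, where its arbitrary value does not affect the length.\<close>

definition velocity ::
    "('m, 'e::euclidean_space) chart set \<Rightarrow> (real \<Rightarrow> 'm) \<Rightarrow> real \<Rightarrow> ('m, 'e) tangent" where
  "velocity A \<gamma> t =
     (\<lambda>c. if c \<in> charts_at A (\<gamma> t) then vector_derivative (snd c \<circ> \<gamma>) (at t) else 0)"

definition curve_length ::
    "('m, 'e::euclidean_space) chart set \<Rightarrow> ('m, 'e) metric_tensor \<Rightarrow> (real \<Rightarrow> 'm) \<Rightarrow> real" where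
  "curve_length A g \<gamma> = integral {0..1} (\<lambda>t. tangent_norm g (\<gamma> t) (velocity A \<gamma> t))"

definition riemannian_dist ::
    "('m::topological_space, 'e::euclidean_space) chart set \<Rightarrow> ('m, 'e) metric_tensor
     \<Rightarrow> 'm \<Rightarrow> 'm \<Rightarrow> real" where
  "riemannian_dist A g x y =
     Inf (curve_length A g ` {\<gamma>. piecewise_C1_path A \<gamma> \<and> pathstart \<gamma> = x \<and> pathfinish \<gamma> = y})"

definition dist_to_set ::
    "('m::topological_space, 'e::euclidean_space) chart set \<Rightarrow> ('m, 'e) metric_tensor
     \<Rightarrow> 'm set \<Rightarrow> 'm \<Rightarrow> real" where
  "dist_to_set A g K x = (INF y\<in>K. riemannian_dist A g x y)"


section \<open>Viscosity solutions\<close>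

text \<open>Test functions only need to be \<open>C\<^sup>1\<close> near the point. This gives the same sets as
  test functions that are \<open>C\<^sup>1\<close> on all of the domain, by cutting off.\<close>

definition superdifferential ::
    "('m::topological_space, 'e::euclidean_space) chart set \<Rightarrow> ('m \<Rightarrow> real) \<Rightarrow> 'm
     \<Rightarrow> ('m, 'e) cotangent set" where
  "superdifferential A u x =
     {differential A \<phi> x | \<phi>. (\<exists>W. open W \<and> x \<in> W \<and> C1_function_on A W \<phi>) \<and>
        (\<forall>\<^sub>F y in nhds x. \<phi> x - u x \<le> \<phi> y - u y)}"

definition subdifferential ::
    "('m::topological_space, 'e::euclidean_space) chart set \<Rightarrow> ('m \<Rightarrow> real) \<Rightarrow> 'm
     \<Rightarrow> ('m, 'e) cotangent set" where
  "subdifferential A u x =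
     {differential A \<phi> x | \<phi>. (\<exists>W. open W \<and> x \<in> W \<and> C1_function_on A W \<phi>) \<and>
        (\<forall>\<^sub>F y in nhds x. \<phi> y - u y \<le> \<phi> x - u x)}"

definition viscosity_solution ::
    "('m::topological_space, 'e::euclidean_space) chart set \<Rightarrow> 'm set
     \<Rightarrow> ('m \<Rightarrow> ('m, 'e) cotangent \<Rightarrow> real \<Rightarrow> real) \<Rightarrow> ('m \<Rightarrow> real) \<Rightarrow> bool" where
  "viscosity_solution A \<Omega> H u \<longleftrightarrow> continuous_on \<Omega> u \<and>
     (\<forall>x\<in>\<Omega>. (\<forall>v\<in>superdifferential A u x. H x v (u x) \<le> 0) \<and>
             (\<forall>v\<in>subdifferential A u x. H x v (u x) \<ge> 0))"

end

theory Submission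
  imports Defs
begin

text \<open>Both directions pass through a purely metric description of viscosity solutions. In a small chart the
  Riemannian distance is, up to a factor close to 1, the norm of the metric frozen at a point, so
  that test functions built from this norm show: if \<open>\<bar>p\<bar> \<le> L\<close> for all supergradients \<open>p\<close> near
  \<open>x\<close>, then \<open>u\<close> is locally \<open>L'\<close>-Lipschitz for every \<open>L' > L\<close>; and if \<open>\<bar>p\<bar> \<ge> L\<close> for all
  subgradients, then for every \<open>L' < L\<close> there are points \<open>y \<noteq> x\<close> arbitrarily close to \<open>x\<close> with
  \<open>u y \<le> u x - L' d(x, y)\<close>. Conversely both metric properties at \<open>x\<close> imply the viscosity inequalities
  there, and \<open>d\<^sub>K\<close> has them with \<open>L = 1\<close> off \<open>K\<close> because \<open>d\<close> is a length metric.

  For uniqueness in the first problem, integrating the Lipschitz bound along curves until they hit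
  \<open>K\<close> gives \<open>u \<le> d\<^sub>K\<close>. By completeness, Ekeland's principle leads from any point \<open>x\<close> to a point
  \<open>y\<close> with \<open>u y \<le> u x - \<theta> d(x, y)\<close> from which \<open>u\<close> does not descend with rate \<open>\<theta> < 1\<close>;
  hence \<open>y \<in> K\<close> and \<open>u x \<ge> \<theta> d\<^sub>K(x)\<close>. In the second problem \<open>u \<ge> 0\<close>, as supergradients exist
  at a dense set of points, and \<open>\<surd>(2u)\<close> inherits the metric properties with \<open>L = 1\<close> off \<open>K\<close>.\<close>

section \<open>Length metrics\<close>

text \<open>The distance function cannot itself serve as a test function, as it need not be C1, and
  the proof uses neither geodesics nor the exponential map. Cones and paraboloids of a norm frozen
  at one point of a chart take its place; they are wrong by factors \<open>1 - e\<close> and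
  \<open>1 + e\<close>. The two metric properties carry a strict margin, \<open>L' > L\<close> or
  \<open>L' < L\<close>, so that this error can be absorbed. Likewise no shortest curve to
  \<open>K\<close> is sought: curves within \<open>e\<close> of the infimum suffice, and
  completeness enters only through the Cauchy sequence behind Ekeland's principle.

  The two properties differ in kind. The Lipschitz property concerns all pairs of points near
  \<open>x\<close>, so it can be chained along a given curve and bounds \<open>u\<close> from above.
  Descent provides one nearby point in an unknown direction; there is no curve to follow, and a
  variational principle, which needs a lower bound on \<open>u\<close>, takes over. In the second
  problem this lower bound is automatic, but passing from \<open>u\<close> to its square root means
  dividing by values of the root, and this is possible only off the zero set.\<close>

text \<open>Continuous induction on an interval: \<open>Sup S\<close> lies in the closed set
  \<open>S\<close>, and progress excludes \<open>Sup S < b\<close>. It carries estimates along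
  curves, once in the metric space and once inside a chart.\<close>

lemma closed_progress_reaches_end:
  fixes S :: "real set"
  assumes "closed S" "S \<subseteq> {a..b}" "a \<in> S"
    and progress: "\<And>t. t \<in> S \<Longrightarrow> t < b \<Longrightarrow> \<exists>t'\<in>S. t < t'"
  shows "b \<in> S"
proof -
  have bdd: "bdd_above S"
    using assms(2) by (meson atLeastAtMost_iff bdd_above.I subsetD)
  have mem: "Sup S \<in> S"
    using closed_contains_Sup[OF _ bdd assms(1)] assms(3) by blast
  have "\<not> Sup S < b"
  proof
    assume "Sup S < b"
    then obtain t' where "t' \<in> S" "Sup S < t'"
      using progress[OF mem] by blast
    then show False
      using cSup_upper[OF _ bdd] by fastforce
  qed
  then show ?thesis
    using mem assms(2) by force
qed

text \<open>All that uniqueness takes from the manifold: a metric inducing the given topology, and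
  almost shortest curves. \<open>L\<close> stands for arc length along the curve and is known only
  through its increments, so no differentiability enters.\<close>

locale length_structure = Metric_space UNIV d
  for d :: "'m::t2_space \<Rightarrow> 'm \<Rightarrow> real" +
  assumes open_iff: "open W \<longleftrightarrow> (\<forall>x\<in>W. \<exists>r>0. \<forall>y. d x y < r \<longrightarrow> y \<in> W)"
    and short_curve: "e > 0 \<Longrightarrow> \<exists>(\<gamma>::real \<Rightarrow> 'm) L::real \<Rightarrow> real.
      continuous_on {0..1} \<gamma> \<and> continuous_on {0..1} L \<and> \<gamma> 0 = x \<and> \<gamma> 1 = y \<and>
      L 0 = 0 \<and> L 1 < d x y + e \<and>
      (\<forall>s t. 0 \<le> s \<longrightarrow> s \<le> t \<longrightarrow> t \<le> 1 \<longrightarrow> d (\<gamma> s) (\<gamma> t) \<le> L t - L s)"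
begin

text \<open>In other terms, the asymptotic Lipschitz constant of \<open>u\<close> at
  \<open>x\<close>, the limit of the Lipschitz constants on shrinking balls, is at most
  \<open>L\<close>. Both points vary, which allows the bounds to be chained along a curve.\<close>

definition local_lipschitz_const :: "('m \<Rightarrow> real) \<Rightarrow> 'm \<Rightarrow> real \<Rightarrow> bool" where
  "local_lipschitz_const u x L \<longleftrightarrow>
     (\<forall>L'>L. \<exists>U. open U \<and> x \<in> U \<and> (\<forall>y\<in>U. \<forall>z\<in>U. u z - u y \<le> L' * d y z))"

text \<open>A limsup condition: \<open>(u x - u y) / d x y\<close> has upper limit at least
  \<open>L\<close> as \<open>y\<close> tends to \<open>x\<close>. For \<open>L > 0\<close> this
  bounds from below the descending slope of metric analysis.\<close>

definition descends_at :: "('m \<Rightarrow> real) \<Rightarrow> 'm \<Rightarrow> real \<Rightarrow> bool" where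
  "descends_at u x L \<longleftrightarrow>
     (\<forall>L'<L. \<forall>U. open U \<longrightarrow> x \<in> U \<longrightarrow> (\<exists>y\<in>U. y \<noteq> x \<and> u y \<le> u x - L' * d x y))"

definition set_dist :: "'m set \<Rightarrow> 'm \<Rightarrow> real" where
  "set_dist K x = (INF y\<in>K. d x y)"

lemma open_dist_ball: "open {y. d x y < r}"
  unfolding open_iff
proof safe
  fix y assume "d x y < r"
  then show "\<exists>e>0. \<forall>z. d y z < e \<longrightarrow> z \<in> {z. d x z < r}"
    by (intro exI[of _ "r - d x y"]) (auto intro!: le_less_trans[OF triangle[of x y]])
qed

lemma ball_in_open: "open W \<Longrightarrow> x \<in> W \<Longrightarrow> \<exists>r>0. \<forall>y. d x y < r \<longrightarrow> y \<in> W"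
  using open_iff by blast

lemma set_dist_le: "k \<in> K \<Longrightarrow> set_dist K x \<le> d x k"
  unfolding set_dist_def by (rule cINF_lower) (auto intro!: bdd_belowI2[of _ 0])

lemma set_dist_greatest: "K \<noteq> {} \<Longrightarrow> (\<And>k. k \<in> K \<Longrightarrow> c \<le> d x k) \<Longrightarrow> c \<le> set_dist K x"
  unfolding set_dist_def by (rule cINF_greatest)

lemma set_dist_nonneg: "K \<noteq> {} \<Longrightarrow> 0 \<le> set_dist K x"
  by (rule set_dist_greatest) auto

lemma set_dist_lt:
  assumes "K \<noteq> {}" "set_dist K x < c"
  obtains k where "k \<in> K" "d x k < c"
  by (meson assms not_le set_dist_greatest)

lemma set_dist_zero: "k \<in> K \<Longrightarrow> set_dist K k = 0"
  using set_dist_le[of k K k] set_dist_nonneg[of K k] by (cases "K = {}") auto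

lemma set_dist_pos:
  assumes "closed K" "K \<noteq> {}" "x \<notin> K"
  shows "0 < set_dist K x"
proof -
  obtain r where r: "r > 0" "\<And>y. d x y < r \<Longrightarrow> y \<in> - K"
    using ball_in_open[of "- K" x] assms by blast
  have "r \<le> set_dist K x"
  proof (rule set_dist_greatest[OF assms(2)])
    fix k assume "k \<in> K"
    then show "r \<le> d x k" using r(2)[of k] by (meson ComplD not_le)
  qed
  then show ?thesis using r by simp
qed

lemma set_dist_lipschitz:
  assumes "K \<noteq> {}"
  shows "set_dist K z - set_dist K y \<le> d y z"
proof -
  have "set_dist K z - d y z \<le> set_dist K y"
  proof (rule set_dist_greatest[OF assms])
    fix k assume "k \<in> K"
    then show "set_dist K z - d y z \<le> d y k"
      using set_dist_le[of k K z] triangle[of z y k] by (simp add: commute)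
  qed
  then show ?thesis by simp
qed

lemma local_lipschitz_const_isCont:
  assumes "local_lipschitz_const u x L"
  shows "isCont u x"
  unfolding isCont_def tendsto_iff
proof (intro allI impI)
  fix e :: real assume e: "e > 0"
  obtain U where U: "open U" "x \<in> U" "\<And>y z. y \<in> U \<Longrightarrow> z \<in> U \<Longrightarrow> u z - u y \<le> (\<bar>L\<bar> + 1) * d y z"
    using assms[unfolded local_lipschitz_const_def, rule_format, of "\<bar>L\<bar> + 1"] by fastforce
  let ?B = "{y. d x y < e / (\<bar>L\<bar> + 1)}"
  have "open (U \<inter> ?B)" "x \<in> U \<inter> ?B"
    using U open_dist_ball e by (auto simp: divide_pos_pos add_nonneg_pos)
  moreover have "dist (u y) (u x) < e" if y: "y \<in> U \<inter> ?B" for y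
  proof -
    have "\<bar>u y - u x\<bar> \<le> (\<bar>L\<bar> + 1) * d x y"
      using U(3)[of x y] U(3)[of y x] y U(2) by (auto simp: commute)
    also have "\<dots> < e"
      using y by (simp add: field_simps add_nonneg_pos)
    finally show ?thesis by (simp add: dist_real_def)
  qed
  ultimately show "\<forall>\<^sub>F y in at x. dist (u y) (u x) < e"
    unfolding eventually_at_topological by blast
qed

lemma set_dist_local_lipschitz: "K \<noteq> {} \<Longrightarrow> local_lipschitz_const (set_dist K) x 1"
  unfolding local_lipschitz_const_def
proof (intro allI impI exI[of _ UNIV] conjI ballI)
  fix L' y z assume "K \<noteq> {}" "(1::real) < L'"
  then show "set_dist K z - set_dist K y \<le> L' * d y z"
    using set_dist_lipschitz[of K z y] mult_right_mono[of 1 L' "d y z"] by simp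
qed auto

lemma continuous_set_dist: "K \<noteq> {} \<Longrightarrow> continuous_on UNIV (set_dist K)"
  by (simp add: continuous_at_imp_continuous_on
      local_lipschitz_const_isCont[OF set_dist_local_lipschitz])

text \<open>A point on an almost shortest curve from \<open>x\<close> to \<open>K\<close>, at small
  distance \<open>r\<close> from \<open>x\<close>, has used up at least \<open>r\<close> of the
  length; what remains bounds its distance to \<open>K\<close>.\<close>

lemma set_dist_descends:
  assumes "closed K" "K \<noteq> {}" "x \<notin> K"
  shows "descends_at (set_dist K) x 1"
  unfolding descends_at_def
proof (intro allI impI)
  fix \<theta> :: real and U assume \<theta>: "\<theta> < 1" and U: "open U" "x \<in> U"
  obtain r0 where r0: "r0 > 0" "\<And>y. d x y < r0 \<Longrightarrow> y \<in> U"
    using ball_in_open[OF U] by blast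
  \<comment> \<open>Being below \<open>set_dist K x\<close> makes the curve, whose end is at least
    that far away, cross distance \<open>r\<close>; being below \<open>r0\<close> keeps the crossing
    point in \<open>U\<close>.\<close>
  define r where "r = min (r0 / 2) (set_dist K x / 2)"
  have r: "r > 0" "r < r0" "r < set_dist K x"
    using r0 set_dist_pos[OF assms] by (auto simp: r_def)
  \<comment> \<open>The choice of \<open>k\<close> and the choice of the curve each lose less than
    \<open>e\<close>, together less than \<open>(1 - \<theta>) * r\<close>.\<close>
  define e where "e = (1 - \<theta>) * r / 2"
  have e: "e > 0" using \<theta> r by (simp add: e_def)
  obtain k where k: "k \<in> K" "d x k < set_dist K x + e"
    using set_dist_lt[OF assms(2), of x "set_dist K x + e"] e by force
  obtain \<gamma> L where \<gamma>: "continuous_on {0..1} \<gamma>" "\<gamma> (0::real) = x" "\<gamma> 1 = k"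
    and L: "L 0 = 0" "L 1 < d x k + e"
    and dL: "\<And>s t. 0 \<le> s \<Longrightarrow> s \<le> t \<Longrightarrow> t \<le> 1 \<Longrightarrow> d (\<gamma> s) (\<gamma> t) \<le> L t - L s"
    using short_curve[OF e, of x k] by blast
  have "{x} \<noteq> {}" by simp
  then have "continuous_on UNIV (set_dist {x})" by (rule continuous_set_dist)
  then have "continuous_on UNIV (\<lambda>y. d x y)"
    by (simp add: set_dist_def[abs_def] commute)
  then have "continuous_on {0..1} (\<lambda>t. d x (\<gamma> t))"
    by (rule continuous_on_compose2[OF _ \<gamma>(1)]) auto
  then obtain t where t: "0 \<le> t" "t \<le> 1" "d x (\<gamma> t) = r"
    using IVT'[of "\<lambda>t. d x (\<gamma> t)" 0 r 1] \<gamma> r set_dist_le[OF k(1), of x] by force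
  have "set_dist K (\<gamma> t) \<le> L 1 - L t"
    using set_dist_le[OF k(1), of "\<gamma> t"] dL[of t 1] t \<gamma> by force
  also have "\<dots> \<le> L 1 - r"
    using dL[of 0 t] t \<gamma> L by force
  also have "\<dots> \<le> set_dist K x - \<theta> * d x (\<gamma> t)"
    using L k t(3) by (simp add: e_def field_simps)
  finally show "\<exists>y\<in>U. y \<noteq> x \<and> set_dist K y \<le> set_dist K x - \<theta> * d x y"
    using t r r0 by (intro bexI[of _ "\<gamma> t"]) auto
qed

section \<open>Comparison with the distance to a closed set\<close>

lemma le_set_dist:
  assumes "K \<noteq> {}" and cont: "continuous_on UNIV u" and zero: "\<And>k. k \<in> K \<Longrightarrow> u k = 0"
    and lip: "\<And>x. x \<notin> K \<Longrightarrow> local_lipschitz_const u x 1"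
  shows "u x \<le> set_dist K x"
proof -
  have bound: "u x \<le> \<theta> * (d x k + e)" if k: "k \<in> K" and \<theta>: "\<theta> > 1" and e: "e > 0" for k \<theta> e
  proof (rule ccontr)
    assume neg: "\<not> ?thesis"
    obtain \<gamma> L where \<gamma>: "continuous_on {0..1} \<gamma>" "\<gamma> (0::real) = x" "\<gamma> 1 = k"
      and L: "continuous_on {0..1} L" "L 0 = 0" "L 1 < d x k + e"
      and dL: "\<And>s t. 0 \<le> s \<Longrightarrow> s \<le> t \<Longrightarrow> t \<le> 1 \<Longrightarrow> d (\<gamma> s) (\<gamma> t) \<le> L t - L s"
      using short_curve[OF e, of x k] by blast
    let ?F = "\<lambda>t. u (\<gamma> t) + \<theta> * L t"
    define S where "S = {t\<in>{0..1}. u x \<le> ?F t}"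
    have contF: "continuous_on {0..1} ?F"
      by (intro continuous_intros L continuous_on_compose2[OF cont \<gamma>(1)]) auto
    have "1 \<in> S"
    proof (rule closed_progress_reaches_end)
      have "S = {0..1} \<inter> ?F -` {u x..}" unfolding S_def by auto
      then show "closed S"
        using continuous_closed_preimage[OF contF closed_atLeastAtMost closed_atLeast[of "u x"]]
        by simp
    next
      fix t assume t: "t \<in> S" "t < 1"
      have "L t \<le> L 1" using dL[of t 1] t order_trans[OF nonneg, of "\<gamma> t" "\<gamma> 1" "L 1 - L t"] by (auto simp: S_def)
      \<comment> \<open>A time in \<open>S\<close> at which the curve meets \<open>K\<close> would
        already give the bound being refuted. This replaces a first hitting time: the Lipschitz
        property is available at every time in \<open>S\<close> considered here.\<close>
      have "\<gamma> t \<notin> K"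
      proof
        assume "\<gamma> t \<in> K"
        then have "u x \<le> \<theta> * L t" using t zero by (auto simp: S_def)
        also have "\<dots> \<le> \<theta> * (d x k + e)"
          using \<open>L t \<le> L 1\<close> L(3) \<theta> by (intro mult_left_mono) auto
        finally show False using neg by simp
      qed
      then obtain U where U: "open U" "\<gamma> t \<in> U"
        "\<And>y z. y \<in> U \<Longrightarrow> z \<in> U \<Longrightarrow> u z - u y \<le> \<theta> * d y z"
        using lip[OF \<open>\<gamma> t \<notin> K\<close>, unfolded local_lipschitz_const_def, rule_format, OF \<theta>]
        by blast
      obtain B where B: "open B" "t \<in> B" "\<And>s. s \<in> {0..1} \<Longrightarrow> s \<in> B \<Longrightarrow> \<gamma> s \<in> U"
        using \<gamma>(1)[unfolded continuous_on_topological, rule_format, of t U] t U(1,2)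
        by (auto simp: S_def)
      obtain r where r: "r > 0" "\<And>s. \<bar>s - t\<bar> < r \<Longrightarrow> s \<in> B"
        using B(1,2) unfolding open_dist dist_real_def by blast
      define s where "s = min 1 (t + r / 2)"
      have s: "t < s" "s \<le> 1" "0 \<le> s" "\<bar>s - t\<bar> < r" using t r by (auto simp: s_def S_def min_def)
      have "u (\<gamma> t) - u (\<gamma> s) \<le> \<theta> * d (\<gamma> s) (\<gamma> t)"
        using U(3)[OF B(3)[OF _ r(2)] U(2), of s] s by simp
      also have "\<dots> \<le> \<theta> * (L s - L t)"
        using dL[of t s] s t \<theta> commute[of "\<gamma> s" "\<gamma> t"]
        by (intro mult_left_mono) (simp_all add: S_def)
      finally have "?F t \<le> ?F s" by (simp add: algebra_simps)
      then have "s \<in> S" using t s by (auto simp: S_def)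
      then show "\<exists>t'\<in>S. t < t'" using s by blast
    qed (auto simp: S_def \<gamma> L)
    then have "u x \<le> \<theta> * L 1" using \<gamma> zero k by (simp add: S_def)
    also have "\<dots> \<le> \<theta> * (d x k + e)" using L \<theta> by (intro mult_left_mono) auto
    finally show False using neg by simp
  qed
  show ?thesis
  proof (rule set_dist_greatest[OF assms(1)])
    fix k assume k: "k \<in> K"
    have "((\<lambda>e. (1 + e) * (d x k + e)) \<longlongrightarrow> (1 + 0) * (d x k + 0)) (at_right 0)"
      by (intro tendsto_intros)
    moreover have "\<forall>\<^sub>F e in at_right 0. u x \<le> (1 + e) * (d x k + e)"
      using bound[OF k] by (auto simp: eventually_at_filter)
    ultimately show "u x \<le> d x k"
      using tendsto_lowerbound[of "\<lambda>e. (1 + e) * (d x k + e)" "(1 + 0) * (d x k + 0)" "at_right 0" "u x"]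
      by simp
  qed
qed

text \<open>Each point of the sequence \<open>a\<close> almost minimises \<open>u\<close> among the points that descend from its
  predecessor with rate \<open>\<theta>\<close>.\<close>

lemma ekeland:
  assumes complete: mcomplete and cont: "continuous_on UNIV u" and bdd: "bdd_below (range u)"
    and \<theta>: "\<theta> > 0"
  obtains y where "u y \<le> u x - \<theta> * d x y" "\<And>z. z \<noteq> y \<Longrightarrow> u z > u y - \<theta> * d y z"
proof -
  define S where "S y = {z. u z + \<theta> * d y z \<le> u y}" for y
  have S_refl: "y \<in> S y" for y by (simp add: S_def)
  have S_trans: "z \<in> S x" if "y \<in> S x" "z \<in> S y" for x y z
  proof -
    have "\<theta> * d x z \<le> \<theta> * d x y + \<theta> * d y z"
      using mult_left_mono[OF triangle[of x y z], of \<theta>] \<theta> by (simp add: algebra_simps)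
    then show ?thesis using that by (simp add: S_def)
  qed
  have bddS: "bdd_below (u ` S y)" for y
    using bdd by (meson bdd_below_mono image_mono subset_UNIV)
  define a where "a = rec_nat x (\<lambda>n y. SOME z. z \<in> S y \<and> u z \<le> Inf (u ` S y) + 1 / 2 ^ n)"
  have a0: "a 0 = x" by (simp add: a_def)
  have aSuc: "a (Suc n) \<in> S (a n) \<and> u (a (Suc n)) \<le> Inf (u ` S (a n)) + 1 / 2 ^ n" for n
  proof -
    have "\<exists>z\<in>S (a n). u z < Inf (u ` S (a n)) + 1 / 2 ^ n"
      using cInf_lessD[of "u ` S (a n)" "Inf (u ` S (a n)) + 1 / 2 ^ n"] S_refl by force
    then have "\<exists>z. z \<in> S (a n) \<and> u z \<le> Inf (u ` S (a n)) + 1 / 2 ^ n"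
      by (auto intro: less_imp_le)
    from someI_ex[OF this] show ?thesis by (simp add: a_def)
  qed
  have mem: "a m \<in> S (a n)" if "n \<le> m" for n m
    using that by (induction m rule: dec_induct) (auto intro: S_refl S_trans aSuc[THEN conjunct1])
  have dist: "\<theta> * d (a n) (a m) \<le> u (a n) - u (a m)" if "n \<le> m" for n m
    using mem[OF that] by (simp add: S_def)
  have dec: "decseq (\<lambda>n. u (a n))"
    unfolding decseq_def
  proof (intro allI impI)
    fix m n :: nat assume "m \<le> n"
    moreover have "0 \<le> \<theta> * d (a m) (a n)" using \<theta> by simp
    ultimately show "u (a n) \<le> u (a m)" using dist[of m n] by linarith
  qed
  obtain c where "\<And>n. c \<le> u (a n)" using bdd by (auto simp: bdd_below_def)
  then have conv: "convergent (\<lambda>n. u (a n))"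
    using decseq_convergent[OF dec, of c] unfolding convergent_def by metis
  have "MCauchy a"
    unfolding MCauchy_def
  proof safe
    fix e :: real assume "e > 0"
    then obtain N where N: "\<And>m n. N \<le> m \<Longrightarrow> N \<le> n \<Longrightarrow> dist (u (a m)) (u (a n)) < \<theta> * e"
      using conv[THEN convergent_Cauchy] \<theta> unfolding Cauchy_def by (metis mult_pos_pos)
    have "d (a n) (a m) < e" if "N \<le> n" "n \<le> m" for n m
    proof -
      have "\<theta> * d (a n) (a m) < \<theta> * e"
        using dist[OF that(2)] N[of n m] that by (auto simp: dist_real_def)
      then show ?thesis using \<theta> by simp
    qed
    then show "\<exists>N. \<forall>n n'. N \<le> n \<longrightarrow> N \<le> n' \<longrightarrow> d (a n) (a n') < e"
      by (metis commute nle_le)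
  qed auto
  then obtain y where "limitin mtopology a y sequentially"
    using complete unfolding mcomplete_def by blast
  then have lim: "(\<lambda>n. d (a n) y) \<longlonglongrightarrow> 0" by (simp add: limitin_metric_dist_null)
  have "(a \<longlongrightarrow> y) sequentially"
  proof (rule topological_tendstoI)
    fix W assume "open W" "y \<in> W"
    then obtain r where r: "r > 0" "\<And>z. d y z < r \<Longrightarrow> z \<in> W" using ball_in_open by blast
    from order_tendstoD(2)[OF lim r(1)] show "\<forall>\<^sub>F n in sequentially. a n \<in> W"
      by eventually_elim (auto simp: r(2) commute)
  qed
  then have ulim: "(\<lambda>n. u (a n)) \<longlonglongrightarrow> u y"
    by (rule continuous_on_tendsto_compose[OF cont]) auto
  have yS: "y \<in> S (a n)" for n
  proof -
    have "(\<lambda>m. d (a n) (a m)) \<longlonglongrightarrow> d (a n) y"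
    proof (rule LIM_zero_cancel)
      have "norm (d (a n) (a m) - d (a n) y) \<le> d (a m) y" for m
        using mdist_reverse_triangle[of "a m" "a n" y] by (simp add: commute)
      then show "(\<lambda>m. d (a n) (a m) - d (a n) y) \<longlonglongrightarrow> 0"
        by (intro Lim_null_comparison[OF _ lim]) simp
    qed
    then have "(\<lambda>m. u (a m) + \<theta> * d (a n) (a m)) \<longlonglongrightarrow> u y + \<theta> * d (a n) y"
      by (intro tendsto_intros ulim)
    then have "u y + \<theta> * d (a n) y \<le> u (a n)"
      by (rule LIMSEQ_le_const2) (use mem in \<open>auto simp: S_def intro: exI[of _ n]\<close>)
    then show ?thesis by (simp add: S_def)
  qed
  show ?thesis
  proof
    show "u y \<le> u x - \<theta> * d x y" using yS[of 0] a0 by (simp add: S_def)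
    fix z assume "z \<noteq> y"
    show "u z > u y - \<theta> * d y z"
    proof (rule ccontr)
      assume "\<not> ?thesis"
      then have z: "z \<in> S y" by (simp add: S_def)
      \<comment> \<open>As \<open>z\<close> lies in every \<open>S (a n)\<close>, almost minimality
        of the next term compares it with \<open>u z\<close>. The limit gives
        \<open>u y \<le> u z\<close>, which is incompatible with descent from \<open>y\<close> to a
        different point \<open>z\<close>.\<close>
      have "u (a (Suc n)) \<le> u z + (1 / 2) ^ n" for n
      proof -
        have "Inf (u ` S (a n)) \<le> u z"
          by (intro cINF_lower bddS S_trans[OF yS z])
        then show ?thesis using aSuc[of n] by (simp add: power_one_over)
      qed
      moreover have "(\<lambda>n. u z + (1 / 2) ^ n) \<longlonglongrightarrow> u z + 0"
        by (intro tendsto_intros LIMSEQ_power_zero) auto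
      ultimately have "u y \<le> u z"
        using LIMSEQ_le[OF LIMSEQ_Suc[OF ulim]] by auto
      then have "\<theta> * d y z \<le> 0" using z by (simp add: S_def)
      then show False using \<theta> \<open>z \<noteq> y\<close> nonneg[of y z] zero[of y z] by (auto simp: mult_le_0_iff)
    qed
  qed
qed

lemma set_dist_le_of_descends:
  assumes complete: mcomplete and "K \<noteq> {}" and cont: "continuous_on UNIV u"
    and bdd: "bdd_below (range u)" and zero: "\<And>k. k \<in> K \<Longrightarrow> u k = 0"
    and desc: "\<And>x. x \<notin> K \<Longrightarrow> descends_at u x 1"
  shows "set_dist K x \<le> u x"
proof -
  have bound: "(1 - e) * set_dist K x \<le> u x" if "0 < e" "e < 1" for e
  proof -
    have pos: "1 - e > 0" using that by simp
    obtain y where y: "u y \<le> u x - (1 - e) * d x y"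
      "\<And>z. z \<noteq> y \<Longrightarrow> u z > u y - (1 - e) * d y z"
      using ekeland[OF complete cont bdd pos, of x] by blast
    have "y \<in> K"
    proof (rule ccontr)
      assume "y \<notin> K"
      then obtain z where "z \<noteq> y" "u z \<le> u y - (1 - e) * d y z"
        using desc[unfolded descends_at_def, rule_format, of y "1 - e" UNIV] \<open>0 < e\<close> by auto
      then show False using y(2)[of z] by simp
    qed
    then have "(1 - e) * set_dist K x \<le> (1 - e) * d x y"
      using set_dist_le pos by (intro mult_left_mono) auto
    then show ?thesis using y(1) zero[OF \<open>y \<in> K\<close>] by linarith
  qed
  have "((\<lambda>e. (1 - e) * set_dist K x) \<longlongrightarrow> (1 - 0) * set_dist K x) (at_right 0)"
    by (intro tendsto_intros)
  moreover have "\<forall>\<^sub>F e in at_right 0. (1 - e) * set_dist K x \<le> u x"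
    using bound eventually_at_right[of "0::real" 1] by (auto intro: exI[of _ 1])
  ultimately show ?thesis
    using tendsto_upperbound[of "\<lambda>e. (1 - e) * set_dist K x" "(1 - 0) * set_dist K x" "at_right 0" "u x"]
    by simp
qed

lemma set_dist_unique:
  assumes mcomplete "K \<noteq> {}" "continuous_on UNIV u" "bdd_below (range u)"
    and "\<And>k. k \<in> K \<Longrightarrow> u k = 0"
    and "\<And>x. x \<notin> K \<Longrightarrow> local_lipschitz_const u x 1" "\<And>x. x \<notin> K \<Longrightarrow> descends_at u x 1"
  shows "u = set_dist K"
  using le_set_dist[of K u] set_dist_le_of_descends[of K u] assms
  by (intro ext antisym) auto

section \<open>Passing between a function and half its square\<close>

lemma isCont_less_nhd:
  fixes w :: "'m \<Rightarrow> real"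
  assumes "isCont w x" "w x < c"
  obtains U where "open U" "x \<in> U" "\<And>y. y \<in> U \<Longrightarrow> w y < c"
  using assms continuous_at_open[of x w] open_lessThan[of c] by (metis lessThan_iff)

lemma isCont_greater_nhd:
  fixes w :: "'m \<Rightarrow> real"
  assumes "isCont w x" "c < w x"
  obtains U where "open U" "x \<in> U" "\<And>y. y \<in> U \<Longrightarrow> c < w y"
  using assms continuous_at_open[of x w] open_greaterThan[of c] by (metis greaterThan_iff)

text \<open>The difference of half squares is \<open>w z - w y\<close> times the mean of the two
  values, and the mean tends to \<open>w x\<close>.\<close>

lemma local_lipschitz_const_half_square:
  assumes w: "\<And>y. 0 \<le> w y" and cont: "isCont w x" and lip: "local_lipschitz_const w x 1"
  shows "local_lipschitz_const (\<lambda>y. (w y)\<^sup>2 / 2) x (w x)"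
  unfolding local_lipschitz_const_def
proof (intro allI impI)
  fix L' assume L': "w x < L'"
  have pos: "0 < L'" using w[of x] L' by linarith
  \<comment> \<open>\<open>L'\<close> is split into a Lipschitz rate \<open>M > 1\<close> for
    \<open>w\<close> and a bound \<open>L' / M > w x\<close> for the mean. The summand 1 in the
    denominator keeps \<open>M\<close> meaningful when \<open>w x = 0\<close>.\<close>
  define M where "M = 1 + (L' - w x) / (2 * (w x + 1))"
  have M: "M > 1" using L' w[of x] by (simp add: M_def divide_pos_pos)
  have "(L' - w x) * w x < (L' - w x) * (2 * (w x + 1))"
    using L' w[of x] by (intro mult_strict_left_mono) auto
  then have "(L' - w x) * w x / (2 * (w x + 1)) < L' - w x"
    using w[of x] by (simp add: divide_less_eq)
  then have "M * w x < L'" by (simp add: M_def algebra_simps)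
  then have "w x < L' / M" using M by (simp add: field_simps)
  then obtain V where V: "open V" "x \<in> V" "\<And>y. y \<in> V \<Longrightarrow> w y < L' / M"
    using isCont_less_nhd[OF cont] by blast
  obtain U where U: "open U" "x \<in> U" "\<And>y z. y \<in> U \<Longrightarrow> z \<in> U \<Longrightarrow> w z - w y \<le> M * d y z"
    using lip[unfolded local_lipschitz_const_def, rule_format, OF M] by blast
  show "\<exists>U. open U \<and> x \<in> U \<and> (\<forall>y\<in>U. \<forall>z\<in>U. (w z)\<^sup>2 / 2 - (w y)\<^sup>2 / 2 \<le> L' * d y z)"
  proof (intro exI conjI ballI)
    show "open (U \<inter> V)" "x \<in> U \<inter> V" using U V by auto
    fix y z assume yz: "y \<in> U \<inter> V" "z \<in> U \<inter> V"
    have eq: "(w z)\<^sup>2 / 2 - (w y)\<^sup>2 / 2 = (w z - w y) * ((w z + w y) / 2)"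
      by (simp add: power2_eq_square field_simps)
    have "(w z - w y) * ((w z + w y) / 2) \<le> (M * d y z) * (L' / M)"
    proof (rule mult_mono)
      have "(w z + w y) / 2 \<le> c" if "w y < c" "w z < c" for c :: real using that by argo
      then show "(w z + w y) / 2 \<le> L' / M" using V(3) yz by blast
      show "0 \<le> (w z + w y) / 2" using w[of y] w[of z] by simp
    qed (use U(3) yz M in auto)
    then show "(w z)\<^sup>2 / 2 - (w y)\<^sup>2 / 2 \<le> L' * d y z"
      using M eq by (simp add: mult.commute)
  qed
qed

text \<open>Here the mean is divided out, so it has to stay away from 0 near \<open>x\<close>; this
  is the use of \<open>w x > 0\<close>.\<close>

lemma local_lipschitz_const_of_half_square:
  assumes w: "\<And>y. 0 \<le> w y" and cont: "isCont w x" and pos: "w x > 0"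
    and lip: "local_lipschitz_const (\<lambda>y. (w y)\<^sup>2 / 2) x (w x)"
  shows "local_lipschitz_const w x 1"
  unfolding local_lipschitz_const_def
proof (intro allI impI)
  fix L' :: real assume L': "1 < L'"
  \<comment> \<open>Strictly between \<open>w x\<close> and \<open>L' * w x\<close>: above the first
    so that the hypothesis applies, below the second so that \<open>L1 / L'\<close> is a lower bound
    for the mean near \<open>x\<close>.\<close>
  define L1 where "L1 = w x * ((1 + L') / 2)"
  have L1: "w x < L1" "L1 > 0" using L' pos by (auto simp: L1_def)
  have "w x * ((1 + L') / 2) < w x * L'" using L' pos by (intro mult_strict_left_mono) auto
  then have "L1 / L' < w x" using L' by (simp add: L1_def field_simps)
  then obtain V where V: "open V" "x \<in> V" "\<And>y. y \<in> V \<Longrightarrow> L1 / L' < w y"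
    using isCont_greater_nhd[OF cont] by blast
  obtain U where U: "open U" "x \<in> U"
      "\<And>y z. y \<in> U \<Longrightarrow> z \<in> U \<Longrightarrow> (w z)\<^sup>2 / 2 - (w y)\<^sup>2 / 2 \<le> L1 * d y z"
    using lip[unfolded local_lipschitz_const_def, rule_format, OF L1(1)] by blast
  show "\<exists>U. open U \<and> x \<in> U \<and> (\<forall>y\<in>U. \<forall>z\<in>U. w z - w y \<le> L' * d y z)"
  proof (intro exI conjI ballI)
    show "open (U \<inter> V)" "x \<in> U \<inter> V" using U V by auto
    fix y z assume yz: "y \<in> U \<inter> V" "z \<in> U \<inter> V"
    show "w z - w y \<le> L' * d y z"
    proof (cases "w z \<le> w y")
      case True
      moreover have "0 \<le> L' * d y z" using L' by simp
      ultimately show ?thesis by linarith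
    next
      case False
      have eq: "(w z)\<^sup>2 / 2 - (w y)\<^sup>2 / 2 = (w z - w y) * ((w z + w y) / 2)"
        by (simp add: power2_eq_square field_simps)
      have "c \<le> (w z + w y) / 2" if "c < w y" "c < w z" for c :: real using that by argo
      then have "L1 / L' \<le> (w z + w y) / 2" using V(3) yz by blast
      then have "(w z - w y) * (L1 / L') \<le> (w z - w y) * ((w z + w y) / 2)"
        using False by (intro mult_left_mono) auto
      also have "\<dots> \<le> L1 * d y z" using U(3)[of y z] yz eq by simp
      finally have "L1 * (w z - w y) \<le> L1 * (L' * d y z)"
        using L' by (simp add: field_simps)
      then show ?thesis using L1(2) by simp
    qed
  qed
qed

lemma descends_at_half_square:
  assumes w: "\<And>y. 0 \<le> w y" and cont: "isCont w x" and pos: "w x > 0"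
    and desc: "descends_at w x 1"
  shows "descends_at (\<lambda>y. (w y)\<^sup>2 / 2) x (w x)"
  unfolding descends_at_def
proof (intro allI impI)
  fix L' U assume L': "L' < w x" and U: "open U" "x \<in> U"
  \<comment> \<open>A negative rate is replaced by 0 so that inequalities can be multiplied. With
    \<open>c\<close> strictly between \<open>L0\<close> and \<open>w x\<close>, the rate
    \<open>L0 / c\<close> is admissible for \<open>w\<close>, and the mean near \<open>x\<close>
    exceeds \<open>c\<close>.\<close>
  define L0 where "L0 = max L' 0"
  define c where "c = (L0 + w x) / 2"
  have c: "0 \<le> L0" "L' \<le> L0" "L0 < c" "c < w x" "c > 0"
    using L' pos by (auto simp: L0_def c_def)
  obtain V where V: "open V" "x \<in> V" "\<And>y. y \<in> V \<Longrightarrow> c < w y"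
    using isCont_greater_nhd[OF cont c(4)] by blast
  have "L0 / c < 1" using c by simp
  from desc[unfolded descends_at_def, rule_format, OF this, of "U \<inter> V"]
  obtain y where y: "y \<in> U" "y \<in> V" "y \<noteq> x" "w y \<le> w x - L0 / c * d x y"
    using U V by auto
  have eq: "(w x)\<^sup>2 / 2 - (w y)\<^sup>2 / 2 = (w x - w y) * ((w x + w y) / 2)"
    by (simp add: power2_eq_square field_simps)
  have "(L0 / c * d x y) * c \<le> (w x - w y) * ((w x + w y) / 2)"
    using y(4) c V(3)[OF y(2)] nonneg[of x y] order_trans[of 0 "L0 / c * d x y" "w x - w y"]
    by (intro mult_mono) auto
  then have "L0 * d x y \<le> (w x)\<^sup>2 / 2 - (w y)\<^sup>2 / 2" using c eq by simp
  moreover have "L' * d x y \<le> L0 * d x y" using c by (intro mult_right_mono) auto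
  ultimately have "(w y)\<^sup>2 / 2 \<le> (w x)\<^sup>2 / 2 - L' * d x y" by linarith
  then show "\<exists>y\<in>U. y \<noteq> x \<and> (w y)\<^sup>2 / 2 \<le> (w x)\<^sup>2 / 2 - L' * d x y"
    using y by blast
qed

lemma descends_at_of_half_square:
  assumes w: "\<And>y. 0 \<le> w y" and pos: "w x > 0"
    and desc: "descends_at (\<lambda>y. (w y)\<^sup>2 / 2) x (w x)"
  shows "descends_at w x 1"
  unfolding descends_at_def
proof (intro allI impI)
  fix L' :: real and U assume L': "L' < 1" and U: "open U" "x \<in> U"
  define M where "M = max L' 0"
  have M: "0 \<le> M" "L' \<le> M" "M < 1" using L' by (auto simp: M_def)
  have "M * w x < w x" using M pos by simp
  from desc[unfolded descends_at_def, rule_format, OF this U]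
  obtain y where y: "y \<in> U" "y \<noteq> x" "(w y)\<^sup>2 / 2 \<le> (w x)\<^sup>2 / 2 - M * w x * d x y"
    by auto
  have "0 \<le> M * w x * d x y" using M pos by simp
  then have "(w y)\<^sup>2 \<le> (w x)\<^sup>2" using y(3) by argo
  \<comment> \<open>Descent makes \<open>w x\<close> itself an upper bound for the mean of the two
    values.\<close>
  then have le: "w y \<le> w x" using pos by (rule power2_le_imp_le[OF _ less_imp_le])
  have "M * w x * d x y \<le> (w x - w y) * ((w x + w y) / 2)"
    using y(3) by (simp add: power2_eq_square field_simps)
  also have "\<dots> \<le> (w x - w y) * w x" using le by (intro mult_left_mono) auto
  finally have "w x * (M * d x y) \<le> w x * (w x - w y)" by (simp add: mult_ac)
  then have "M * d x y \<le> w x - w y" using pos by simp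
  moreover have "L' * d x y \<le> M * d x y" using M by (intro mult_right_mono) auto
  ultimately have "w y \<le> w x - L' * d x y" by linarith
  then show "\<exists>y\<in>U. y \<noteq> x \<and> w y \<le> w x - L' * d x y"
    using y by blast
qed

text \<open>In the second problem the slope bound depends on the point: on a neighbourhood of
  \<open>x\<close> it holds only with a constant strictly beyond \<open>w x\<close>. This lemma and
  the next recover the limiting constant.\<close>

lemma local_lipschitz_const_dense:
  assumes "\<And>L1. L < L1 \<Longrightarrow> local_lipschitz_const u x L1"
  shows "local_lipschitz_const u x L"
  unfolding local_lipschitz_const_def
proof (intro allI impI)
  fix L' assume "L < L'"
  then obtain L1 where "L < L1" "L1 < L'" using dense by blast
  then show "\<exists>U. open U \<and> x \<in> U \<and> (\<forall>y\<in>U. \<forall>z\<in>U. u z - u y \<le> L' * d y z)"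
    using assms unfolding local_lipschitz_const_def by blast
qed

lemma descends_at_dense:
  assumes "0 < L" "\<And>L1. 0 < L1 \<Longrightarrow> L1 < L \<Longrightarrow> descends_at u x L1"
  shows "descends_at u x L"
  unfolding descends_at_def
proof (intro allI impI)
  fix L' U assume L': "L' < L" and U: "open U" "x \<in> U"
  obtain L1 where "max L' 0 < L1" "L1 < L" using dense[of "max L' 0" L] assms(1) L' by auto
  then show "\<exists>y\<in>U. y \<noteq> x \<and> u y \<le> u x - L' * d x y"
    using assms(2)[of L1] U unfolding descends_at_def by auto
qed

end

section \<open>Inner products and charts\<close>

definition form_norm :: "('e \<Rightarrow> 'e \<Rightarrow> real) \<Rightarrow> 'e \<Rightarrow> real" where
  "form_norm B a = sqrt (B a a)"

locale inner_form =
  fixes B :: "'e::euclidean_space \<Rightarrow> 'e \<Rightarrow> real"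
  assumes add_left: "B (a + b) c = B a c + B b c"
    and scale_left: "B (r *\<^sub>R a) c = r * B a c"
    and sym: "B a b = B b a"
    and pos: "a \<noteq> 0 \<Longrightarrow> 0 < B a a"
begin

abbreviation Q :: "'e \<Rightarrow> real" where "Q \<equiv> form_norm B"

lemma bounded_bilinear_B: "bounded_bilinear B"
proof -
  have l: "linear (\<lambda>a. B a b)" for b
    by (intro linearI add_left) (simp add: scale_left)
  have "linear (B a)" for a
    using l[of a] by (simp add: sym[of _ a] cong: if_cong)
  then show ?thesis
    using l by (simp add: bilinear_conv_bounded_bilinear[symmetric] bilinear_def)
qed

sublocale bounded_bilinear B by (rule bounded_bilinear_B)

lemma nonneg: "0 \<le> B a a"
  by (cases "a = 0") (auto simp: zero_left intro: less_imp_le pos)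

lemma Q_nonneg [simp]: "0 \<le> Q a"
  by (simp add: form_norm_def nonneg)

lemma Q_square: "Q a * Q a = B a a"
  by (simp add: form_norm_def nonneg)

lemma Q_zero [simp]: "Q 0 = 0"
  by (simp add: form_norm_def zero_left)

lemma Q_pos: "a \<noteq> 0 \<Longrightarrow> 0 < Q a"
  by (simp add: form_norm_def pos)

lemma Q_scale: "Q (r *\<^sub>R a) = \<bar>r\<bar> * Q a"
proof -
  have "B (r *\<^sub>R a) (r *\<^sub>R a) = r\<^sup>2 * B a a"
    by (simp add: scaleR_left scaleR_right power2_eq_square)
  then show ?thesis by (simp add: form_norm_def real_sqrt_mult)
qed

lemma Q_minus: "Q (- a) = Q a"
  using Q_scale[of "-1" a] by simp

lemma Cauchy_Schwarz: "B a b \<le> Q a * Q b"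
proof (cases "a = 0 \<or> b = 0")
  case True
  then show ?thesis by (auto simp: zero_left zero_right)
next
  case False
  then have p: "0 < Q a" "0 < Q b" by (auto intro: Q_pos)
  have "0 \<le> B (Q b *\<^sub>R a - Q a *\<^sub>R b) (Q b *\<^sub>R a - Q a *\<^sub>R b)" by (rule nonneg)
  also have "\<dots> = Q b * Q b * B a a - 2 * (Q a * Q b) * B a b + Q a * Q a * B b b"
    using sym[of b a] by (simp add: diff_left diff_right scaleR_left scaleR_right algebra_simps)
  also have "\<dots> = 2 * (Q a * Q b) * (Q a * Q b - B a b)"
    by (simp add: Q_square[symmetric] algebra_simps)
  finally show ?thesis using p mult_pos_pos[OF p] by (auto simp: zero_le_mult_iff)
qed

lemma Q_triangle: "Q (a + b) \<le> Q a + Q b"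
proof (rule power2_le_imp_le)
  show "(Q (a + b))\<^sup>2 \<le> (Q a + Q b)\<^sup>2"
    using Cauchy_Schwarz[of a b] sym[of b a]
    by (simp add: power2_eq_square Q_square add_left add_right algebra_simps flip: Q_square)
       (simp add: Q_square add_left add_right)
qed simp

lemma continuous_B [continuous_intros]:
  "continuous_on S f \<Longrightarrow> continuous_on S h \<Longrightarrow> continuous_on S (\<lambda>t. B (f t) (h t))"
  by (rule continuous_on)

lemma continuous_Q [continuous_intros]: "continuous_on S f \<Longrightarrow> continuous_on S (\<lambda>t. Q (f t))"
  unfolding form_norm_def by (intro continuous_intros)

lemma Q_bounds:
  "\<exists>m>0. \<exists>C>0. (\<forall>a. m * norm a \<le> Q a) \<and> (\<forall>a. Q a \<le> C * norm a)"
proof -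
  obtain b :: 'e where b: "b \<in> Basis" using nonempty_Basis by blast
  have ne: "sphere 0 1 \<noteq> ({}::'e set)" using b by (auto intro!: exI[of _ b])
  have c: "continuous_on (sphere 0 1) Q" by (intro continuous_intros)
  obtain a0 where a0: "norm a0 = 1" "\<And>a. norm a = 1 \<Longrightarrow> Q a0 \<le> Q a"
    using continuous_attains_inf[OF compact_sphere ne c] by auto
  obtain a1 where a1: "norm a1 = 1" "\<And>a. norm a = 1 \<Longrightarrow> Q a \<le> Q a1"
    using continuous_attains_sup[OF compact_sphere ne c] by auto
  have p: "0 < Q a0" "0 < Q a1" using a0(1) a1(1) by (auto intro: Q_pos)
  have split: "Q a = norm a * Q (a /\<^sub>R norm a)" for a
    by (cases "a = 0") (auto simp: Q_scale)
  have "Q a0 * norm a \<le> Q a" for a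
  proof (cases "a = 0")
    case False
    then have "norm a * Q a0 \<le> norm a * Q (a /\<^sub>R norm a)"
      by (intro mult_left_mono a0) auto
    then show ?thesis using split[of a] by (simp add: mult.commute)
  qed simp
  moreover have "Q a \<le> Q a1 * norm a" for a
  proof (cases "a = 0")
    case False
    then have "norm a * Q (a /\<^sub>R norm a) \<le> norm a * Q a1"
      by (intro mult_left_mono a1) auto
    then show ?thesis using split[of a] by (simp add: mult.commute)
  qed simp
  ultimately show ?thesis using p by blast
qed

text \<open>Represents the functional \<open>B a\<close> by the Euclidean inner product. Derivatives
  of test functions are kept in the form \<open>w y \<bullet> v\<close>, so that being C1 reduces to
  continuity of the vector field \<open>w\<close>.\<close>

definition flat :: "'e \<Rightarrow> 'e" where "flat a = (\<Sum>i\<in>Basis. B a i *\<^sub>R i)"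

lemma linear_functional_sum:
  assumes "linear f"
  shows "(\<Sum>i\<in>Basis. f i *\<^sub>R i) \<bullet> b = (f b :: real)"
proof -
  have "f b = f (\<Sum>i\<in>Basis. (b \<bullet> i) *\<^sub>R i)" by (simp add: euclidean_representation)
  also have "\<dots> = (\<Sum>i\<in>Basis. (b \<bullet> i) * f i)"
    using assms by (simp add: linear_sum linear_cmul)
  also have "\<dots> = (\<Sum>i\<in>Basis. f i *\<^sub>R i) \<bullet> b"
    by (auto simp: inner_sum_left inner_commute[of b] mult.commute intro!: sum.cong)
  finally show ?thesis by simp
qed

lemma flat_inner: "flat a \<bullet> b = B a b"
  unfolding flat_def
  by (rule linear_functional_sum) (simp add: bounded_linear_right bounded_linear.linear)

lemma continuous_flat [continuous_intros]:
  "continuous_on S f \<Longrightarrow> continuous_on S (\<lambda>t. flat (f t))"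
  unfolding flat_def by (intro continuous_intros)

lemma representation:
  assumes "linear p"
  obtains w where "\<And>a. p a = B w a"
proof -
  have lin: "linear flat"
    unfolding flat_def
    by (intro linear_compose_sum ballI linearI)
       (auto simp: add_left scaleR_left scaleR_add_left)
  have "inj flat"
  proof (rule linear_injective_0[OF lin, THEN iffD2], intro allI impI)
    fix a assume "flat a = 0"
    then have "B a a = 0" using flat_inner[of a a] by simp
    then show "a = 0" using pos[of a] by force
  qed
  then have "surj flat" using linear_injective_imp_surjective[OF lin] by simp
  then obtain w where "flat w = (\<Sum>i\<in>Basis. p i *\<^sub>R i)" by (metis surjD)
  then have "p a = B w a" for a
    using flat_inner[of w a] linear_functional_sum[OF assms, of a] by simp
  then show ?thesis using that by blast
qed

lemma B_square_has_derivative: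
  "((\<lambda>y. B (y - z) (y - z)) has_derivative (\<lambda>v. 2 * B (y - z) v)) (at y)"
proof -
  have "((\<lambda>y. B (y - z) (y - z)) has_derivative (\<lambda>v. B (y - z) v + B v (y - z))) (at y)"
    by (rule FDERIV) (auto intro!: derivative_eq_intros)
  then show ?thesis by (simp add: sym[of _ "y - z"])
qed

text \<open>Reduces continuity of the metric in its base point, and closeness of two metrics, to the
  finitely many coefficients \<open>B i j\<close>.\<close>

lemma expand:
  "B a b = (\<Sum>i\<in>Basis. \<Sum>j\<in>Basis. (a \<bullet> i) * (b \<bullet> j) * B i j)"
proof -
  have "B a b = B (\<Sum>i\<in>Basis. (a \<bullet> i) *\<^sub>R i) (\<Sum>j\<in>Basis. (b \<bullet> j) *\<^sub>R j)"
    by (simp add: euclidean_representation)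
  also have "\<dots> = (\<Sum>i\<in>Basis. \<Sum>j\<in>Basis. (a \<bullet> i) * (b \<bullet> j) * B i j)"
    by (simp only: sum_left sum_right scaleR_left scaleR_right)
      (subst sum.swap, simp add: sum_distrib_left mult_ac)
  finally show ?thesis .
qed

lemma Q_has_derivative:
  assumes "y \<noteq> z"
  shows "((\<lambda>y. Q (y - z)) has_derivative (\<lambda>v. B (y - z) v / Q (y - z))) (at y)"
proof -
  have "0 < B (y - z) (y - z)" using pos[of "y - z"] assms by simp
  then have "((\<lambda>y. sqrt (B (y - z) (y - z))) has_derivative
      (\<lambda>v. 2 * B (y - z) v * (inverse (sqrt (B (y - z) (y - z))) / 2))) (at y)"
    by (intro has_derivative_real_sqrt B_square_has_derivative)
  moreover have "(\<lambda>v. 2 * B (y - z) v * (inverse (sqrt (B (y - z) (y - z))) / 2)) =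
      (\<lambda>v. B (y - z) v / sqrt (B (y - z) (y - z)))"
    by (simp add: fun_eq_iff inverse_eq_divide)
  ultimately show ?thesis unfolding form_norm_def by (simp only:)
qed

text \<open>The cone \<open>Q (y - z)\<close> has no derivative at its vertex. Adding \<delta>
  squared under the root removes the singularity, and by Cauchy-Schwarz the slope stays at most 1
  with respect to \<open>Q\<close>.\<close>

lemma regularised_cone_has_derivative:
  assumes "\<delta> > 0"
  shows "((\<lambda>y. sqrt (B (y - z) (y - z) + \<delta>\<^sup>2)) has_derivative
    (\<lambda>v. B (y - z) v / sqrt (B (y - z) (y - z) + \<delta>\<^sup>2))) (at y)"
proof -
  have "0 < B (y - z) (y - z) + \<delta>\<^sup>2" using nonneg[of "y - z"] assms by (simp add: add_nonneg_pos)
  moreover have "((\<lambda>y. B (y - z) (y - z) + \<delta>\<^sup>2) has_derivative (\<lambda>v. 2 * B (y - z) v)) (at y)"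
    using has_derivative_add[OF B_square_has_derivative has_derivative_const] by simp
  ultimately have "((\<lambda>y. sqrt (B (y - z) (y - z) + \<delta>\<^sup>2)) has_derivative
      (\<lambda>v. 2 * B (y - z) v * (inverse (sqrt (B (y - z) (y - z) + \<delta>\<^sup>2)) / 2))) (at y)"
    by (rule has_derivative_real_sqrt)
  moreover have "(\<lambda>v. 2 * B (y - z) v * (inverse (sqrt (B (y - z) (y - z) + \<delta>\<^sup>2)) / 2)) =
      (\<lambda>v. B (y - z) v / sqrt (B (y - z) (y - z) + \<delta>\<^sup>2))"
    by (simp add: fun_eq_iff inverse_eq_divide)
  ultimately show ?thesis by (simp only:)
qed

end

lemma right_derivative_ge:
  fixes f :: "real \<Rightarrow> real"
  assumes "(f has_real_derivative D) (at 0)" "\<forall>\<^sub>F t in at_right 0. k * t \<le> f t - f 0"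
  shows "k \<le> D"
proof -
  have "((\<lambda>t. (f t - f 0) / t) \<longlongrightarrow> D) (at_right 0)"
    using assms(1) unfolding has_field_derivative_iff
    by (auto intro: filterlim_mono[OF _ order_refl] simp: at_within_le_at)
  moreover have "\<forall>\<^sub>F t in at_right 0. k \<le> (f t - f 0) / t"
    using assms(2) eventually_at_right_less[of 0]
    by eventually_elim (simp add: pos_le_divide_eq)
  ultimately show ?thesis
    by (rule tendsto_lowerbound) simp
qed

lemma has_derivative_transform_nhds:
  assumes "(f has_derivative f') (at x)" "\<forall>\<^sub>F y in nhds x. f y = g y"
  shows "(g has_derivative f') (at x)"
proof (rule has_derivative_transform_eventually[OF assms(1)])
  show "\<forall>\<^sub>F y in at x. f y = g y"
    using assms(2) by (auto simp: eventually_at_filter elim: eventually_mono)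
  show "f x = g x" using assms(2) by (rule eventually_nhds_x_imp_x)
qed simp

section \<open>Charts, tangent vectors and differentials\<close>

context smooth_manifold
begin

lemma chart_inv_in:
  "c \<in> A \<Longrightarrow> y \<in> snd c ` fst c \<Longrightarrow> chart_inv c y \<in> fst c"
  "c \<in> A \<Longrightarrow> y \<in> snd c ` fst c \<Longrightarrow> snd c (chart_inv c y) = y"
  by (auto simp: inv_into_into f_inv_into_f)

lemma chart_inv_chart: "c \<in> A \<Longrightarrow> x \<in> fst c \<Longrightarrow> chart_inv c (snd c x) = x"
  using chart_homeomorphism[of c] by (simp add: homeomorphism_def)

lemma chart_inj:
  "c \<in> A \<Longrightarrow> x \<in> fst c \<Longrightarrow> y \<in> fst c \<Longrightarrow> snd c x = snd c y \<Longrightarrow> x = y"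
  by (metis chart_inv_chart)

lemma continuous_chart: "c \<in> A \<Longrightarrow> continuous_on (fst c) (snd c)"
  and continuous_chart_inv: "c \<in> A \<Longrightarrow> continuous_on (snd c ` fst c) (chart_inv c)"
  using chart_homeomorphism[of c] by (simp_all add: homeomorphism_def)

lemma open_chart_image:
  assumes "c \<in> A" "open W"
  shows "open (snd c ` (fst c \<inter> W))"
proof -
  have "snd c ` (fst c \<inter> W) = snd c ` fst c \<inter> chart_inv c -` W"
    using assms by (auto simp: chart_inv_chart)
  then show ?thesis
    using continuous_open_preimage[OF continuous_chart_inv open_image] assms by simp
qed

lemma open_chart_preimage:
  assumes "c \<in> A" "open V"
  shows "open (fst c \<inter> snd c -` V)"
  using continuous_open_preimage[OF continuous_chart open_domain] assms by simp

lemma charts_at_nonempty: "\<exists>c. c \<in> charts_at A x"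
  using charts_cover unfolding charts_at_def by (metis (mono_tags, lifting) UNIV_I UN_E mem_Collect_eq)

definition transition :: "('m, 'e) chart \<Rightarrow> ('m, 'e) chart \<Rightarrow> 'm \<Rightarrow> 'e \<Rightarrow> 'e" where
  "transition c e x = frechet_derivative (snd e \<circ> chart_inv c) (at (snd c x))"

lemma transition_Ck1:
  "c \<in> A \<Longrightarrow> e \<in> A \<Longrightarrow> Ck_on 1 (snd c ` (fst c \<inter> fst e)) (snd e \<circ> chart_inv c)"
  using smooth_transition[of c e] by (simp only: smooth_on_def)

lemma transition_has_derivative:
  assumes "c \<in> charts_at A x" "e \<in> charts_at A x"
  shows "(snd e \<circ> chart_inv c has_derivative transition c e x) (at (snd c x))"
  using transition_Ck1[of c e] assms
  by (auto simp: transition_def charts_at_def frechet_derivative_works[symmetric])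

lemma transition_linear:
  "c \<in> charts_at A x \<Longrightarrow> e \<in> charts_at A x \<Longrightarrow> linear (transition c e x)"
  by (rule has_derivative_linear[OF transition_has_derivative])

lemma continuous_transition:
  assumes "c \<in> A" "e \<in> A"
  shows "continuous_on (snd c ` (fst c \<inter> fst e))
    (\<lambda>y. frechet_derivative (snd e \<circ> chart_inv c) (at y) v)"
  using transition_Ck1[OF assms] by simp

lemma eventually_chart:
  assumes "c \<in> charts_at A x" "open W" "x \<in> W"
  shows "\<forall>\<^sub>F y in nhds (snd c x). y \<in> snd c ` (fst c \<inter> W)"
  using open_chart_image[of c W] assms
  by (auto simp: charts_at_def intro!: eventually_nhds_in_open)

lemma has_derivative_change_chart:
  assumes c: "c \<in> charts_at A x" and e: "e \<in> charts_at A x"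
    and f: "(f \<circ> chart_inv e has_derivative f') (at (snd e x))"
  shows "(f \<circ> chart_inv c has_derivative (\<lambda>v. f' (transition c e x v))) (at (snd c x))"
proof -
  have x: "(snd e \<circ> chart_inv c) (snd c x) = snd e x"
    using c by (simp add: chart_inv_chart charts_at_def)
  have "((f \<circ> chart_inv e) \<circ> (snd e \<circ> chart_inv c) has_derivative f' \<circ> transition c e x)
      (at (snd c x))"
    by (rule diff_chain_at[OF transition_has_derivative[OF c e]]) (simp add: x[simplified] f)
  moreover have "\<forall>\<^sub>F y in nhds (snd c x).
      ((f \<circ> chart_inv e) \<circ> (snd e \<circ> chart_inv c)) y = (f \<circ> chart_inv c) y"
    using eventually_chart[OF c open_domain[of e]] e
    by (auto simp: charts_at_def chart_inv_chart elim!: eventually_mono)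
      (use c in \<open>auto simp: chart_inv_chart charts_at_def\<close>)
  ultimately have "(f \<circ> chart_inv c has_derivative f' \<circ> transition c e x) (at (snd c x))"
    by (rule has_derivative_transform_nhds)
  then show ?thesis by (simp add: o_def)
qed

lemma transition_self: "c \<in> charts_at A x \<Longrightarrow> transition c c x v = v"
proof -
  assume c: "c \<in> charts_at A x"
  have "\<forall>\<^sub>F y in nhds (snd c x). y = (snd c \<circ> chart_inv c) y"
    using eventually_chart[OF c open_UNIV] c
    by (auto simp: charts_at_def chart_inv_chart elim!: eventually_mono)
  then have "(snd c \<circ> chart_inv c has_derivative (\<lambda>v. v)) (at (snd c x))"
    by (rule has_derivative_transform_nhds[OF has_derivative_ident])
  then show ?thesis
    using has_derivative_unique[OF transition_has_derivative[OF c c]] by metis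
qed

lemma transition_trans:
  assumes "c \<in> charts_at A x" "e \<in> charts_at A x" "f \<in> charts_at A x"
  shows "transition e f x (transition c e x v) = transition c f x v"
  using has_derivative_unique[OF transition_has_derivative[OF assms(1,3)]
      has_derivative_change_chart[OF assms(1,2) transition_has_derivative[OF assms(2,3)]]]
  by metis

lemma tangent_of_coords_eq:
  "tangent_of_coords A c x a = (\<lambda>e. if e \<in> charts_at A x then transition c e x a else 0)"
  unfolding tangent_of_coords_def transition_def ..

lemma tangent_of_coords_apply: "c \<in> charts_at A x \<Longrightarrow> tangent_of_coords A c x a c = a"
  by (simp add: tangent_of_coords_eq transition_self)

lemma tangent_of_coords_in:
  "c \<in> charts_at A x \<Longrightarrow> tangent_of_coords A c x a \<in> tangent_space A x"
  by (simp add: tangent_space_def tangent_of_coords_eq transition_trans flip: transition_def)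

lemma tangent_of_coords_surj:
  assumes "c \<in> charts_at A x" "v \<in> tangent_space A x"
  shows "v = tangent_of_coords A c x (v c)"
proof
  fix e
  show "v e = tangent_of_coords A c x (v c) e"
  proof (cases "e \<in> charts_at A x")
    case True
    then have "v e = transition c e x (v c)"
      using assms unfolding tangent_space_def transition_def by blast
    then show ?thesis using True by (simp add: tangent_of_coords_eq)
  next
    case False
    then have "v e = 0" using assms(2) unfolding tangent_space_def by blast
    then show ?thesis using False by (simp add: tangent_of_coords_eq)
  qed
qed

lemma tangent_of_coords_change:
  "c \<in> charts_at A x \<Longrightarrow> e \<in> charts_at A x \<Longrightarrow>
   tangent_of_coords A c x a = tangent_of_coords A e x (transition c e x a)"
  by (auto simp: tangent_of_coords_eq transition_trans)

lemma tangent_of_coords_add: "c \<in> charts_at A x \<Longrightarrow> tangent_of_coords A c x (a + b) =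
   (\<lambda>e. tangent_of_coords A c x a e + tangent_of_coords A c x b e)"
  using linear_add[OF transition_linear] by (fastforce simp: tangent_of_coords_eq)

lemma tangent_of_coords_scale: "c \<in> charts_at A x \<Longrightarrow> tangent_of_coords A c x (r *\<^sub>R a) =
   (\<lambda>e. r *\<^sub>R tangent_of_coords A c x a e)"
  using linear_cmul[OF transition_linear] by (fastforce simp: tangent_of_coords_eq)

lemma C1_function_has_derivative:
  assumes "c \<in> charts_at A x" "C1_function_on A W \<phi>" "x \<in> W"
  shows "(\<phi> \<circ> chart_inv c has_derivative frechet_derivative (\<phi> \<circ> chart_inv c) (at (snd c x)))
     (at (snd c x))"
  using assms by (auto simp: C1_function_on_def charts_at_def frechet_derivative_works[symmetric])

text \<open>\<open>differential\<close> computes in a chart picked by \<open>SOME\<close>; the chain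
  rule for the coordinate change gives the same value in any other chart.\<close>

lemma differential_coords:
  assumes c: "c \<in> charts_at A x" and "(\<phi> \<circ> chart_inv c has_derivative p) (at (snd c x))"
  shows "differential A \<phi> x (tangent_of_coords A c x a) = p a"
proof -
  let ?e = "SOME c. c \<in> charts_at A x"
  have e: "?e \<in> charts_at A x" using charts_at_nonempty by (rule someI_ex)
  have "(\<phi> \<circ> chart_inv ?e has_derivative (\<lambda>v. p (transition ?e c x v))) (at (snd ?e x))"
    by (rule has_derivative_change_chart[OF e c assms(2)])
  then have "frechet_derivative (\<phi> \<circ> chart_inv ?e) (at (snd ?e x)) = (\<lambda>v. p (transition ?e c x v))"
    by (rule frechet_derivative_at[symmetric])
  moreover have "tangent_of_coords A c x a ?e = transition c ?e x a"
    using e by (simp add: tangent_of_coords_eq)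
  ultimately show ?thesis
    using transition_trans[OF c e c] transition_self[OF c]
    by (simp add: differential_def tangent_of_coords_in[OF c] Let_def)
qed

text \<open>Test functions are written down in one chart, but \<open>C1_function_on\<close>
  quantifies over all of them. In a chart \<open>e\<close> the derivative is \<open>w\<close> paired
  with the derivative of the coordinate change, and both factors are continuous.\<close>

lemma C1_function_of_chart:
  assumes c: "c \<in> A" and V: "open V" "V \<subseteq> snd c ` fst c"
    and F: "\<And>y. y \<in> V \<Longrightarrow> (F has_derivative (\<lambda>v. w y \<bullet> v)) (at y)"
    and w: "continuous_on V w"
  shows "C1_function_on A (fst c \<inter> snd c -` V) (F \<circ> snd c)"
  unfolding C1_function_on_def
proof
  fix e assume e: "e \<in> A"
  let ?W = "fst c \<inter> snd c -` V"
  have der: "(F \<circ> snd c \<circ> chart_inv e has_derivative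
      (\<lambda>v. w (snd c x) \<bullet> transition e c x v)) (at (snd e x))" if x: "x \<in> fst e \<inter> ?W" for x
  proof -
    have ce: "c \<in> charts_at A x" "e \<in> charts_at A x" using x c e by (auto simp: charts_at_def)
    have "\<forall>\<^sub>F y in nhds (snd c x). F y = (F \<circ> snd c \<circ> chart_inv c) y"
    proof (rule eventually_mono)
      show "\<forall>\<^sub>F y in nhds (snd c x). y \<in> V"
        using x by (intro eventually_nhds_in_open V(1)) auto
      show "F y = (F \<circ> snd c \<circ> chart_inv c) y" if "y \<in> V" for y
        using V(2) that chart_inv_in(2)[OF c, of y] by auto
    qed
    moreover have "snd c x \<in> V" using x by simp
    ultimately have "(F \<circ> snd c \<circ> chart_inv c has_derivative (\<lambda>v. w (snd c x) \<bullet> v)) (at (snd c x))"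
      by (intro has_derivative_transform_nhds[OF F])
    from has_derivative_change_chart[OF ce(2,1) this] show ?thesis .
  qed
  have eq: "frechet_derivative (F \<circ> snd c \<circ> chart_inv e) (at y) v =
      w ((snd c \<circ> chart_inv e) y) \<bullet> frechet_derivative (snd c \<circ> chart_inv e) (at y) v"
    if y: "y \<in> snd e ` (fst e \<inter> ?W)" for y v
  proof -
    obtain x where x: "x \<in> fst e \<inter> ?W" "y = snd e x" using y by blast
    have "chart_inv e (snd e x) = x" using x e by (simp add: chart_inv_chart)
    then show ?thesis
      unfolding x(2) frechet_derivative_at[OF der[OF x(1)], symmetric] transition_def by simp
  qed
  have sub: "snd e ` (fst e \<inter> ?W) \<subseteq> snd e ` (fst e \<inter> fst c)" by auto
  have cont: "continuous_on (snd e ` (fst e \<inter> ?W)) (snd c \<circ> chart_inv e)"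
  proof (rule continuous_on_subset[OF _ sub])
    have "\<forall>y\<in>snd e ` (fst e \<inter> fst c). (snd c \<circ> chart_inv e) differentiable (at y)"
      using transition_Ck1[OF e c] by simp
    then show "continuous_on (snd e ` (fst e \<inter> fst c)) (snd c \<circ> chart_inv e)"
      by (intro continuous_at_imp_continuous_on ballI differentiable_imp_continuous_within) blast
  qed
  have "continuous_on (snd e ` (fst e \<inter> ?W))
     (\<lambda>y. frechet_derivative (F \<circ> snd c \<circ> chart_inv e) (at y) v)" for v
  proof -
    have "continuous_on (snd e ` (fst e \<inter> ?W)) (\<lambda>y. w ((snd c \<circ> chart_inv e) y) \<bullet>
       frechet_derivative (snd c \<circ> chart_inv e) (at y) v)"
    proof (rule continuous_on_inner)
      show "continuous_on (snd e ` (fst e \<inter> ?W)) (\<lambda>y. w ((snd c \<circ> chart_inv e) y))"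
        by (rule continuous_on_compose2[OF w cont]) (use e in \<open>auto simp: chart_inv_chart\<close>)
      show "continuous_on (snd e ` (fst e \<inter> ?W))
          (\<lambda>y. frechet_derivative (snd c \<circ> chart_inv e) (at y) v)"
        by (rule continuous_on_subset[OF continuous_transition[OF e c] sub])
    qed
    then show ?thesis by (simp only: eq cong: continuous_on_cong)
  qed
  moreover have "F \<circ> snd c \<circ> chart_inv e differentiable (at y)"
    if "y \<in> snd e ` (fst e \<inter> ?W)" for y
    using der that unfolding differentiable_def by blast
  ultimately show "Ck_on 1 (snd e ` (fst e \<inter> ?W)) (F \<circ> snd c \<circ> chart_inv e)"
    by simp
qed

end

section \<open>The metric in coordinates\<close>

context riemannian_manifold
begin

definition coord_metric :: "('m, 'e) chart \<Rightarrow> 'm \<Rightarrow> 'e \<Rightarrow> 'e \<Rightarrow> real" where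
  "coord_metric c x a b = g x (tangent_of_coords A c x a) (tangent_of_coords A c x b)"

abbreviation coord_norm :: "('m, 'e) chart \<Rightarrow> 'm \<Rightarrow> 'e \<Rightarrow> real" where
  "coord_norm c x \<equiv> form_norm (coord_metric c x)"

lemma coord_metric_inner_form:
  assumes c: "c \<in> charts_at A x"
  shows "inner_form (coord_metric c x)"
proof
  fix a b :: 'e and r :: real and v :: 'e
  show "coord_metric c x (a + b) v = coord_metric c x a v + coord_metric c x b v"
    by (simp add: coord_metric_def tangent_of_coords_add[OF c] metric_add tangent_of_coords_in[OF c])
  show "coord_metric c x (r *\<^sub>R a) b = r * coord_metric c x a b"
    by (simp add: coord_metric_def tangent_of_coords_scale[OF c] metric_scale tangent_of_coords_in[OF c])
  show "coord_metric c x a b = coord_metric c x b a"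
    by (simp add: coord_metric_def metric_sym tangent_of_coords_in[OF c])
  assume "a \<noteq> 0"
  then have "tangent_of_coords A c x a \<noteq> (\<lambda>c. 0)"
    using tangent_of_coords_apply[OF c, of a] by auto
  then show "0 < coord_metric c x a a"
    by (simp add: coord_metric_def metric_pos tangent_of_coords_in[OF c])
qed

lemma tangent_norm_coords: "tangent_norm g x (tangent_of_coords A c x a) = coord_norm c x a"
  by (simp add: tangent_norm_def form_norm_def coord_metric_def)

lemma cotangent_norm_representation:
  assumes c: "c \<in> charts_at A x" and "(\<phi> \<circ> chart_inv c has_derivative p) (at (snd c x))"
  obtains w where "\<And>a. p a = coord_metric c x w a"
    "cotangent_norm A g x (differential A \<phi> x) = coord_norm c x w"
proof -
  interpret inner_form "coord_metric c x" by (rule coord_metric_inner_form[OF c])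
  obtain w where w: "\<And>a. p a = coord_metric c x w a"
    using representation[OF has_derivative_linear[OF assms(2)]] by blast
  have "sharp A g x (differential A \<phi> x) = tangent_of_coords A c x w"
    unfolding sharp_def
  proof (rule the_equality, intro conjI ballI)
    show "tangent_of_coords A c x w \<in> tangent_space A x" by (rule tangent_of_coords_in[OF c])
    fix v assume v: "v \<in> tangent_space A x"
    show "differential A \<phi> x v = g x (tangent_of_coords A c x w) v"
      by (subst (1 2) tangent_of_coords_surj[OF c v])
        (simp add: differential_coords[OF assms] w coord_metric_def)
  next
    fix w' assume w': "w' \<in> tangent_space A x \<and> (\<forall>v\<in>tangent_space A x. differential A \<phi> x v = g x w' v)"
    have eq: "w' = tangent_of_coords A c x (w' c)" using w' by (intro tangent_of_coords_surj[OF c]) auto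
    have "coord_metric c x (w' c) a = p a" for a
      using w' tangent_of_coords_in[OF c, of a] differential_coords[OF assms, of a]
      unfolding coord_metric_def eq[symmetric] by metis
    then have "coord_metric c x (w' c - w) (w' c - w) = 0" by (simp add: diff_left w)
    then have "w' c = w" using pos[of "w' c - w"] by force
    then show "w' = tangent_of_coords A c x w" using eq by simp
  qed
  then have "cotangent_norm A g x (differential A \<phi> x) = coord_norm c x w"
    by (simp add: cotangent_norm_def tangent_norm_coords)
  then show ?thesis using that w by blast
qed

text \<open>The norm of the differential is the dual norm of its coordinate form \<open>p\<close>:
  Cauchy-Schwarz gives the first bound, testing with the coordinates \<open>w\<close> of the
  gradient the second. All later estimates of gradients go through these facts.\<close>

lemma
  assumes c: "c \<in> charts_at A x" and p: "(\<phi> \<circ> chart_inv c has_derivative p) (at (snd c x))"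
  shows cotangent_norm_bound: "p a \<le> cotangent_norm A g x (differential A \<phi> x) * coord_norm c x a"
    and cotangent_norm_least: "(\<And>a. p a \<le> L * coord_norm c x a) \<Longrightarrow> 0 \<le> L \<Longrightarrow>
      cotangent_norm A g x (differential A \<phi> x) \<le> L"
    and cotangent_norm_nonneg: "0 \<le> cotangent_norm A g x (differential A \<phi> x)"
proof -
  interpret inner_form "coord_metric c x" by (rule coord_metric_inner_form[OF c])
  obtain w where w: "\<And>a. p a = coord_metric c x w a"
    "cotangent_norm A g x (differential A \<phi> x) = coord_norm c x w"
    using cotangent_norm_representation[OF assms] by blast
  show "p a \<le> cotangent_norm A g x (differential A \<phi> x) * coord_norm c x a"
    by (simp add: w Cauchy_Schwarz)
  show "0 \<le> cotangent_norm A g x (differential A \<phi> x)" by (simp add: w)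
  show "cotangent_norm A g x (differential A \<phi> x) \<le> L"
    if "\<And>a. p a \<le> L * coord_norm c x a" "0 \<le> L"
  proof (cases "w = 0")
    case True
    then show ?thesis using that(2) by (simp add: w)
  next
    case False
    have "Q w * Q w \<le> L * Q w" using that(1)[of w] by (simp add: w Q_square)
    then show ?thesis using Q_pos[OF False] by (simp add: w)
  qed
qed

lemma coord_metric_change_chart:
  assumes "c \<in> charts_at A x" "e \<in> charts_at A x"
  shows "coord_metric e x (transition c e x a) (transition c e x b) = coord_metric c x a b"
  by (simp add: coord_metric_def flip: tangent_of_coords_change[OF assms])

lemma continuous_coord_metric:
  assumes c: "c \<in> A"
  shows "continuous_on (fst c) (\<lambda>x. coord_metric c x a b)"
proof -
  have "continuous_on (snd c ` fst c) (\<lambda>y. coord_metric c (chart_inv c y) a b)"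
    using spec[OF metric_smooth[OF c, of a b, unfolded smooth_on_def], of 0]
    by (simp add: coord_metric_def)
  from continuous_on_compose2[OF this continuous_chart[OF c]]
  have "continuous_on (fst c) (\<lambda>x. coord_metric c (chart_inv c (snd c x)) a b)" by simp
  then show ?thesis using c by (simp add: chart_inv_chart cong: continuous_on_cong)
qed

lemma continuous_coord_metric_along:
  assumes c: "c \<in> A" and \<gamma>: "continuous_on S \<gamma>" "\<gamma> ` S \<subseteq> fst c"
    and "continuous_on S D" "continuous_on S E"
  shows "continuous_on S (\<lambda>t. coord_metric c (\<gamma> t) (D t) (E t))"
proof -
  have "continuous_on S (\<lambda>t. \<Sum>i\<in>Basis. \<Sum>j\<in>Basis. (D t \<bullet> i) * (E t \<bullet> j) * coord_metric c (\<gamma> t) i j)"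
    by (intro continuous_intros assms continuous_on_compose2[OF continuous_coord_metric[OF c] \<gamma>])
  moreover have "coord_metric c (\<gamma> t) (D t) (E t) =
      (\<Sum>i\<in>Basis. \<Sum>j\<in>Basis. (D t \<bullet> i) * (E t \<bullet> j) * coord_metric c (\<gamma> t) i j)" if "t \<in> S" for t
    using \<gamma>(2) that c by (intro inner_form.expand[OF coord_metric_inner_form]) (auto simp: charts_at_def)
  ultimately show ?thesis by (simp cong: continuous_on_cong)
qed

lemma metric_comparison:
  assumes c: "c \<in> charts_at A x" and e: "0 < e" "e < 1"
  obtains W where "open W" "x \<in> W" "W \<subseteq> fst c"
    "\<And>z a. z \<in> W \<Longrightarrow> (1 - e) * coord_norm c x a \<le> coord_norm c z a"
    "\<And>z a. z \<in> W \<Longrightarrow> coord_norm c z a \<le> (1 + e) * coord_norm c x a"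
proof -
  interpret inner_form "coord_metric c x" by (rule coord_metric_inner_form[OF c])
  have cA: "c \<in> A" "x \<in> fst c" using c by (auto simp: charts_at_def)
  obtain m C where m: "0 < m" "0 < C" "\<And>a. m * norm a \<le> Q a" "\<And>a. Q a \<le> C * norm a"
    using Q_bounds by blast
  let ?\<delta> = "\<lambda>z. \<Sum>i\<in>Basis. \<Sum>j\<in>Basis. \<bar>coord_metric c z i j - coord_metric c x i j\<bar>"
  \<comment> \<open>As \<open>m * norm a \<le> Q a\<close>, coefficient errors summing to less than
    \<open>m\<^sup>2 * e\<close> change the quadratic form by at most
    \<open>e * (Q a)\<^sup>2\<close>.\<close>
  define W where "W = fst c \<inter> ?\<delta> -` {..<m\<^sup>2 * e}"
  have "continuous_on (fst c) ?\<delta>"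
    by (intro continuous_intros continuous_coord_metric cA)
  then have "open W"
    unfolding W_def by (intro continuous_open_preimage open_domain cA open_lessThan)
  moreover have "x \<in> W" using cA e m by (simp add: W_def)
  moreover have key: "\<bar>coord_metric c z a a - coord_metric c x a a\<bar> \<le> e * (Q a)\<^sup>2" if z: "z \<in> W" for z a
  proof -
    have zc: "c \<in> charts_at A z" using z cA by (auto simp: W_def charts_at_def)
    have "coord_metric c z a a - coord_metric c x a a =
        (\<Sum>i\<in>Basis. \<Sum>j\<in>Basis. (a \<bullet> i) * (a \<bullet> j) * (coord_metric c z i j - coord_metric c x i j))"
      using inner_form.expand[OF coord_metric_inner_form[OF zc], of a a] expand[of a a]
      by (simp add: sum_subtractf algebra_simps)
    also have "\<bar>\<dots>\<bar> \<le> (\<Sum>i\<in>Basis. \<Sum>j\<in>Basis. \<bar>(a \<bullet> i) * (a \<bullet> j) * (coord_metric c z i j - coord_metric c x i j)\<bar>)"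
      by (rule order_trans[OF sum_abs sum_mono[OF sum_abs]])
    also have "\<dots> \<le> (\<Sum>i\<in>Basis. \<Sum>j\<in>Basis. (norm a)\<^sup>2 * \<bar>coord_metric c z i j - coord_metric c x i j\<bar>)"
      unfolding abs_mult power2_eq_square
      by (intro sum_mono mult_right_mono mult_mono Basis_le_norm) auto
    also have "\<dots> = (norm a)\<^sup>2 * ?\<delta> z" by (simp add: sum_distrib_left)
    also have "\<dots> \<le> (norm a)\<^sup>2 * (m\<^sup>2 * e)"
      using z by (intro mult_left_mono) (auto simp: W_def)
    also have "\<dots> = e * (m * norm a)\<^sup>2" by (simp add: power_mult_distrib)
    also have "\<dots> \<le> e * (Q a)\<^sup>2" using e m by (intro mult_left_mono power_mono m) auto
    finally show ?thesis .
  qed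
  have "(1 - e) * coord_norm c x a \<le> coord_norm c z a"
    "coord_norm c z a \<le> (1 + e) * coord_norm c x a" if z: "z \<in> W" for z a
  proof -
    have zc: "c \<in> charts_at A z" using z cA by (auto simp: W_def charts_at_def)
    interpret Z: inner_form "coord_metric c z" by (rule coord_metric_inner_form[OF zc])
    have k: "\<bar>(Z.Q a)\<^sup>2 - (Q a)\<^sup>2\<bar> \<le> e * (Q a)\<^sup>2"
      using key[OF z, of a] by (simp add: power2_eq_square Q_square Z.Q_square)
    \<comment> \<open>These turn the estimate for squares into one for norms with the same
      \<open>e\<close>.\<close>
    have e2: "(1 - e)\<^sup>2 \<le> 1 - e" "1 + e \<le> (1 + e)\<^sup>2"
      using e by (auto simp: power2_eq_square algebra_simps)
    have "((1 - e) * Q a)\<^sup>2 \<le> (1 - e) * (Q a)\<^sup>2"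
      unfolding power_mult_distrib by (intro mult_right_mono e2) auto
    also have "\<dots> \<le> (Z.Q a)\<^sup>2" using k by (simp add: algebra_simps abs_le_iff)
    finally show "(1 - e) * Q a \<le> Z.Q a" by (rule power2_le_imp_le) simp
    have "(Z.Q a)\<^sup>2 \<le> (1 + e) * (Q a)\<^sup>2" using k by (simp add: algebra_simps abs_le_iff)
    also have "\<dots> \<le> ((1 + e) * Q a)\<^sup>2"
      unfolding power_mult_distrib by (intro mult_right_mono e2) auto
    finally show "Z.Q a \<le> (1 + e) * Q a" by (rule power2_le_imp_le) (use e in simp)
  qed
  ultimately show ?thesis using that[of W] by (auto simp: W_def)
qed

end

section \<open>Curves and the Riemannian distance\<close>

context smooth_manifold
begin

lemma has_vector_derivative_change_chart:
  assumes c: "c \<in> charts_at A (\<gamma> t)" and e: "e \<in> charts_at A (\<gamma> t)"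
    and cont: "continuous (at t within S) \<gamma>" and t: "t \<in> S"
    and D: "((snd c \<circ> \<gamma>) has_vector_derivative D) (at t within S)"
  shows "((snd e \<circ> \<gamma>) has_vector_derivative transition c e (\<gamma> t) D) (at t within S)"
proof -
  have "((\<lambda>s. (snd e \<circ> chart_inv c) ((snd c \<circ> \<gamma>) s)) has_derivative
      (\<lambda>h. transition c e (\<gamma> t) (h *\<^sub>R D))) (at t within S)"
    by (rule has_derivative_compose[OF D[unfolded has_vector_derivative_def]])
      (use transition_has_derivative[OF c e] in \<open>simp add: o_def\<close>)
  then have "((\<lambda>s. (snd e \<circ> chart_inv c) ((snd c \<circ> \<gamma>) s)) has_vector_derivative
      transition c e (\<gamma> t) D) (at t within S)"
    by (simp add: has_vector_derivative_def linear_cmul[OF transition_linear[OF c e]])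
  moreover have "\<forall>\<^sub>F s in at t within S. \<gamma> s \<in> fst c"
    using cont open_domain[of c] c unfolding continuous_within by (auto simp: charts_at_def intro: topological_tendstoD)
  then have "\<forall>\<^sub>F s in at t within S. (snd e \<circ> chart_inv c) ((snd c \<circ> \<gamma>) s) = (snd e \<circ> \<gamma>) s"
    by eventually_elim (use c in \<open>simp add: chart_inv_chart charts_at_def\<close>)
  ultimately show ?thesis
    unfolding has_vector_derivative_def
    by (rule has_derivative_transform_eventually)
      (use c t in \<open>simp_all add: chart_inv_chart charts_at_def\<close>)
qed

text \<open>At break points \<open>velocity\<close> is an arbitrary value and need not be a tangent
  vector. Speed formulas are therefore stated at regular times, which for a piecewise C1 curve are
  all but finitely many.\<close>

definition regular_at :: "(real \<Rightarrow> 'm) \<Rightarrow> real \<Rightarrow> bool" where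
  "regular_at \<gamma> t \<longleftrightarrow> isCont \<gamma> t \<and>
     (\<exists>c\<in>charts_at A (\<gamma> t). \<exists>D. ((snd c \<circ> \<gamma>) has_vector_derivative D) (at t))"

lemma velocity_eq:
  assumes "isCont \<gamma> t" "c \<in> charts_at A (\<gamma> t)" "((snd c \<circ> \<gamma>) has_vector_derivative D) (at t)"
  shows "velocity A \<gamma> t = tangent_of_coords A c (\<gamma> t) D"
proof
  fix e
  show "velocity A \<gamma> t e = tangent_of_coords A c (\<gamma> t) D e"
    using has_vector_derivative_change_chart[of c \<gamma> t e UNIV D] assms
    by (simp add: velocity_def tangent_of_coords_eq vector_derivative_at)
qed

lemma regular_atD:
  assumes "regular_at \<gamma> t" "c \<in> charts_at A (\<gamma> t)"
  shows "((snd c \<circ> \<gamma>) has_vector_derivative velocity A \<gamma> t c) (at t)"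
proof -
  obtain e D where e: "e \<in> charts_at A (\<gamma> t)" "((snd e \<circ> \<gamma>) has_vector_derivative D) (at t)"
    and cont: "isCont \<gamma> t"
    using assms(1) by (auto simp: regular_at_def)
  from has_vector_derivative_change_chart[OF e(1) assms(2) _ UNIV_I e(2)] cont assms(2)
  show ?thesis by (simp add: velocity_def vector_derivative_at)
qed

section \<open>Piecewise C1 curves\<close>

text \<open>The partitions of \<open>piecewise_C1_path\<close> in inductive form and on arbitrary
  intervals, so that restriction, concatenation and reparametrisation become inductions over the
  pieces.\<close>

inductive piecewise_C1 :: "real \<Rightarrow> real \<Rightarrow> (real \<Rightarrow> 'm) \<Rightarrow> bool" where
  single: "a < b \<Longrightarrow> C1_curve_on A a b \<gamma> \<Longrightarrow> piecewise_C1 a b \<gamma>"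
| append: "piecewise_C1 a b \<gamma> \<Longrightarrow> b < c \<Longrightarrow> C1_curve_on A b c \<gamma> \<Longrightarrow> piecewise_C1 a c \<gamma>"

lemma C1_curve_on_continuous: "C1_curve_on A a b \<gamma> \<Longrightarrow> continuous_on {a..b} \<gamma>"
  by (simp add: C1_curve_on_def)

lemma piecewise_C1_less: "piecewise_C1 a b \<gamma> \<Longrightarrow> a < b"
  by (induction rule: piecewise_C1.induct) auto

lemma piecewise_C1_continuous: "piecewise_C1 a b \<gamma> \<Longrightarrow> continuous_on {a..b} \<gamma>"
proof (induction rule: piecewise_C1.induct)
  case (append a b \<gamma> c)
  have "{a..c} = {a..b} \<union> {b..c}" using append piecewise_C1_less[OF append(1)] by auto
  then show ?case
    using append by (auto intro: continuous_on_closed_Un C1_curve_on_continuous)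
qed (rule C1_curve_on_continuous)

lemma piecewise_C1_join:
  "piecewise_C1 b c \<gamma> \<Longrightarrow> piecewise_C1 a b \<gamma> \<Longrightarrow> piecewise_C1 a c \<gamma>"
proof (induction rule: piecewise_C1.induct)
  case (single b c \<gamma>) show ?case by (rule piecewise_C1.append[OF single(3,1,2)])
next
  case (append b m \<gamma> c) show ?case by (rule piecewise_C1.append[OF append(4)[OF append(5)] append(2,3)])
qed

text \<open>The sign of \<open>m\<close> is free: \<open>m = -1\<close> gives reversal, and
  \<open>m = 1\<close> with \<open>k = 0\<close> gives restriction to a subinterval.\<close>

lemma C1_curve_on_affine:
  assumes \<gamma>: "C1_curve_on A a b \<gamma>" and map: "\<And>t. t \<in> {a'..b'} \<Longrightarrow> m * t + k \<in> {a..b}"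
  shows "C1_curve_on A a' b' (\<lambda>t. \<gamma> (m * t + k))"
  unfolding C1_curve_on_def
proof (intro conjI ballI)
  let ?f = "\<lambda>t. m * t + k"
  show "continuous_on {a'..b'} (\<lambda>t. \<gamma> (m * t + k))"
    by (rule continuous_on_compose2[OF C1_curve_on_continuous[OF \<gamma>]])
      (use map in \<open>auto intro!: continuous_intros\<close>)
  fix c assume "c \<in> A"
  then obtain D where D: "continuous_on {t \<in> {a..b}. \<gamma> t \<in> fst c} D"
    "\<And>t. t \<in> {a..b} \<Longrightarrow> \<gamma> t \<in> fst c \<Longrightarrow>
       ((snd c \<circ> \<gamma>) has_vector_derivative D t) (at t within {a..b})"
    using \<gamma> unfolding C1_curve_on_def by blast
  show "\<exists>D. continuous_on {t \<in> {a'..b'}. \<gamma> (m * t + k) \<in> fst c} D \<and>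
      (\<forall>t\<in>{a'..b'}. \<gamma> (m * t + k) \<in> fst c \<longrightarrow>
        ((snd c \<circ> (\<lambda>t. \<gamma> (m * t + k))) has_vector_derivative D t) (at t within {a'..b'}))"
  proof (intro exI conjI ballI impI)
    show "continuous_on {t \<in> {a'..b'}. \<gamma> (m * t + k) \<in> fst c} (\<lambda>t. m *\<^sub>R D (m * t + k))"
      by (intro continuous_intros continuous_on_compose2[OF D(1)])
        (use map in auto)
    fix t assume t: "t \<in> {a'..b'}" "\<gamma> (m * t + k) \<in> fst c"
    have "(?f has_vector_derivative m) (at t within {a'..b'})"
      by (auto intro!: derivative_eq_intros simp: has_real_derivative_iff_has_vector_derivative[symmetric])
    moreover have "((snd c \<circ> \<gamma>) has_vector_derivative D (?f t)) (at (?f t) within ?f ` {a'..b'})"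
      by (rule has_vector_derivative_within_subset[OF D(2)]) (use t map in auto)
    ultimately show "((snd c \<circ> (\<lambda>t. \<gamma> (m * t + k))) has_vector_derivative m *\<^sub>R D (m * t + k))
        (at t within {a'..b'})"
      using vector_diff_chain_within[of ?f m t "{a'..b'}" "snd c \<circ> \<gamma>" "D (?f t)"]
      by (simp add: o_def)
  qed
qed

lemma C1_curve_on_cong:
  assumes \<gamma>: "C1_curve_on A a b \<gamma>" and eq: "\<And>t. t \<in> {a..b} \<Longrightarrow> \<gamma> t = \<delta> t"
  shows "C1_curve_on A a b \<delta>"
  unfolding C1_curve_on_def
proof (intro conjI ballI)
  show "continuous_on {a..b} \<delta>"
    using continuous_on_eq[OF C1_curve_on_continuous[OF \<gamma>] eq] .
  fix c assume "c \<in> A"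
  then obtain D where D: "continuous_on {t \<in> {a..b}. \<gamma> t \<in> fst c} D"
    "\<And>t. t \<in> {a..b} \<Longrightarrow> \<gamma> t \<in> fst c \<Longrightarrow>
       ((snd c \<circ> \<gamma>) has_vector_derivative D t) (at t within {a..b})"
    using \<gamma> unfolding C1_curve_on_def by blast
  have sets: "{t \<in> {a..b}. \<gamma> t \<in> fst c} = {t \<in> {a..b}. \<delta> t \<in> fst c}" using eq by auto
  show "\<exists>D. continuous_on {t \<in> {a..b}. \<delta> t \<in> fst c} D \<and>
      (\<forall>t\<in>{a..b}. \<delta> t \<in> fst c \<longrightarrow> ((snd c \<circ> \<delta>) has_vector_derivative D t) (at t within {a..b}))"
  proof (intro exI[of _ D] conjI ballI impI)
    show "continuous_on {t \<in> {a..b}. \<delta> t \<in> fst c} D" using D(1) sets by simp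
    fix t assume t: "t \<in> {a..b}" "\<delta> t \<in> fst c"
    show "((snd c \<circ> \<delta>) has_vector_derivative D t) (at t within {a..b})"
      by (rule has_vector_derivative_transform[OF t(1) _ D(2)]) (use t eq in auto)
  qed
qed

lemma piecewise_C1_cong:
  "piecewise_C1 a b \<gamma> \<Longrightarrow> (\<And>t. t \<in> {a..b} \<Longrightarrow> \<gamma> t = \<delta> t) \<Longrightarrow> piecewise_C1 a b \<delta>"
proof (induction rule: piecewise_C1.induct)
  case (single a b \<gamma>)
  then show ?case by (blast intro: piecewise_C1.single C1_curve_on_cong)
next
  case (append a b \<gamma> c)
  note less = piecewise_C1_less[OF append(1)]
  show ?case
  proof (rule piecewise_C1.append[OF append(4) append(2) C1_curve_on_cong[OF append(3)]])
    show "\<gamma> t = \<delta> t" if "t \<in> {a..b}" for t using append(2,5) that by auto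
    show "\<gamma> t = \<delta> t" if "t \<in> {b..c}" for t using less append(5) that by auto
  qed
qed

lemma C1_curve_on_subinterval:
  "C1_curve_on A a b \<gamma> \<Longrightarrow> a \<le> s \<Longrightarrow> t \<le> b \<Longrightarrow> C1_curve_on A s t \<gamma>"
  using C1_curve_on_affine[of a b \<gamma> s t 1 0] by simp

lemma piecewise_C1_subinterval:
  "piecewise_C1 a b \<gamma> \<Longrightarrow> a \<le> s \<Longrightarrow> s < t \<Longrightarrow> t \<le> b \<Longrightarrow> piecewise_C1 s t \<gamma>"
proof (induction arbitrary: s t rule: piecewise_C1.induct)
  case (single a b \<gamma>)
  then show ?case by (blast intro: piecewise_C1.single C1_curve_on_subinterval)
next
  case (append a b \<gamma> c)
  consider "t \<le> b" | "b \<le> s" | "s < b" "b < t" by linarith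
  then show ?case
  proof cases
    case 1
    then show ?thesis using append by blast
  next
    case 2
    then show ?thesis using append by (blast intro: piecewise_C1.single C1_curve_on_subinterval)
  next
    case 3
    have "piecewise_C1 s b \<gamma>" by (rule append(4)) (use append 3 in auto)
    then show ?thesis
      using 3 append.prems by (intro piecewise_C1.append[OF _ 3(2)] C1_curve_on_subinterval[OF append(3)]) auto
  qed
qed

lemma piecewise_C1_affine:
  assumes "piecewise_C1 a b \<gamma>" and m: "m > 0"
  shows "piecewise_C1 ((a - k) / m) ((b - k) / m) (\<lambda>t. \<gamma> (m * t + k))"
  using assms(1)
proof (induction rule: piecewise_C1.induct)
  case (single a b \<gamma>)
  show ?case
    by (rule piecewise_C1.single[OF _ C1_curve_on_affine[OF single(2)]])
      (use single m in \<open>auto simp: field_simps\<close>)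
next
  case (append a b \<gamma> c)
  show ?case
    by (rule piecewise_C1.append[OF append(4) _ C1_curve_on_affine[OF append(3)]])
      (use append m in \<open>auto simp: field_simps\<close>)
qed

lemma piecewise_C1_reverse:
  "piecewise_C1 a b \<gamma> \<Longrightarrow> piecewise_C1 (- b) (- a) (\<lambda>t. \<gamma> (- t))"
proof (induction rule: piecewise_C1.induct)
  case (single a b \<gamma>)
  then show ?case using C1_curve_on_affine[of a b \<gamma> "- b" "- a" "-1" 0]
    by (auto intro: piecewise_C1.single)
next
  case (append a b \<gamma> c)
  then have "piecewise_C1 (- c) (- b) (\<lambda>t. \<gamma> (- t))"
    using C1_curve_on_affine[of b c \<gamma> "- c" "- b" "-1" 0] by (auto intro: piecewise_C1.single)
  then show ?case using append(4) by (rule piecewise_C1_join[rotated])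
qed

lemma piecewise_C1_path_iff: "piecewise_C1_path A \<gamma> \<longleftrightarrow> piecewise_C1 0 1 \<gamma>"
proof
  assume "piecewise_C1_path A \<gamma>"
  then obtain n ts where ts: "ts 0 = (0::real)" "ts n = 1"
    "\<And>i::nat. i < n \<Longrightarrow> ts i < ts (Suc i) \<and> C1_curve_on A (ts i) (ts (Suc i)) \<gamma>"
    unfolding piecewise_C1_path_def by blast
  have "piecewise_C1 (ts 0) (ts (Suc i)) \<gamma>" if "i < n" for i
    using that
  proof (induction i)
    case 0
    then show ?case using ts(3)[of 0] by (auto intro: piecewise_C1.single)
  next
    case (Suc i)
    then show ?case using ts(3)[of "Suc i"] by (auto intro: piecewise_C1.append)
  qed
  from this[of "n - 1"] ts(1,2) show "piecewise_C1 0 1 \<gamma>" by (cases n) auto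
next
  assume \<gamma>: "piecewise_C1 0 1 \<gamma>"
  have "\<exists>(n::nat) ts. ts 0 = a \<and> ts n = b \<and>
      (\<forall>i<n. ts i < ts (Suc i) \<and> C1_curve_on A (ts i) (ts (Suc i)) \<gamma>)"
    if "piecewise_C1 a b \<gamma>" for a b
    using that
  proof (induction rule: piecewise_C1.induct)
    case (single a b \<gamma>)
    then show ?case by (intro exI[of _ 1] exI[of _ "\<lambda>i. if i = 0 then a else b"]) auto
  next
    case (append a b \<gamma> c)
    then obtain n ts where ts: "ts 0 = a" "ts n = b"
      "\<And>i::nat. i < n \<Longrightarrow> ts i < ts (Suc i) \<and> C1_curve_on A (ts i) (ts (Suc i)) \<gamma>" by blast
    show ?case
    proof (intro exI conjI allI impI)
      let ?ts = "\<lambda>i. if i \<le> n then ts i else c"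
      show "?ts 0 = a" "?ts (Suc n) = c" using ts by auto
      fix i assume "i < Suc n"
      then consider "i < n" | "i = n" by linarith
      then show "?ts i < ?ts (Suc i)" "C1_curve_on A (?ts i) (?ts (Suc i)) \<gamma>"
        using ts append by (cases; auto)+
    qed
  qed
  from this[OF \<gamma>] show "piecewise_C1_path A \<gamma>"
    using piecewise_C1_continuous[OF \<gamma>] by (simp add: piecewise_C1_path_def path_def)
qed

end

section \<open>Speed and length\<close>

context riemannian_manifold
begin

definition speed :: "(real \<Rightarrow> 'm) \<Rightarrow> real \<Rightarrow> real" where
  "speed \<gamma> t = tangent_norm g (\<gamma> t) (velocity A \<gamma> t)"

definition len :: "real \<Rightarrow> real \<Rightarrow> (real \<Rightarrow> 'm) \<Rightarrow> real" where
  "len a b \<gamma> = integral {a..b} (speed \<gamma>)"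

lemma curve_length_eq: "curve_length A g \<gamma> = len 0 1 \<gamma>"
  by (simp add: curve_length_def len_def speed_def[abs_def])

lemma speed_coords:
  assumes "isCont \<gamma> t" "c \<in> charts_at A (\<gamma> t)" "((snd c \<circ> \<gamma>) has_vector_derivative D) (at t)"
  shows "speed \<gamma> t = coord_norm c (\<gamma> t) D"
  by (simp add: speed_def velocity_eq[OF assms] tangent_norm_coords)

lemma speed_regular:
  assumes "regular_at \<gamma> t" "c \<in> charts_at A (\<gamma> t)"
  shows "speed \<gamma> t = coord_norm c (\<gamma> t) (velocity A \<gamma> t c)"
  using regular_atD[OF assms] assms by (intro speed_coords) (auto simp: regular_at_def)

lemma speed_nonneg: "regular_at \<gamma> t \<Longrightarrow> 0 \<le> speed \<gamma> t"
  using charts_at_nonempty[of "\<gamma> t"] speed_regular inner_form.Q_nonneg[OF coord_metric_inner_form]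
  by metis

text \<open>\<open>speed\<close> uses two-sided derivatives and may be arbitrary at the ends of a
  piece. The function \<sigma>, built from the derivatives within the closed interval, is continuous
  up to the ends, which yields integrability.\<close>

lemma C1_curve_on_speed:
  assumes \<gamma>: "C1_curve_on A a b \<gamma>" and ab: "a < b"
  obtains \<sigma> where "continuous_on {a..b} \<sigma>"
    "\<And>t. t \<in> {a<..<b} \<Longrightarrow> regular_at \<gamma> t \<and> speed \<gamma> t = \<sigma> t"
proof -
  have "\<forall>c\<in>A. \<exists>D. continuous_on {t \<in> {a..b}. \<gamma> t \<in> fst c} D \<and>
     (\<forall>t\<in>{a..b}. \<gamma> t \<in> fst c \<longrightarrow> ((snd c \<circ> \<gamma>) has_vector_derivative D t) (at t within {a..b}))"
    using \<gamma> by (simp add: C1_curve_on_def)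
  from bchoice[OF this] obtain D where D:
    "\<And>c. c \<in> A \<Longrightarrow> continuous_on {t \<in> {a..b}. \<gamma> t \<in> fst c} (D c)"
    "\<And>c t. c \<in> A \<Longrightarrow> t \<in> {a..b} \<Longrightarrow> \<gamma> t \<in> fst c \<Longrightarrow>
      ((snd c \<circ> \<gamma>) has_vector_derivative D c t) (at t within {a..b})" by blast
  note cont = C1_curve_on_continuous[OF \<gamma>]
  have D_change: "D e t = transition c e (\<gamma> t) (D c t)"
    if t: "t \<in> {a..b}" and c: "c \<in> charts_at A (\<gamma> t)" and e: "e \<in> charts_at A (\<gamma> t)" for t c e
  proof (rule vector_derivative_unique_within_closed_interval[OF ab])
    show "((snd e \<circ> \<gamma>) has_vector_derivative D e t) (at t within cbox a b)"
      using D(2) t e by (simp add: charts_at_def)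
    have "((snd c \<circ> \<gamma>) has_vector_derivative D c t) (at t within {a..b})"
      using D(2) t c by (simp add: charts_at_def)
    then show "((snd e \<circ> \<gamma>) has_vector_derivative transition c e (\<gamma> t) (D c t)) (at t within cbox a b)"
      using has_vector_derivative_change_chart[of c \<gamma> t e "{a..b}" "D c t"] c e cont t
      by (simp add: continuous_on_eq_continuous_within)
  qed (use t in simp)
  \<comment> \<open>The chart chosen here may jump with \<open>t\<close>. By \<open>D_change\<close>
    the value does not depend on it, so near a given time one fixed chart can be used to prove
    continuity.\<close>
  define \<sigma> where "\<sigma> t = (let c = (SOME c. c \<in> charts_at A (\<gamma> t)) in coord_norm c (\<gamma> t) (D c t))" for t
  have \<sigma>: "\<sigma> t = coord_norm c (\<gamma> t) (D c t)" if t: "t \<in> {a..b}" and c: "c \<in> charts_at A (\<gamma> t)" for t c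
  proof -
    have e: "(SOME c. c \<in> charts_at A (\<gamma> t)) \<in> charts_at A (\<gamma> t)"
      using charts_at_nonempty by (rule someI_ex)
    show ?thesis
      unfolding \<sigma>_def Let_def D_change[OF t c e] form_norm_def coord_metric_change_chart[OF c e] ..
  qed
  show ?thesis
  proof
    show "continuous_on {a..b} \<sigma>"
      unfolding continuous_on_eq_continuous_within
    proof
      fix t assume t: "t \<in> {a..b}"
      obtain c where c: "c \<in> charts_at A (\<gamma> t)" using charts_at_nonempty by blast
      then have cA: "c \<in> A" by (simp add: charts_at_def)
      let ?S = "{t \<in> {a..b}. \<gamma> t \<in> fst c}"
      have "continuous_on ?S (\<lambda>t. coord_norm c (\<gamma> t) (D c t))"
        unfolding form_norm_def
        by (intro continuous_intros continuous_coord_metric_along cA D(1)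
            continuous_on_subset[OF cont]) auto
      then have contS: "continuous_on ?S \<sigma>"
        by (subst continuous_on_cong[OF refl \<sigma>]) (auto simp: charts_at_def cA)
      obtain T where T: "open T" "?S = {a..b} \<inter> T"
        using continuous_openin_preimage_gen[OF cont open_domain[OF cA]]
        by (auto simp: openin_open Int_def)
      have tS: "t \<in> ?S" using t c by (simp add: charts_at_def)
      then have "continuous (at t within ?S) \<sigma>"
        using contS unfolding continuous_on_eq_continuous_within by blast
      moreover have "at t within ?S = at t within {a..b}"
        by (rule at_within_nhd[of t T]) (use T tS in auto)
      ultimately show "continuous (at t within {a..b}) \<sigma>" by (simp only:)
    qed
    fix t assume t: "t \<in> {a<..<b}"
    then have at: "at t within {a..b} = at t" by (simp add: at_within_Icc_at)
    have isC: "isCont \<gamma> t" using cont t by (simp add: continuous_on_interior)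
    obtain c where c: "c \<in> charts_at A (\<gamma> t)" using charts_at_nonempty by blast
    have d: "((snd c \<circ> \<gamma>) has_vector_derivative D c t) (at t)"
      using D(2)[of c t] c t by (simp add: charts_at_def at)
    then show "regular_at \<gamma> t \<and> speed \<gamma> t = \<sigma> t"
      using isC c speed_coords[OF isC c d] \<sigma>[OF _ c] t by (auto simp: regular_at_def)
  qed
qed

lemma piecewise_C1_regular:
  "piecewise_C1 a b \<gamma> \<Longrightarrow> \<exists>F. finite F \<and> (\<forall>t\<in>{a..b} - F. regular_at \<gamma> t)"
proof (induction rule: piecewise_C1.induct)
  case (single a b \<gamma>)
  obtain \<sigma> where "\<And>t. t \<in> {a<..<b} \<Longrightarrow> regular_at \<gamma> t \<and> speed \<gamma> t = \<sigma> t"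
    using C1_curve_on_speed[OF single(2,1)] by blast
  then show ?case by (intro exI[of _ "{a, b}"]) auto
next
  case (append a b \<gamma> c)
  obtain \<sigma> where "\<And>t. t \<in> {b<..<c} \<Longrightarrow> regular_at \<gamma> t \<and> speed \<gamma> t = \<sigma> t"
    using C1_curve_on_speed[OF append(3,2)] by blast
  moreover obtain F where "finite F" "\<forall>t\<in>{a..b} - F. regular_at \<gamma> t" using append by blast
  moreover have "t \<in> {a..b} - F \<or> t \<in> {b<..<c}" if "t \<in> {a..c} - (F \<union> {b, c})" for t
    using that by auto
  ultimately show ?case by (intro exI[of _ "F \<union> {b, c}"]) blast
qed

lemma C1_curve_on_speed_integrable:
  assumes "C1_curve_on A a b \<gamma>" "a < b"
  shows "speed \<gamma> integrable_on {a..b}"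
proof -
  obtain \<sigma> where \<sigma>: "continuous_on {a..b} \<sigma>"
    "\<And>t. t \<in> {a<..<b} \<Longrightarrow> regular_at \<gamma> t \<and> speed \<gamma> t = \<sigma> t"
    using C1_curve_on_speed[OF assms] by blast
  show ?thesis
    by (rule integrable_spike_finite[OF _ _ integrable_continuous_interval[OF \<sigma>(1)], of "{a, b}"])
      (use \<sigma>(2) in auto)
qed

lemma speed_integrable: "piecewise_C1 a b \<gamma> \<Longrightarrow> speed \<gamma> integrable_on {a..b}"
proof (induction rule: piecewise_C1.induct)
  case (append a b \<gamma> c)
  then show ?case
    using piecewise_C1_less[OF append(1)] C1_curve_on_speed_integrable[OF append(3,2)]
    by (intro Henstock_Kurzweil_Integration.integrable_combine[where a = a and b = c and c = b]) auto
qed (rule C1_curve_on_speed_integrable)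

lemma len_nonneg:
  assumes "piecewise_C1 a b \<gamma>"
  shows "0 \<le> len a b \<gamma>"
proof -
  obtain F where F: "finite F" "\<And>t. t \<in> {a..b} - F \<Longrightarrow> regular_at \<gamma> t"
    using piecewise_C1_regular[OF assms] by blast
  \<comment> \<open>At irregular times \<open>g\<close> may be evaluated outside the tangent space,
    and \<open>sqrt\<close> of a negative number is negative, so nonnegativity of
    \<open>speed\<close> can fail there. Changing finitely many values leaves the integral
    unchanged.\<close>
  have "((\<lambda>t. if t \<in> F then 0 else speed \<gamma> t) has_integral len a b \<gamma>) {a..b}"
    unfolding len_def
    by (rule has_integral_spike_finite[OF F(1) _ integrable_integral[OF speed_integrable[OF assms]]]) auto
  then show ?thesis
    by (rule has_integral_nonneg) (use F(2) speed_nonneg in auto)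
qed

lemma len_combine:
  assumes "piecewise_C1 a b \<gamma>" "a \<le> s" "s \<le> b"
  shows "len a b \<gamma> = len a s \<gamma> + len s b \<gamma>"
  using Henstock_Kurzweil_Integration.integral_combine[OF assms(2,3) speed_integrable[OF assms(1)]] by (simp add: len_def)

lemma len_trivial [simp]: "len a a \<gamma> = 0"
  by (simp add: len_def)

lemma continuous_len: "piecewise_C1 a b \<gamma> \<Longrightarrow> continuous_on {a..b} (\<lambda>t. len a t \<gamma>)"
  unfolding len_def by (rule indefinite_integral_continuous_1[OF speed_integrable])

lemma len_subinterval:
  assumes "piecewise_C1 a b \<gamma>" "a \<le> s" "s \<le> t" "t \<le> b"
  shows "len s t \<gamma> = len a t \<gamma> - len a s \<gamma>" "0 \<le> len s t \<gamma>"
proof -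
  show "0 \<le> len s t \<gamma>"
    using len_nonneg[OF piecewise_C1_subinterval[OF assms(1)], of s t] assms by (cases "s = t") auto
  show "len s t \<gamma> = len a t \<gamma> - len a s \<gamma>"
  proof (cases "a = t")
    case False
    then have "piecewise_C1 a t \<gamma>" using assms by (intro piecewise_C1_subinterval[OF assms(1)]) auto
    then show ?thesis using len_combine[of a t \<gamma> s] assms by simp
  qed (use assms in auto)
qed

lemma speed_affine:
  assumes "regular_at \<gamma> (m * t + k)"
  shows "speed (\<lambda>t. \<gamma> (m * t + k)) t = \<bar>m\<bar> * speed \<gamma> (m * t + k)"
proof -
  let ?f = "\<lambda>t. m * t + k"
  obtain c where c: "c \<in> charts_at A (\<gamma> (?f t))" using charts_at_nonempty by blast
  have isC: "isCont \<gamma> (?f t)" using assms by (simp add: regular_at_def)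
  have "isCont ?f t" by (intro continuous_intros)
  then have cont: "isCont (\<lambda>t. \<gamma> (?f t)) t" using isCont_o2[of t ?f \<gamma>] isC by simp
  have "(?f has_vector_derivative m) (at t)"
    by (auto intro!: derivative_eq_intros simp: has_real_derivative_iff_has_vector_derivative[symmetric])
  then have "((snd c \<circ> \<gamma>) \<circ> ?f has_vector_derivative m *\<^sub>R velocity A \<gamma> (?f t) c) (at t)"
    using vector_diff_chain_at[of ?f m t "snd c \<circ> \<gamma>"] regular_atD[OF assms c] by blast
  then have "(snd c \<circ> (\<lambda>t. \<gamma> (?f t)) has_vector_derivative m *\<^sub>R velocity A \<gamma> (?f t) c) (at t)"
    by (simp add: o_def)
  from speed_coords[OF cont c this]
  show ?thesis
    by (simp add: speed_regular[OF assms c] inner_form.Q_scale[OF coord_metric_inner_form[OF c]])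
qed

lemma len_affine:
  assumes \<gamma>: "piecewise_C1 a b \<gamma>" and m: "m > 0"
  shows "len ((a - k) / m) ((b - k) / m) (\<lambda>t. \<gamma> (m * t + k)) = len a b \<gamma>"
proof -
  let ?I = "{(a - k) / m..(b - k) / m}"
  obtain F where F: "finite F" "\<And>t. t \<in> {a..b} - F \<Longrightarrow> regular_at \<gamma> t"
    using piecewise_C1_regular[OF \<gamma>] by blast
  have "(speed \<gamma> has_integral len a b \<gamma>) (cbox a b)"
    using integrable_integral[OF speed_integrable[OF \<gamma>]] by (simp add: len_def)
  from has_integral_affinity'[OF this m, of k]
  have "((\<lambda>t. speed \<gamma> (m * t + k)) has_integral len a b \<gamma> / m) ?I"
    by (simp add: divide_inverse mult.commute)
  from has_integral_mult_right[OF this, of m]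
  have "((\<lambda>t. m * speed \<gamma> (m * t + k)) has_integral len a b \<gamma>) ?I"
    using m by simp
  moreover have "finite ((\<lambda>t. (t - k) / m) ` F)" using F(1) by simp
  moreover have "speed (\<lambda>t. \<gamma> (m * t + k)) t = m * speed \<gamma> (m * t + k)"
    if t: "t \<in> ?I - (\<lambda>t. (t - k) / m) ` F" for t
  proof -
    have "m * t + k \<notin> F"
    proof
      assume "m * t + k \<in> F"
      then have "(m * t + k - k) / m \<in> (\<lambda>t. (t - k) / m) ` F" by blast
      then show False using t m by simp
    qed
    moreover have "m * t + k \<in> {a..b}" using t m by (auto simp: field_simps)
    ultimately show ?thesis using speed_affine[of \<gamma> m t k] F(2) m by simp
  qed
  ultimately have "(speed (\<lambda>t. \<gamma> (m * t + k)) has_integral len a b \<gamma>) ?I"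
    by (rule has_integral_spike_finite[rotated 2])
  then show ?thesis unfolding len_def by (rule integral_unique)
qed

lemma len_reverse:
  assumes \<gamma>: "piecewise_C1 a b \<gamma>"
  shows "len (- b) (- a) (\<lambda>t. \<gamma> (- t)) = len a b \<gamma>"
proof -
  obtain F where F: "finite F" "\<And>t. t \<in> {a..b} - F \<Longrightarrow> regular_at \<gamma> t"
    using piecewise_C1_regular[OF \<gamma>] by blast
  have "((\<lambda>t. speed \<gamma> (- t)) has_integral len a b \<gamma>) {- b..- a}"
    using integrable_integral[OF speed_integrable[OF \<gamma>]] by (simp add: len_def has_integral_reflect_real)
  moreover have "speed (\<lambda>t. \<gamma> (- t)) t = speed \<gamma> (- t)" if t: "t \<in> {- b..- a} - uminus ` F" for t
  proof -
    have "- t \<in> {a..b} - F" using t by (force simp: image_iff)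
    then show ?thesis using speed_affine[of \<gamma> "-1" t 0] F(2) by simp
  qed
  ultimately have "(speed (\<lambda>t. \<gamma> (- t)) has_integral len a b \<gamma>) {- b..- a}"
    by (rule has_integral_spike_finite[OF finite_imageI[OF F(1)], rotated])
  then show ?thesis unfolding len_def by (rule integral_unique)
qed

lemma speed_cong:
  assumes "regular_at \<gamma> t" "open T" "t \<in> T" "\<And>s. s \<in> T \<Longrightarrow> \<gamma> s = \<delta> s"
  shows "speed \<delta> t = speed \<gamma> t"
proof -
  obtain c where c: "c \<in> charts_at A (\<gamma> t)" using charts_at_nonempty by blast
  have ev: "\<forall>\<^sub>F s in nhds t. \<gamma> s = \<delta> s"
    using eventually_nhds_in_open[OF assms(2,3)] by eventually_elim (rule assms(4))
  have eq: "\<gamma> t = \<delta> t" using assms by blast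
  have "isCont \<delta> t" using isCont_cong[OF ev] assms(1) by (simp add: regular_at_def)
  moreover have "(snd c \<circ> \<delta> has_vector_derivative velocity A \<gamma> t c) (at t)"
    using regular_atD[OF assms(1) c] unfolding has_vector_derivative_def
    by (rule has_derivative_transform_nhds) (use ev in \<open>auto elim: eventually_mono\<close>)
  ultimately show ?thesis
    using speed_coords[where \<gamma> = \<delta> and t = t and c = c] speed_regular[OF assms(1) c] c eq by simp
qed

lemma len_cong:
  assumes \<gamma>: "piecewise_C1 a b \<gamma>" and eq: "\<And>t. t \<in> {a..b} \<Longrightarrow> \<gamma> t = \<delta> t"
  shows "len a b \<delta> = len a b \<gamma>"
proof -
  obtain F where F: "finite F" "\<And>t. t \<in> {a..b} - F \<Longrightarrow> regular_at \<gamma> t"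
    using piecewise_C1_regular[OF \<gamma>] by blast
  have "speed \<delta> t = speed \<gamma> t" if t: "t \<in> {a..b} - (F \<union> {a, b})" for t
    by (rule speed_cong[of \<gamma> t "{a<..<b}"]) (use t F(2) eq in auto)
  moreover have "finite (F \<union> {a, b})" using F(1) by simp
  ultimately have "(speed \<delta> has_integral len a b \<gamma>) {a..b}"
    using has_integral_spike_finite[OF _ _ integrable_integral[OF speed_integrable[OF \<gamma>]]]
    unfolding len_def by metis
  then show ?thesis unfolding len_def by (rule integral_unique)
qed

abbreviation d :: "'m \<Rightarrow> 'm \<Rightarrow> real" where "d \<equiv> riemannian_dist A g"

lemma dist_eq_Inf: "d x y = Inf ((\<lambda>\<gamma>. len 0 1 \<gamma>) ` {\<gamma>. piecewise_C1 0 1 \<gamma> \<and> \<gamma> 0 = x \<and> \<gamma> 1 = y})"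
  by (simp add: riemannian_dist_def piecewise_C1_path_iff pathstart_def pathfinish_def
      curve_length_eq[abs_def])

lemma dist_le_len:
  assumes \<gamma>: "piecewise_C1 a b \<gamma>"
  shows "d (\<gamma> a) (\<gamma> b) \<le> len a b \<gamma>"
proof -
  have ab: "b - a > 0" using piecewise_C1_less[OF \<gamma>] by simp
  let ?\<delta> = "\<lambda>t. \<gamma> ((b - a) * t + a)"
  have *: "(a - a) / (b - a) = 0" "(b - a) / (b - a) = 1" using ab by auto
  have "piecewise_C1 0 1 ?\<delta>" "len 0 1 ?\<delta> = len a b \<gamma>"
    using piecewise_C1_affine[OF \<gamma> ab, of a] len_affine[OF \<gamma> ab, of a] unfolding * by auto
  then have "d (\<gamma> a) (\<gamma> b) \<le> len 0 1 ?\<delta>"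
    unfolding dist_eq_Inf
    by (intro cINF_lower bdd_belowI2[of _ 0]) (auto intro: len_nonneg)
  then show ?thesis using \<open>len 0 1 ?\<delta> = len a b \<gamma>\<close> by simp
qed

lemma dist_less_obtains:
  assumes "\<exists>\<gamma>. piecewise_C1 0 1 \<gamma> \<and> \<gamma> 0 = x \<and> \<gamma> 1 = y" "d x y < r"
  obtains \<gamma> where "piecewise_C1 0 1 \<gamma>" "\<gamma> 0 = x" "\<gamma> 1 = y" "len 0 1 \<gamma> < r"
proof -
  have "\<exists>l\<in>(\<lambda>\<gamma>. len 0 1 \<gamma>) ` {\<gamma>. piecewise_C1 0 1 \<gamma> \<and> \<gamma> 0 = x \<and> \<gamma> 1 = y}. l < r"
    using assms by (intro cInf_lessD) (auto simp: dist_eq_Inf)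
  then show ?thesis using that by blast
qed

lemma concatenation:
  assumes \<gamma>: "piecewise_C1 0 1 \<gamma>" and \<delta>: "piecewise_C1 0 1 \<delta>" and eq: "\<gamma> 1 = \<delta> 0"
  obtains \<eta> where "piecewise_C1 0 2 \<eta>" "\<eta> 0 = \<gamma> 0" "\<eta> 2 = \<delta> 1" "len 0 2 \<eta> = len 0 1 \<gamma> + len 0 1 \<delta>"
proof
  let ?\<delta> = "\<lambda>t. \<delta> (1 * t + -1)"
  let ?\<eta> = "\<lambda>t::real. if t \<le> 1 then \<gamma> t else ?\<delta> t"
  have \<delta>1: "piecewise_C1 1 2 ?\<delta>" "len 1 2 ?\<delta> = len 0 1 \<delta>"
    using piecewise_C1_affine[OF \<delta>, of 1 "-1"] len_affine[OF \<delta>, of 1 "-1"] by simp_all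
  have 1: "piecewise_C1 0 1 ?\<eta>" "len 0 1 ?\<eta> = len 0 1 \<gamma>"
    using piecewise_C1_cong[OF \<gamma>, of ?\<eta>] len_cong[OF \<gamma>, of ?\<eta>] by auto
  have e: "?\<delta> t = ?\<eta> t" if "t \<in> {1..2}" for t using that eq by (cases "t = 1") auto
  have 2: "piecewise_C1 1 2 ?\<eta>" by (rule piecewise_C1_cong[OF \<delta>1(1) e])
  have 3: "len 1 2 ?\<eta> = len 0 1 \<delta>" using len_cong[OF \<delta>1(1) e] \<delta>1(2) by simp
  show 4: "piecewise_C1 0 2 ?\<eta>" by (rule piecewise_C1_join[OF 2 1(1)])
  show "len 0 2 ?\<eta> = len 0 1 \<gamma> + len 0 1 \<delta>"
    using len_combine[OF 4, of 1] 1(2) 3 by simp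
qed auto

text \<open>A calibration argument: pair the coordinate velocity with the fixed total increment. The
  integral of this pairing is the squared norm of the increment, while Cauchy-Schwarz bounds the
  integrand by the norm of the increment times the speed over \<open>l\<close>; then one factor
  cancels.\<close>

lemma chart_increment_le_len:
  assumes c: "c \<in> charts_at A x" and W: "W \<subseteq> fst c"
    and lower: "\<And>z a. z \<in> W \<Longrightarrow> l * coord_norm c x a \<le> coord_norm c z a" and l: "0 < l"
    and \<gamma>: "piecewise_C1 s t \<gamma>" "\<gamma> ` {s..t} \<subseteq> W"
  shows "l * coord_norm c x (snd c (\<gamma> t) - snd c (\<gamma> s)) \<le> len s t \<gamma>"
proof -
  interpret inner_form "coord_metric c x" by (rule coord_metric_inner_form[OF c])
  have cA: "c \<in> A" using c by (simp add: charts_at_def)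
  have st: "s < t" by (rule piecewise_C1_less[OF \<gamma>(1)])
  have chart: "c \<in> charts_at A (\<gamma> r)" if "r \<in> {s..t}" for r
  proof -
    have "\<gamma> r \<in> W" using \<gamma>(2) that by blast
    then show ?thesis using W cA by (auto simp: charts_at_def)
  qed
  obtain F where F: "finite F" "\<And>r. r \<in> {s..t} - F \<Longrightarrow> regular_at \<gamma> r"
    using piecewise_C1_regular[OF \<gamma>(1)] by blast
  define v where "v r = (if r \<in> F then 0 else velocity A \<gamma> r c)" for r
  let ?w = "snd c (\<gamma> t) - snd c (\<gamma> s)"
  have "continuous_on {s..t} (snd c \<circ> \<gamma>)"
    by (rule continuous_on_compose[OF piecewise_C1_continuous[OF \<gamma>(1)]
          continuous_on_subset[OF continuous_chart[OF cA]]]) (use \<gamma>(2) W in auto)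
  moreover have "(snd c \<circ> \<gamma> has_vector_derivative v r) (at r)" if "r \<in> {s<..<t} - F" for r
    using regular_atD[OF F(2)[of r] chart[of r]] that by (auto simp: v_def)
  ultimately have "(v has_integral (snd c \<circ> \<gamma>) t - (snd c \<circ> \<gamma>) s) {s..t}"
    using fundamental_theorem_of_calculus_interior_strong[OF F(1) less_imp_le[OF st]] by blast
  from has_integral_linear[OF this bounded_linear_right[of ?w]]
  have "((\<lambda>r. l * coord_metric c x ?w (v r)) has_integral l * coord_metric c x ?w ?w) {s..t}"
    by (intro has_integral_mult_right) (simp add: o_def)
  moreover have "((\<lambda>r. Q ?w * (if r \<in> F then 0 else speed \<gamma> r)) has_integral Q ?w * len s t \<gamma>) {s..t}"
    unfolding len_def
    by (intro has_integral_mult_right has_integral_spike_finite[OF F(1) _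
          integrable_integral[OF speed_integrable[OF \<gamma>(1)]]]) auto
  moreover have "l * coord_metric c x ?w (v r) \<le> Q ?w * (if r \<in> F then 0 else speed \<gamma> r)"
    if r: "r \<in> {s..t}" for r
  proof (cases "r \<in> F")
    case True
    then show ?thesis by (simp add: v_def zero_right)
  next
    case False
    have "l * coord_metric c x ?w (v r) \<le> l * (Q ?w * Q (v r))"
      using l by (intro mult_left_mono Cauchy_Schwarz) auto
    also have "\<dots> = Q ?w * (l * Q (v r))" by simp
    also have "\<dots> \<le> Q ?w * coord_norm c (\<gamma> r) (v r)"
    proof (intro mult_left_mono lower)
      show "\<gamma> r \<in> W" using \<gamma>(2) r by blast
    qed simp
    also have "coord_norm c (\<gamma> r) (v r) = speed \<gamma> r"
      using speed_regular[OF F(2) chart] r False by (simp add: v_def)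
    finally show ?thesis using False by simp
  qed
  ultimately have "l * coord_metric c x ?w ?w \<le> Q ?w * len s t \<gamma>" by (rule has_integral_le)
  then have "Q ?w * (l * Q ?w) \<le> Q ?w * len s t \<gamma>" by (simp add: Q_square[symmetric] mult_ac)
  then show ?thesis
    using len_nonneg[OF \<gamma>(1)] Q_pos[of ?w] by (cases "?w = 0") auto
qed

text \<open>A curve can leave the chart neighbourhood only after crossing a coordinate ball, which
  costs length \<open>l * r\<close>. The increment estimate presupposes that the curve stays in
  \<open>W\<close>, so both statements are propagated together by continuous induction in
  time.\<close>

lemma short_curve_trapped:
  assumes c: "c \<in> charts_at A x" and W: "open W" "W \<subseteq> fst c"
    and lower: "\<And>z a. z \<in> W \<Longrightarrow> l * coord_norm c x a \<le> coord_norm c z a" and l: "0 < l"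
    and ball: "{\<xi>. coord_norm c x (\<xi> - snd c y) \<le> r} \<subseteq> snd c ` W"
    and y: "y \<in> W" and \<gamma>: "piecewise_C1 a b \<gamma>" "\<gamma> a = y" "len a b \<gamma> < l * r"
  shows "\<gamma> b \<in> W \<and> l * coord_norm c x (snd c (\<gamma> b) - snd c y) \<le> len a b \<gamma>"
proof -
  interpret inner_form "coord_metric c x" by (rule coord_metric_inner_form[OF c])
  have cA: "c \<in> A" using c by (simp add: charts_at_def)
  have ab: "a < b" by (rule piecewise_C1_less[OF \<gamma>(1)])
  note cont = piecewise_C1_continuous[OF \<gamma>(1)]
  define B where "B = {\<xi>. Q (\<xi> - snd c y) \<le> r}"
  obtain m where m: "0 < m" "\<And>a. m * norm a \<le> Q a" using Q_bounds by blast
  have "B \<subseteq> cball (snd c y) (r / m)"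
  proof
    fix \<xi> assume "\<xi> \<in> B"
    then have "m * norm (\<xi> - snd c y) \<le> r" using m(2)[of "\<xi> - snd c y"] by (simp add: B_def)
    then show "\<xi> \<in> cball (snd c y) (r / m)"
      using m(1) by (simp add: dist_norm norm_minus_commute pos_le_divide_eq mult.commute)
  qed
  then have "bounded B" using bounded_cball bounded_subset by blast
  moreover have "closed B"
    unfolding B_def by (intro closed_Collect_le continuous_intros)
  ultimately have "compact B" by (simp add: compact_eq_bounded_closed)
  define C where "C = chart_inv c ` B"
  have BW: "B \<subseteq> snd c ` W" using ball by (simp add: B_def)
  have "compact C" unfolding C_def
    by (rule compact_continuous_image[OF continuous_on_subset[OF continuous_chart_inv[OF cA]] \<open>compact B\<close>])
      (use BW W in auto)
  then have "closed C" by (rule compact_imp_closed)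
  have CW: "z \<in> W" if "z \<in> C" for z
    using that BW W cA by (force simp: C_def chart_inv_chart)
  have C_iff: "z \<in> C \<longleftrightarrow> Q (snd c z - snd c y) \<le> r" if "z \<in> W" for z
  proof -
    have zc: "z \<in> fst c" using that W by blast
    have inv: "snd c (chart_inv c \<xi>) = \<xi>" if "\<xi> \<in> B" for \<xi>
      using that BW W cA by (intro chart_inv_in) auto
    show ?thesis
    proof
      assume "z \<in> C"
      then show "Q (snd c z - snd c y) \<le> r" by (auto simp: C_def inv) (simp add: B_def)
    next
      assume "Q (snd c z - snd c y) \<le> r"
      then have "snd c z \<in> B" by (simp add: B_def)
      then have "chart_inv c (snd c z) \<in> C" by (auto simp: C_def)
      then show "z \<in> C" using zc cA by (simp add: chart_inv_chart)
    qed
  qed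
  define S where "S = {t \<in> {a..b}. \<gamma> t \<in> W \<and> l * Q (snd c (\<gamma> t) - snd c y) \<le> len a t \<gamma>}"
  define E where "E = {t \<in> {a..b}. \<gamma> t \<in> C}"
  \<comment> \<open>As \<open>W\<close> is only open, closedness of \<open>S\<close> is not visible
    from its definition. The length bound places its points in \<open>C\<close>, the preimage of a
    compact coordinate ball, which is closed because the manifold is Hausdorff.\<close>
  have S_eq: "S = {t \<in> E. l * Q (snd c (\<gamma> t) - snd c y) \<le> len a t \<gamma>}"
  proof -
    have "\<gamma> t \<in> C" if t: "t \<in> S" for t
    proof -
      have "l * Q (snd c (\<gamma> t) - snd c y) \<le> len a t \<gamma>" using t by (simp add: S_def)
      also have "\<dots> \<le> len a b \<gamma>"
        using len_combine[OF \<gamma>(1), of t] len_subinterval(2)[OF \<gamma>(1), of t b] t by (auto simp: S_def)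
      also have "\<dots> \<le> l * r" using \<gamma>(3) by simp
      finally show ?thesis using C_iff[of "\<gamma> t"] t l by (simp add: S_def)
    qed
    then show ?thesis using CW by (auto simp: S_def E_def)
  qed
  have "b \<in> S"
  proof (rule closed_progress_reaches_end)
    have "E = {a..b} \<inter> \<gamma> -` C" by (auto simp: E_def)
    then have "closed E"
      using continuous_closed_preimage[OF cont closed_atLeastAtMost \<open>closed C\<close>] by simp
    moreover have "continuous_on E (\<lambda>t. snd c (\<gamma> t))"
      by (rule continuous_on_compose2[OF continuous_chart[OF cA] continuous_on_subset[OF cont]])
        (use CW W in \<open>auto simp: E_def\<close>)
    then have "continuous_on E (\<lambda>t. l * Q (snd c (\<gamma> t) - snd c y))"
      by (intro continuous_intros)
    moreover have "continuous_on E (\<lambda>t. len a t \<gamma>)"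
      by (rule continuous_on_subset[OF continuous_len[OF \<gamma>(1)]]) (auto simp: E_def)
    ultimately show "closed S"
      unfolding S_eq by (intro continuous_on_closed_Collect_le)
    show "a \<in> S" using ab y \<gamma>(2) by (simp add: S_def)
    show "S \<subseteq> {a..b}" by (auto simp: S_def)
    fix t assume t: "t \<in> S" "t < b"
    then have "t \<in> {a..b}" "\<gamma> t \<in> W" by (auto simp: S_def)
    then obtain T where T: "open T" "t \<in> T" "\<And>s. s \<in> {a..b} \<Longrightarrow> s \<in> T \<Longrightarrow> \<gamma> s \<in> W"
      using cont[unfolded continuous_on_topological, rule_format, of t W] W(1) by blast
    obtain e where e: "e > 0" "\<And>s. \<bar>s - t\<bar> < e \<Longrightarrow> s \<in> T"
      using T(1,2) unfolding open_dist dist_real_def by blast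
    define t' where "t' = min b (t + e / 2)"
    have t': "t < t'" "t' \<le> b" using t e by (auto simp: t'_def)
    have inW: "\<gamma> s \<in> W" if "s \<in> {t..t'}" for s
    proof (rule T(3)[OF _ e(2)])
      show "s \<in> {a..b}" using that t' \<open>t \<in> {a..b}\<close> by auto
      show "\<bar>s - t\<bar> < e" using that e(1) by (auto simp: t'_def)
    qed
    have at: "a \<le> t" using \<open>t \<in> {a..b}\<close> by simp
    have "piecewise_C1 t t' \<gamma>" by (rule piecewise_C1_subinterval[OF \<gamma>(1) at t'])
    from chart_increment_le_len[OF c W(2) _ l this] lower inW
    have step: "l * Q (snd c (\<gamma> t') - snd c (\<gamma> t)) \<le> len t t' \<gamma>" by blast
    have "l * Q (snd c (\<gamma> t') - snd c y) \<le> l * (Q (snd c (\<gamma> t') - snd c (\<gamma> t)) + Q (snd c (\<gamma> t) - snd c y))"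
      using Q_triangle[of "snd c (\<gamma> t') - snd c (\<gamma> t)" "snd c (\<gamma> t) - snd c y"] l by simp
    also have "\<dots> \<le> len t t' \<gamma> + len a t \<gamma>"
      using step t by (simp add: S_def distrib_left)
    also have "\<dots> = len a t' \<gamma>"
      using len_subinterval(1)[OF \<gamma>(1) at less_imp_le[OF t'(1)] t'(2)] by simp
    finally have "t' \<in> S" using inW[of t'] t' at by (simp add: S_def)
    then show "\<exists>t'\<in>S. t < t'" using t'(1) by blast
  qed
  then show ?thesis by (simp add: S_def)
qed

definition coord_line :: "('m, 'e) chart \<Rightarrow> 'm \<Rightarrow> 'm \<Rightarrow> real \<Rightarrow> 'm" where
  "coord_line c y z t = chart_inv c (snd c y + t *\<^sub>R (snd c z - snd c y))"

lemma coord_line_C1: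
  assumes c: "c \<in> A" and seg: "closed_segment (snd c y) (snd c z) \<subseteq> snd c ` fst c"
  shows "C1_curve_on A 0 1 (coord_line c y z)"
  unfolding C1_curve_on_def
proof (intro conjI ballI)
  let ?l = "\<lambda>t. snd c y + t *\<^sub>R (snd c z - snd c y)"
  let ?\<gamma> = "coord_line c y z"
  have line: "?l t \<in> snd c ` fst c" if "t \<in> {0..1}" for t
  proof -
    have "?l t \<in> closed_segment (snd c y) (snd c z)"
      using that by (auto simp: in_segment algebra_simps intro!: exI[of _ t])
    then show ?thesis using seg by blast
  qed
  have chart: "snd c (?\<gamma> t) = ?l t" "?\<gamma> t \<in> fst c" if "t \<in> {0..1}" for t
    using chart_inv_in[OF c line[OF that]] by (auto simp: coord_line_def)
  show cont: "continuous_on {0..1} ?\<gamma>"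
    unfolding coord_line_def
    by (rule continuous_on_compose2[OF continuous_chart_inv[OF c]])
      (use line in \<open>auto intro!: continuous_intros\<close>)
  fix e assume e: "e \<in> A"
  let ?D = "\<lambda>t. frechet_derivative (snd e \<circ> chart_inv c) (at (?l t)) (snd c z - snd c y)"
  show "\<exists>D. continuous_on {t \<in> {0..1}. ?\<gamma> t \<in> fst e} D \<and>
      (\<forall>t\<in>{0..1}. ?\<gamma> t \<in> fst e \<longrightarrow> ((snd e \<circ> ?\<gamma>) has_vector_derivative D t) (at t within {0..1}))"
  proof (intro exI[of _ ?D] conjI ballI impI)
    show "continuous_on {t \<in> {0..1}. ?\<gamma> t \<in> fst e} ?D"
    proof (rule continuous_on_compose2[OF continuous_transition[OF c e]])
      show "?l ` {t \<in> {0..1}. ?\<gamma> t \<in> fst e} \<subseteq> snd c ` (fst c \<inter> fst e)"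
      proof (rule image_subsetI)
        fix t assume t: "t \<in> {t \<in> {0..1}. ?\<gamma> t \<in> fst e}"
        then have "?l t = snd c (?\<gamma> t)" "?\<gamma> t \<in> fst c \<inter> fst e" using chart[of t] by auto
        then show "?l t \<in> snd c ` (fst c \<inter> fst e)" by blast
      qed
    qed (intro continuous_intros)
    fix t :: real assume t: "t \<in> {0..1}" "?\<gamma> t \<in> fst e"
    have "(?l has_vector_derivative (snd c z - snd c y)) (at t within {0..1})"
      by (auto intro!: derivative_eq_intros)
    then have "((snd c \<circ> ?\<gamma>) has_vector_derivative (snd c z - snd c y)) (at t within {0..1})"
      by (rule has_vector_derivative_transform[OF t(1), rotated]) (simp add: chart)
    from has_vector_derivative_change_chart[of c ?\<gamma> t e "{0..1}", OF _ _ _ t(1) this]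
    show "((snd e \<circ> ?\<gamma>) has_vector_derivative ?D t) (at t within {0..1})"
      using c e t chart[OF t(1)] cont
      by (simp add: charts_at_def transition_def continuous_on_eq_continuous_within)
  qed
qed

lemma coord_line_ends:
  assumes "c \<in> A" "y \<in> fst c" "z \<in> fst c"
  shows "coord_line c y z 0 = y" "coord_line c y z 1 = z"
  using assms by (simp_all add: coord_line_def chart_inv_chart)

lemma dist_le_coord_norm:
  assumes c: "c \<in> charts_at A x" and W: "W \<subseteq> fst c"
    and upper: "\<And>z a. z \<in> W \<Longrightarrow> coord_norm c z a \<le> l * coord_norm c x a"
    and yz: "y \<in> W" "z \<in> W" and seg: "closed_segment (snd c y) (snd c z) \<subseteq> snd c ` W"
  shows "d y z \<le> l * coord_norm c x (snd c z - snd c y)"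
proof -
  let ?\<gamma> = "coord_line c y z" and ?v = "snd c z - snd c y"
  let ?l = "\<lambda>t. snd c y + t *\<^sub>R ?v"
  have cA: "c \<in> A" using c by (simp add: charts_at_def)
  have seg': "closed_segment (snd c y) (snd c z) \<subseteq> snd c ` fst c" using seg W by blast
  have C1: "C1_curve_on A 0 1 ?\<gamma>" by (rule coord_line_C1[OF cA seg'])
  then have \<gamma>: "piecewise_C1 0 1 ?\<gamma>" by (intro piecewise_C1.single) auto
  have chart: "snd c (?\<gamma> t) = ?l t" "?\<gamma> t \<in> W" if "t \<in> {0..1}" for t
  proof -
    have "?l t \<in> closed_segment (snd c y) (snd c z)"
      using that by (auto simp: in_segment algebra_simps intro!: exI[of _ t])
    then have "?l t \<in> snd c ` W" using seg by blast
    then show "snd c (?\<gamma> t) = ?l t" "?\<gamma> t \<in> W"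
      using W cA by (auto simp: coord_line_def chart_inv_chart subset_iff)
  qed
  have speed: "speed ?\<gamma> t \<le> l * coord_norm c x ?v" if t: "t \<in> {0..1} - {0, 1}" for t
  proof -
    have T: "t \<in> {0<..<1}" using t by auto
    have "(?l has_vector_derivative ?v) (at t)" by (auto intro!: derivative_eq_intros)
    moreover have "\<forall>\<^sub>F s in nhds t. ?l s = (snd c \<circ> ?\<gamma>) s"
      using eventually_nhds_in_open[OF open_greaterThanLessThan T] by eventually_elim (simp add: chart)
    ultimately have "((snd c \<circ> ?\<gamma>) has_vector_derivative ?v) (at t)"
      unfolding has_vector_derivative_def by (rule has_derivative_transform_nhds)
    moreover have "isCont ?\<gamma> t"
      using C1_curve_on_continuous[OF C1] T by (simp add: continuous_on_interior)
    moreover have "c \<in> charts_at A (?\<gamma> t)" using chart(2)[of t] t W cA by (auto simp: charts_at_def)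
    ultimately have "speed ?\<gamma> t = coord_norm c (?\<gamma> t) ?v" by (intro speed_coords)
    then show ?thesis using upper[OF chart(2)[of t]] t by simp
  qed
  \<comment> \<open>The speed bound covers interior times only; the values at the end points are
    replaced so that the integrands compare everywhere.\<close>
  have "((\<lambda>t. if t \<in> {0, 1} then l * coord_norm c x ?v else speed ?\<gamma> t) has_integral len 0 1 ?\<gamma>) {0..1}"
    unfolding len_def
    by (rule has_integral_spike_finite[OF _ _ integrable_integral[OF speed_integrable[OF \<gamma>]], of "{0, 1}"]) auto
  moreover have "((\<lambda>t::real. l * coord_norm c x ?v) has_integral l * coord_norm c x ?v) {0..1}"
    using has_integral_const_real[of "l * coord_norm c x ?v" 0 1] by simp
  ultimately have "len 0 1 ?\<gamma> \<le> l * coord_norm c x ?v"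
    by (rule has_integral_le) (use speed in auto)
  moreover have "y \<in> fst c" "z \<in> fst c" using W yz by auto
  ultimately show ?thesis
    using dist_le_len[OF \<gamma>] by (simp add: coord_line_ends[OF cA])
qed

end

section \<open>The Riemannian distance as a length metric\<close>

locale connected_riemannian_manifold = riemannian_manifold A g
  for A :: "('m::{t2_space, second_countable_topology}, 'e::euclidean_space) chart set" and g +
  assumes connected_UNIV: "connected (UNIV :: 'm set)"
begin

text \<open>Joinability is an equivalence relation whose classes are open, by coordinate segments in
  small balls, so connectedness leaves one class. This keeps the infimum in the distance from
  ranging over an empty set.\<close>

lemma curve_exists: "\<exists>\<gamma>. piecewise_C1 0 1 \<gamma> \<and> \<gamma> 0 = x \<and> \<gamma> 1 = y"
proof (rule connected_equivalence_relation[OF connected_UNIV,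
      where R = "\<lambda>x y. \<exists>\<gamma>. piecewise_C1 0 1 \<gamma> \<and> \<gamma> 0 = x \<and> \<gamma> 1 = y"])
  fix x y :: 'm assume "\<exists>\<gamma>. piecewise_C1 0 1 \<gamma> \<and> \<gamma> 0 = x \<and> \<gamma> 1 = y"
  then obtain \<gamma> where \<gamma>: "piecewise_C1 0 1 \<gamma>" "\<gamma> 0 = x" "\<gamma> 1 = y" by blast
  have "piecewise_C1 0 1 (\<lambda>t. \<gamma> (- (1 * t + -1)))"
    using piecewise_C1_affine[OF piecewise_C1_reverse[OF \<gamma>(1)], of 1 "-1"] by simp
  then show "\<exists>\<gamma>. piecewise_C1 0 1 \<gamma> \<and> \<gamma> 0 = y \<and> \<gamma> 1 = x"
    using \<gamma> by (intro exI[of _ "\<lambda>t. \<gamma> (- (1 * t + -1))"]) simp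
next
  fix x y z :: 'm
  assume "\<exists>\<gamma>. piecewise_C1 0 1 \<gamma> \<and> \<gamma> 0 = x \<and> \<gamma> 1 = y" "\<exists>\<gamma>. piecewise_C1 0 1 \<gamma> \<and> \<gamma> 0 = y \<and> \<gamma> 1 = z"
  then obtain \<gamma> \<delta> where \<gamma>: "piecewise_C1 0 1 \<gamma>" "\<gamma> 0 = x" "\<gamma> 1 = y"
    and \<delta>: "piecewise_C1 0 1 \<delta>" "\<delta> 0 = y" "\<delta> 1 = z" by blast
  obtain \<eta> where \<eta>: "piecewise_C1 0 2 \<eta>" "\<eta> 0 = x" "\<eta> 2 = z"
    using concatenation[OF \<gamma>(1) \<delta>(1)] \<gamma> \<delta> by metis
  have "piecewise_C1 0 1 (\<lambda>t. \<eta> (2 * t + 0))"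
    using piecewise_C1_affine[OF \<eta>(1), of 2 0] by simp
  then show "\<exists>\<gamma>. piecewise_C1 0 1 \<gamma> \<and> \<gamma> 0 = x \<and> \<gamma> 1 = z"
    using \<eta> by (intro exI[of _ "\<lambda>t. \<eta> (2 * t + 0)"]) simp
next
  fix x :: 'm
  obtain c where c: "c \<in> charts_at A x" using charts_at_nonempty by blast
  then have cA: "c \<in> A" "x \<in> fst c" by (auto simp: charts_at_def)
  have "open (snd c ` fst c)" "snd c x \<in> snd c ` fst c" using cA open_image by auto
  then obtain r where r: "r > 0" "ball (snd c x) r \<subseteq> snd c ` fst c" by (metis open_contains_ball)
  let ?T = "fst c \<inter> snd c -` ball (snd c x) r"
  have "\<exists>\<gamma>. piecewise_C1 0 1 \<gamma> \<and> \<gamma> 0 = x \<and> \<gamma> 1 = z" if z: "z \<in> ?T" for z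
  proof (intro exI conjI)
    have "closed_segment (snd c x) (snd c z) \<subseteq> ball (snd c x) r"
      using z r by (intro closed_segment_subset convex_ball) auto
    then show "piecewise_C1 0 1 (coord_line c x z)"
      using r by (intro piecewise_C1.single coord_line_C1 cA) auto
  qed (use coord_line_ends cA z in auto)
  then show "\<exists>T. openin (top_of_set UNIV) T \<and> x \<in> T \<and>
      (\<forall>z\<in>T. \<exists>\<gamma>. piecewise_C1 0 1 \<gamma> \<and> \<gamma> 0 = x \<and> \<gamma> 1 = z)"
    using open_chart_preimage[OF cA(1) open_ball] cA r
    by (intro exI[of _ ?T]) auto
qed auto

lemmas dist_less_curve = dist_less_obtains[OF curve_exists]

lemma dist_greatest: "(\<And>\<gamma>. piecewise_C1 0 1 \<gamma> \<Longrightarrow> \<gamma> 0 = x \<Longrightarrow> \<gamma> 1 = y \<Longrightarrow> r \<le> len 0 1 \<gamma>) \<Longrightarrow> r \<le> d x y"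
  by (meson dist_less_curve not_le)

lemma dist_nonneg: "0 \<le> d x y"
  by (intro dist_greatest len_nonneg)

lemma dist_triangle': "d x z \<le> d x y + d y z"
proof (rule field_le_epsilon)
  fix e :: real assume "e > 0"
  then have "d x y < d x y + e / 2" "d y z < d y z + e / 2" by auto
  then obtain \<gamma> \<delta> where \<gamma>: "piecewise_C1 0 1 \<gamma>" "\<gamma> 0 = x" "\<gamma> 1 = y" "len 0 1 \<gamma> < d x y + e / 2"
    and \<delta>: "piecewise_C1 0 1 \<delta>" "\<delta> 0 = y" "\<delta> 1 = z" "len 0 1 \<delta> < d y z + e / 2"
    by (metis dist_less_curve)
  obtain \<eta> where \<eta>: "piecewise_C1 0 2 \<eta>" "\<eta> 0 = x" "\<eta> 2 = z" "len 0 2 \<eta> = len 0 1 \<gamma> + len 0 1 \<delta>"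
    using concatenation[OF \<gamma>(1) \<delta>(1)] \<gamma> \<delta> by metis
  then show "d x z \<le> d x y + d y z + e" using dist_le_len[OF \<eta>(1)] \<gamma>(4) \<delta>(4) by simp
qed

lemma dist_commute_le: "d y x \<le> d x y"
proof (rule dist_greatest)
  fix \<gamma> assume \<gamma>: "piecewise_C1 0 1 \<gamma>" "\<gamma> 0 = x" "\<gamma> 1 = y"
  show "d y x \<le> len 0 1 \<gamma>"
    using dist_le_len[OF piecewise_C1_reverse[OF \<gamma>(1)]] len_reverse[OF \<gamma>(1)] \<gamma>(2,3) by simp
qed

text \<open>The lower bounds come from trapping short curves, the upper ones from coordinate
  segments. The last clause starts from \<open>d x z < r\<close> and not from
  \<open>z \<in> U\<close>: it confines small \<open>d\<close>-balls to the chart, as required to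
  show that \<open>d\<close> induces the topology.\<close>

lemma local_geometry:
  assumes c: "c \<in> charts_at A x" and e: "0 < e" "e < 1"
  obtains U r where "open U" "x \<in> U" "U \<subseteq> fst c" "r > 0"
    "\<And>z a. z \<in> U \<Longrightarrow> (1 - e) * coord_norm c x a \<le> coord_norm c z a"
    "\<And>z a. z \<in> U \<Longrightarrow> coord_norm c z a \<le> (1 + e) * coord_norm c x a"
    "\<And>y z. y \<in> U \<Longrightarrow> z \<in> U \<Longrightarrow> (1 - e) * coord_norm c x (snd c z - snd c y) \<le> d y z"
    "\<And>y z. y \<in> U \<Longrightarrow> z \<in> U \<Longrightarrow> d y z \<le> (1 + e) * coord_norm c x (snd c z - snd c y)"
    "\<And>z. d x z < r \<Longrightarrow> z \<in> fst c \<and> (1 - e) * coord_norm c x (snd c z - snd c x) \<le> d x z"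
proof -
  interpret inner_form "coord_metric c x" by (rule coord_metric_inner_form[OF c])
  have cA: "c \<in> A" "x \<in> fst c" using c by (auto simp: charts_at_def)
  obtain W where W: "open W" "x \<in> W" "W \<subseteq> fst c"
    and lower: "\<And>z a. z \<in> W \<Longrightarrow> (1 - e) * coord_norm c x a \<le> coord_norm c z a"
    and upper: "\<And>z a. z \<in> W \<Longrightarrow> coord_norm c z a \<le> (1 + e) * coord_norm c x a"
    by (rule metric_comparison[OF c e]) (rule that)
  obtain m C where m: "0 < m" "0 < C" "\<And>a. m * norm a \<le> Q a" "\<And>a. Q a \<le> C * norm a"
    using Q_bounds by blast
  have "snd c ` W = snd c ` (fst c \<inter> W)" using W by (simp add: Int_absorb1)
  then have "open (snd c ` W)" using open_chart_image[OF cA(1) W(1)] by simp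
  then obtain R where R: "R > 0" "ball (snd c x) R \<subseteq> snd c ` W"
    using W(2) by (metis open_contains_ball imageI)
  \<comment> \<open>A \<open>Q\<close>-ball of radius \<rho> has Euclidean radius at most
    \<open>R / 4\<close>, so around a point within \<open>R / 2\<close> of the centre it stays in
    the ball of radius \<open>R\<close>.\<close>
  define \<rho> where "\<rho> = m * R / 4"
  \<comment> \<open>The second bound keeps the \<open>Q\<close>-distance of two points of
    \<open>U\<close> at most \<rho>. A curve too long to be trapped then satisfies the lower
    estimate trivially.\<close>
  define s where "s = min (R / 2) (\<rho> / (2 * C))"
  have pos: "\<rho> > 0" "s > 0" "s \<le> R / 2" "2 * C * s \<le> \<rho>"
    using m R by (auto simp: \<rho>_def s_def min_def field_simps)
  define U where "U = fst c \<inter> snd c -` ball (snd c x) s"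
  have UW: "U \<subseteq> W"
  proof
    fix z assume z: "z \<in> U"
    then have "snd c z \<in> ball (snd c x) R" using pos R by (auto simp: U_def)
    then obtain z' where z': "z' \<in> W" "snd c z = snd c z'" using R(2) by blast
    then have "z = z'" using z W(3) cA(1) by (intro chart_inj[of c]) (auto simp: U_def)
    then show "z \<in> W" using z' by simp
  qed
  have ball: "{\<xi>. Q (\<xi> - snd c y) \<le> \<rho>} \<subseteq> snd c ` W" if y: "y \<in> U" for y
  proof
    fix \<xi> assume "\<xi> \<in> {\<xi>. Q (\<xi> - snd c y) \<le> \<rho>}"
    then have "m * norm (\<xi> - snd c y) \<le> m * (R / 4)"
      using m(3)[of "\<xi> - snd c y"] by (simp add: \<rho>_def)
    then have "norm (\<xi> - snd c y) \<le> R / 4" using m(1) by simp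
    then have "dist (snd c x) \<xi> < R"
      using y pos R dist_triangle[of "snd c x" \<xi> "snd c y"]
      by (auto simp: U_def dist_norm norm_minus_commute)
    then show "\<xi> \<in> snd c ` W" using R(2) by auto
  qed
  have e': "0 < 1 - e" using e by simp
  have trapped: "z \<in> W \<and> (1 - e) * Q (snd c z - snd c y) \<le> len 0 1 \<gamma>"
    if "y \<in> U" "piecewise_C1 0 1 \<gamma>" "\<gamma> 0 = y" "\<gamma> 1 = z" "len 0 1 \<gamma> < (1 - e) * \<rho>" for y z \<gamma>
    using short_curve_trapped[OF c W(1,3) lower e' ball _ that(2,3)] that UW by blast
  show ?thesis
  proof (rule that)
    show "open U" unfolding U_def by (intro open_chart_preimage cA open_ball)
    show "x \<in> U" using cA pos by (simp add: U_def)
    show "U \<subseteq> fst c" by (simp add: U_def)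
    show "(1 - e) * \<rho> > 0" using e pos by simp
    show "(1 - e) * Q a \<le> coord_norm c z a" "coord_norm c z a \<le> (1 + e) * Q a" if "z \<in> U" for z a
      using lower upper UW that by blast+
    show "(1 - e) * Q (snd c z - snd c y) \<le> d y z" if yz: "y \<in> U" "z \<in> U" for y z
    proof (rule dist_greatest)
      fix \<gamma> assume \<gamma>: "piecewise_C1 0 1 \<gamma>" "\<gamma> 0 = y" "\<gamma> 1 = z"
      show "(1 - e) * Q (snd c z - snd c y) \<le> len 0 1 \<gamma>"
      proof (cases "len 0 1 \<gamma> < (1 - e) * \<rho>")
        case True
        then show ?thesis using trapped[OF yz(1) \<gamma>] by blast
      next
        case False
        have "norm (snd c z - snd c y) \<le> 2 * s"
          using yz dist_triangle2[of "snd c z" "snd c y" "snd c x"]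
          by (auto simp: U_def dist_norm norm_minus_commute)
        then have "C * norm (snd c z - snd c y) \<le> C * (2 * s)"
          using m by (intro mult_left_mono) auto
        then have "Q (snd c z - snd c y) \<le> \<rho>"
          using m(4)[of "snd c z - snd c y"] pos by simp
        then have "(1 - e) * Q (snd c z - snd c y) \<le> (1 - e) * \<rho>"
          using e by (intro mult_left_mono) auto
        then show ?thesis using False by simp
      qed
    qed
    show "d y z \<le> (1 + e) * Q (snd c z - snd c y)" if yz: "y \<in> U" "z \<in> U" for y z
    proof (rule dist_le_coord_norm[OF c W(3) upper])
      have "closed_segment (snd c y) (snd c z) \<subseteq> ball (snd c x) R"
        using yz pos R by (intro closed_segment_subset convex_ball) (auto simp: U_def)
      then show "closed_segment (snd c y) (snd c z) \<subseteq> snd c ` W" using R(2) by blast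
    qed (use yz UW in auto)
    fix z assume z: "d x z < (1 - e) * \<rho>"
    have xU: "x \<in> U" using cA pos by (simp add: U_def)
    have zc: "z \<in> fst c"
    proof -
      obtain \<gamma> where "piecewise_C1 0 1 \<gamma>" "\<gamma> 0 = x" "\<gamma> 1 = z" "len 0 1 \<gamma> < (1 - e) * \<rho>"
        by (rule dist_less_curve[OF z])
      then show ?thesis using trapped[OF xU] W(3) by blast
    qed
    moreover have "(1 - e) * Q (snd c z - snd c x) \<le> d x z"
    proof (rule dist_greatest)
      fix \<gamma> assume \<gamma>: "piecewise_C1 0 1 \<gamma>" "\<gamma> 0 = x" "\<gamma> 1 = z"
      show "(1 - e) * Q (snd c z - snd c x) \<le> len 0 1 \<gamma>"
      proof (cases "len 0 1 \<gamma> < (1 - e) * \<rho>")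
        case True
        then show ?thesis using trapped[OF xU \<gamma>] by blast
      next
        case False
        obtain \<delta> where \<delta>: "piecewise_C1 0 1 \<delta>" "\<delta> 0 = x" "\<delta> 1 = z" "len 0 1 \<delta> < (1 - e) * \<rho>"
          by (rule dist_less_curve[OF z])
        then show ?thesis using trapped[OF xU \<delta>] False by simp
      qed
    qed
    ultimately show "z \<in> fst c \<and> (1 - e) * Q (snd c z - snd c x) \<le> d x z" ..
  qed
qed

sublocale length_structure d
proof
  show "0 \<le> d x y" for x y by (rule dist_nonneg)
  show "d x y = d y x" for x y by (intro antisym dist_commute_le)
  show "d x z \<le> d x y + d y z" for x y z by (rule dist_triangle')
  have refl: "d x x = 0" for x
  proof -
    obtain c where c: "c \<in> charts_at A x" using charts_at_nonempty by blast
    interpret inner_form "coord_metric c x" by (rule coord_metric_inner_form[OF c])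
    obtain U r where "x \<in> U" "\<And>y z. y \<in> U \<Longrightarrow> z \<in> U \<Longrightarrow> d y z \<le> (1 + 1/2) * Q (snd c z - snd c y)"
      by (rule local_geometry[OF c, of "1/2"]) auto
    then have "d x x \<le> 0" by force
    then show ?thesis using dist_nonneg[of x x] by simp
  qed
  \<comment> \<open>Small \<open>d\<close>-balls fit into open sets. Applied to the complement of a
    point, this also shows that distinct points have positive distance.\<close>
  have nhd: "\<exists>r>0. \<forall>y. d x y < r \<longrightarrow> y \<in> W" if W: "open W" "x \<in> W" for W x
  proof -
    obtain c where c: "c \<in> charts_at A x" using charts_at_nonempty by blast
    then have cA: "c \<in> A" "x \<in> fst c" by (auto simp: charts_at_def)
    interpret inner_form "coord_metric c x" by (rule coord_metric_inner_form[OF c])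
    obtain U r where r: "r > 0"
      "\<And>z. d x z < r \<Longrightarrow> z \<in> fst c \<and> (1 - 1/2) * Q (snd c z - snd c x) \<le> d x z"
      by (rule local_geometry[OF c, of "1/2"]) auto
    obtain m C where m: "0 < m" "0 < C" "\<And>a. m * norm a \<le> Q a" "\<And>a. Q a \<le> C * norm a"
      using Q_bounds by blast
    have "snd c x \<in> snd c ` (fst c \<inter> W)" using cA W by blast
    then obtain s where s: "s > 0" "ball (snd c x) s \<subseteq> snd c ` (fst c \<inter> W)"
      using open_chart_image[OF cA(1) W(1)] by (metis open_contains_ball)
    have "y \<in> W" if y: "d x y < min r (m * s / 2)" for y
    proof -
      have yc: "y \<in> fst c" "(1 - 1/2) * Q (snd c y - snd c x) \<le> d x y" using r(2)[of y] y by auto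
      have "m * norm (snd c y - snd c x) < m * s" using m(3)[of "snd c y - snd c x"] yc y by simp
      then have "snd c y \<in> ball (snd c x) s" using m(1) by (simp add: dist_norm norm_minus_commute)
      then obtain y' where y': "y' \<in> fst c \<inter> W" "snd c y = snd c y'" using s(2) by blast
      then have "y = y'" using yc(1) cA(1) by (intro chart_inj[of c]) auto
      then show "y \<in> W" using y' by simp
    qed
    then show ?thesis using r(1) m s by (intro exI[of _ "min r (m * s / 2)"]) auto
  qed
  show "d x y = 0 \<longleftrightarrow> x = y" for x y
  proof
    assume "d x y = 0"
    show "x = y"
    proof (rule ccontr)
      assume "x \<noteq> y"
      then have "open (- {y})" "x \<in> - {y}" by auto
      then obtain r where "r > 0" "\<And>z. d x z < r \<Longrightarrow> z \<in> - {y}" using nhd by metis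
      then show False using \<open>d x y = 0\<close> by force
    qed
  qed (simp add: refl)
  \<comment> \<open>Conversely, \<open>d\<close>-balls contain open neighbourhoods, by the upper
    bound for \<open>d\<close> in the chart.\<close>
  have ball: "\<exists>T. open T \<and> x \<in> T \<and> (\<forall>y\<in>T. d x y < r)" if "r > 0" for x r
  proof -
    obtain c where c: "c \<in> charts_at A x" using charts_at_nonempty by blast
    then have cA: "c \<in> A" "x \<in> fst c" by (auto simp: charts_at_def)
    interpret inner_form "coord_metric c x" by (rule coord_metric_inner_form[OF c])
    obtain U s where U: "open U" "x \<in> U" "U \<subseteq> fst c"
      "\<And>y z. y \<in> U \<Longrightarrow> z \<in> U \<Longrightarrow> d y z \<le> (1 + 1/2) * Q (snd c z - snd c y)"
      by (rule local_geometry[OF c, of "1/2"]) auto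
    obtain m C where m: "0 < m" "0 < C" "\<And>a. m * norm a \<le> Q a" "\<And>a. Q a \<le> C * norm a"
      using Q_bounds by blast
    let ?T = "U \<inter> (fst c \<inter> snd c -` ball (snd c x) (r / (2 * C)))"
    have "open ?T" "x \<in> ?T"
      using U cA m that by (auto intro!: open_Int open_chart_preimage)
    moreover have "d x y < r" if y: "y \<in> ?T" for y
    proof -
      have "C * norm (snd c y - snd c x) < r / 2"
        using y m by (simp add: dist_norm norm_minus_commute field_simps)
      then have "(1 + 1/2) * Q (snd c y - snd c x) < r"
        using m(4)[of "snd c y - snd c x"] \<open>r > 0\<close> by simp
      then show ?thesis using U(4)[OF U(2), of y] y by simp
    qed
    ultimately show ?thesis by blast
  qed
  show "open W \<longleftrightarrow> (\<forall>x\<in>W. \<exists>r>0. \<forall>y. d x y < r \<longrightarrow> y \<in> W)" for W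
  proof
    assume "\<forall>x\<in>W. \<exists>r>0. \<forall>y. d x y < r \<longrightarrow> y \<in> W"
    then have "\<forall>x\<in>W. \<exists>T. open T \<and> x \<in> T \<and> T \<subseteq> W"
      using ball by (metis subsetI)
    then show "open W" using open_subopen[of W] by blast
  qed (use nhd in blast)
  show "\<exists>(\<gamma>::real \<Rightarrow> 'm) L::real \<Rightarrow> real.
      continuous_on {0..1} \<gamma> \<and> continuous_on {0..1} L \<and> \<gamma> 0 = x \<and> \<gamma> 1 = y \<and>
      L 0 = 0 \<and> L 1 < d x y + e \<and>
      (\<forall>s t. 0 \<le> s \<longrightarrow> s \<le> t \<longrightarrow> t \<le> 1 \<longrightarrow> d (\<gamma> s) (\<gamma> t) \<le> L t - L s)" if "e > 0" for e x y
  proof -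
    have "d x y < d x y + e" using that by simp
    then obtain \<gamma> where \<gamma>: "piecewise_C1 0 1 \<gamma>" "\<gamma> 0 = x" "\<gamma> 1 = y" "len 0 1 \<gamma> < d x y + e"
      by (rule dist_less_curve)
    have "d (\<gamma> s) (\<gamma> t) \<le> len 0 t \<gamma> - len 0 s \<gamma>" if st: "0 \<le> s" "s \<le> t" "t \<le> 1" for s t
    proof (cases "s = t")
      case False
      then have "piecewise_C1 s t \<gamma>" using st by (intro piecewise_C1_subinterval[OF \<gamma>(1)]) auto
      then show ?thesis using dist_le_len len_subinterval(1)[OF \<gamma>(1) st] by metis
    qed (simp add: refl)
    then show ?thesis
      using \<gamma> piecewise_C1_continuous[OF \<gamma>(1)] continuous_len[OF \<gamma>(1)]
      by (intro exI[of _ \<gamma>] exI[of _ "\<lambda>t. len 0 t \<gamma>"]) auto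
  qed
qed

lemma dist_to_set_eq: "dist_to_set A g = set_dist"
  by (simp add: fun_eq_iff dist_to_set_def set_dist_def)

end

section \<open>Viscosity inequalities and the metric\<close>

context connected_riemannian_manifold
begin

section \<open>From viscosity inequalities to metric properties\<close>

text \<open>Transports a test function from coordinates to the manifold for both kinds of test: the
  lower bound on the norm of its differential serves for supergradients, the upper bound for
  subgradients.\<close>

lemma test_function:
  assumes c: "c \<in> A" and V: "open V" "V \<subseteq> snd c ` fst c" "\<zeta> \<in> V"
    and F: "\<forall>y\<in>V. (F has_derivative (\<lambda>v. w y \<bullet> v)) (at y)"
    and w: "continuous_on V w"
  shows "\<exists>\<phi>. (\<exists>W. open W \<and> chart_inv c \<zeta> \<in> W \<and> C1_function_on A W \<phi>) \<and>
    (\<forall>\<^sub>F z in nhds (chart_inv c \<zeta>). z \<in> fst c \<and> snd c z \<in> V \<and> \<phi> z = F (snd c z)) \<and>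
    \<phi> (chart_inv c \<zeta>) = F \<zeta> \<and>
    (\<forall>a. w \<zeta> \<bullet> a \<le> cotangent_norm A g (chart_inv c \<zeta>) (differential A \<phi> (chart_inv c \<zeta>))
        * coord_norm c (chart_inv c \<zeta>) a) \<and>
    (\<forall>L\<ge>0. (\<forall>a. w \<zeta> \<bullet> a \<le> L * coord_norm c (chart_inv c \<zeta>) a) \<longrightarrow>
        cotangent_norm A g (chart_inv c \<zeta>) (differential A \<phi> (chart_inv c \<zeta>)) \<le> L)"
proof -
  let ?x = "chart_inv c \<zeta>" and ?W = "fst c \<inter> snd c -` V" and ?\<phi> = "F \<circ> snd c"
  have x: "?x \<in> fst c" "snd c ?x = \<zeta>" using chart_inv_in[OF c, of \<zeta>] V by auto
  have cx: "c \<in> charts_at A ?x" using x c by (simp add: charts_at_def)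
  have W: "open ?W" "?x \<in> ?W" using open_chart_preimage[OF c V(1)] x V(3) by auto
  have "\<forall>\<^sub>F y in nhds \<zeta>. F y = (?\<phi> \<circ> chart_inv c) y"
  proof (rule eventually_mono)
    show "\<forall>\<^sub>F y in nhds \<zeta>. y \<in> V" by (intro eventually_nhds_in_open V)
    show "F y = (?\<phi> \<circ> chart_inv c) y" if "y \<in> V" for y
      using V(2) that chart_inv_in(2)[OF c, of y] by auto
  qed
  then have der: "(?\<phi> \<circ> chart_inv c has_derivative (\<lambda>v. w \<zeta> \<bullet> v)) (at (snd c ?x))"
    unfolding x(2) by (rule has_derivative_transform_nhds[OF bspec[OF F V(3)]])
  show ?thesis
  proof (intro exI[of _ ?\<phi>] conjI allI impI)
    show "\<exists>W. open W \<and> ?x \<in> W \<and> C1_function_on A W ?\<phi>"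
      using W C1_function_of_chart[OF c V(1,2) bspec[OF F] w] by blast
    show "\<forall>\<^sub>F z in nhds ?x. z \<in> fst c \<and> snd c z \<in> V \<and> ?\<phi> z = F (snd c z)"
      using eventually_nhds_in_open[OF W] by eventually_elim auto
    show "w \<zeta> \<bullet> a \<le> cotangent_norm A g ?x (differential A ?\<phi> ?x) * coord_norm c ?x a" for a
      by (rule cotangent_norm_bound[OF cx der])
    show "cotangent_norm A g ?x (differential A ?\<phi> ?x) \<le> L"
      if "0 \<le> L" "\<forall>a. w \<zeta> \<bullet> a \<le> L * coord_norm c ?x a" for L
      using that by (intro cotangent_norm_least[OF cx der]) auto
  qed (simp add: x)
qed

lemma superdifferential_test:
  assumes c: "c \<in> A" and V: "open V" "V \<subseteq> snd c ` fst c" "\<zeta> \<in> V"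
    and F: "\<forall>y\<in>V. (F has_derivative (\<lambda>v. w y \<bullet> v)) (at y)"
    and w: "continuous_on V w"
    and max: "\<forall>y\<in>V. u (chart_inv c y) - F y \<le> u (chart_inv c \<zeta>) - F \<zeta>"
  shows "\<exists>p\<in>superdifferential A u (chart_inv c \<zeta>).
    \<forall>a. w \<zeta> \<bullet> a \<le> cotangent_norm A g (chart_inv c \<zeta>) p * coord_norm c (chart_inv c \<zeta>) a"
proof -
  let ?x = "chart_inv c \<zeta>"
  obtain \<phi> where \<phi>: "\<exists>W. open W \<and> ?x \<in> W \<and> C1_function_on A W \<phi>"
    "\<forall>\<^sub>F z in nhds ?x. z \<in> fst c \<and> snd c z \<in> V \<and> \<phi> z = F (snd c z)" "\<phi> ?x = F \<zeta>"
    "\<forall>a. w \<zeta> \<bullet> a \<le> cotangent_norm A g ?x (differential A \<phi> ?x) * coord_norm c ?x a"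
    using test_function[OF c V F w] by blast
  from \<phi>(2) have "\<forall>\<^sub>F z in nhds ?x. \<phi> ?x - u ?x \<le> \<phi> z - u z"
  proof eventually_elim
    case (elim z)
    then show ?case using bspec[OF max, of "snd c z"] c \<phi>(3) by (simp add: chart_inv_chart)
  qed
  then have "differential A \<phi> ?x \<in> superdifferential A u ?x"
    unfolding superdifferential_def using \<phi>(1) by blast
  then show ?thesis using \<phi>(4) by blast
qed

lemma subdifferential_test:
  assumes c: "c \<in> A" and V: "open V" "V \<subseteq> snd c ` fst c" "\<zeta> \<in> V"
    and F: "\<forall>y\<in>V. (F has_derivative (\<lambda>v. w y \<bullet> v)) (at y)"
    and w: "continuous_on V w"
    and min: "\<forall>y\<in>V. u (chart_inv c \<zeta>) - F \<zeta> \<le> u (chart_inv c y) - F y"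
    and L: "\<forall>a. w \<zeta> \<bullet> a \<le> L * coord_norm c (chart_inv c \<zeta>) a" "0 \<le> L"
  shows "\<exists>p\<in>subdifferential A u (chart_inv c \<zeta>). cotangent_norm A g (chart_inv c \<zeta>) p \<le> L"
proof -
  let ?x = "chart_inv c \<zeta>"
  obtain \<phi> where \<phi>: "\<exists>W. open W \<and> ?x \<in> W \<and> C1_function_on A W \<phi>"
    "\<forall>\<^sub>F z in nhds ?x. z \<in> fst c \<and> snd c z \<in> V \<and> \<phi> z = F (snd c z)" "\<phi> ?x = F \<zeta>"
    "cotangent_norm A g ?x (differential A \<phi> ?x) \<le> L"
    using test_function[OF c V F w] L by blast
  from \<phi>(2) have "\<forall>\<^sub>F z in nhds ?x. \<phi> z - u z \<le> \<phi> ?x - u ?x"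
  proof eventually_elim
    case (elim z)
    then show ?case using bspec[OF min, of "snd c z"] c \<phi>(3) by (simp add: chart_inv_chart)
  qed
  then have "differential A \<phi> ?x \<in> subdifferential A u ?x"
    unfolding subdifferential_def using \<phi>(1) by blast
  then show ?thesis using \<phi>(4) by blast
qed

lemma coord_ball_in_open:
  assumes c: "c \<in> charts_at A x" and W: "open W" "x \<in> W"
  obtains R where "R > 0" "cball (snd c x) R \<subseteq> snd c ` (fst c \<inter> W)"
proof -
  have "open (snd c ` (fst c \<inter> W))" "snd c x \<in> snd c ` (fst c \<inter> W)"
    using c W open_chart_image[of c W] by (auto simp: charts_at_def)
  then show ?thesis using that by (metis open_contains_cball)
qed

text \<open>Subtract from \<open>u\<close> a paraboloid so steep that the maximum over a coordinate
  ball is interior. There the paraboloid, shifted by a constant, touches \<open>u\<close> from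
  above.\<close>

lemma superdifferential_nonempty:
  assumes W: "open W" "x \<in> W" and u: "continuous_on W u"
  shows "\<exists>z\<in>W. superdifferential A u z \<noteq> {}"
proof -
  obtain c where c: "c \<in> charts_at A x" using charts_at_nonempty by blast
  then have cA: "c \<in> A" "x \<in> fst c" by (auto simp: charts_at_def)
  interpret inner_form "coord_metric c x" by (rule coord_metric_inner_form[OF c])
  obtain m C where m: "0 < m" "0 < C" "\<And>a. m * norm a \<le> Q a" "\<And>a. Q a \<le> C * norm a"
    using Q_bounds by blast
  obtain R where R: "R > 0" "cball (snd c x) R \<subseteq> snd c ` (fst c \<inter> W)"
    by (rule coord_ball_in_open[OF c W])
  define v where "v \<xi> = u (chart_inv c \<xi>)" for \<xi>
  have inW: "chart_inv c \<xi> \<in> W" "\<xi> \<in> snd c ` fst c" if "\<xi> \<in> cball (snd c x) R" for \<xi>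
    using R(2) that cA by (auto simp: chart_inv_chart subset_iff image_iff)
  have v: "continuous_on (cball (snd c x) R) v"
    unfolding v_def
    by (rule continuous_on_compose2[OF u continuous_on_subset[OF continuous_chart_inv[OF cA(1)]]])
      (use inW in auto)
  obtain M where M: "\<And>\<xi>. \<xi> \<in> cball (snd c x) R \<Longrightarrow> \<bar>v \<xi>\<bar> \<le> M"
    using compact_imp_bounded[OF compact_continuous_image[OF v compact_cball]]
    by (auto simp: bounded_iff simp del: mem_cball)
  \<comment> \<open>On the boundary sphere the paraboloid reaches at least \<open>2 * M + 1\<close>,
    more than the oscillation \<open>2 * M\<close> of \<open>v\<close>.\<close>
  define N where "N = (2 * M + 1) / (m * R)\<^sup>2"
  define F where "F \<xi> = N * coord_metric c x (\<xi> - snd c x) (\<xi> - snd c x)" for \<xi>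
  have "continuous_on (cball (snd c x) R) (\<lambda>\<xi>. v \<xi> - F \<xi>)"
    unfolding F_def by (intro continuous_intros v)
  from continuous_attains_sup[OF compact_cball _ this] R(1)
  obtain \<zeta> where \<zeta>: "\<zeta> \<in> cball (snd c x) R"
    "\<And>\<xi>. \<xi> \<in> cball (snd c x) R \<Longrightarrow> v \<xi> - F \<xi> \<le> v \<zeta> - F \<zeta>" by auto
  have "\<zeta> \<in> ball (snd c x) R"
  proof (rule ccontr)
    assume "\<zeta> \<notin> ball (snd c x) R"
    then have "norm (\<zeta> - snd c x) \<ge> R" by (simp add: dist_norm norm_minus_commute)
    then have "m * R \<le> Q (\<zeta> - snd c x)"
      using m(1) m(3)[of "\<zeta> - snd c x"] by (meson mult_left_mono less_imp_le order_trans)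
    then have "(m * R)\<^sup>2 \<le> coord_metric c x (\<zeta> - snd c x) (\<zeta> - snd c x)"
      using power_mono[of "m * R" "Q (\<zeta> - snd c x)" 2] m R by (simp add: power2_eq_square Q_square)
    moreover have "N \<ge> 0" using M[of \<zeta>] \<zeta>(1) by (simp add: N_def)
    ultimately have "N * (m * R)\<^sup>2 \<le> F \<zeta>" unfolding F_def by (rule mult_left_mono)
    then have "2 * M + 1 \<le> F \<zeta>" using m R by (simp add: N_def)
    then show False using \<zeta>(2)[of "snd c x"] M[of "snd c x"] M[OF \<zeta>(1)] R(1)
      by (auto simp: F_def zero_left)
  qed
  moreover have "\<forall>\<xi>\<in>ball (snd c x) R.
      (F has_derivative (\<lambda>v. ((2 * N) *\<^sub>R flat (\<xi> - snd c x)) \<bullet> v)) (at \<xi>)"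
    unfolding F_def
    by (intro ballI, rule has_derivative_eq_rhs[OF has_derivative_mult_right[OF B_square_has_derivative]])
      (simp add: flat_inner fun_eq_iff)
  moreover have "continuous_on (ball (snd c x) R) (\<lambda>\<xi>. (2 * N) *\<^sub>R flat (\<xi> - snd c x))"
    by (intro continuous_intros)
  moreover have "ball (snd c x) R \<subseteq> snd c ` fst c" using inW by auto
  moreover have "\<forall>\<xi>\<in>ball (snd c x) R. u (chart_inv c \<xi>) - F \<xi> \<le> u (chart_inv c \<zeta>) - F \<zeta>"
    using \<zeta>(2) by (simp add: v_def)
  ultimately obtain p where "p \<in> superdifferential A u (chart_inv c \<zeta>)"
    using superdifferential_test[OF cA(1) open_ball, of "snd c x" R \<zeta> F
        "\<lambda>\<xi>. (2 * N) *\<^sub>R flat (\<xi> - snd c x)" u] by blast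
  then show ?thesis using inW(1)[OF \<zeta>(1)] by blast
qed

text \<open>The comparison functions \<open>\<theta>\<bar>z - y\<bar> + N\<bar>z - y\<bar>\<^sup>2\<close> with vertex \<open>y\<close> have slope larger than
  \<open>\<theta>\<close> away from the vertex, and with \<open>N\<close> large they exceed the oscillation of \<open>u\<close> on the boundary
  of a ball around \<open>y\<close> whose radius does not depend on \<open>y\<close>.\<close>

lemma subsolution_local_lipschitz:
  assumes W: "open W" "x \<in> W" and u: "continuous_on W u" and L: "0 \<le> L"
    and sub: "\<And>z p. z \<in> W \<Longrightarrow> p \<in> superdifferential A u z \<Longrightarrow> cotangent_norm A g z p \<le> L"
  shows "local_lipschitz_const u x L"
  unfolding local_lipschitz_const_def
proof (intro allI impI)
  fix L' assume L': "L < L'"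
  define e where "e = (L' - L) / (L + 1 + L')"
  have e: "0 < e" "e < 1" using L L' by (auto simp: e_def)
  have eL: "L * (1 + e) + e = L' * (1 - e)"
  proof -
    have "e * (L + 1 + L') = L' - L" using L L' by (simp add: e_def)
    then show ?thesis by (simp add: algebra_simps)
  qed
  define \<theta> where "\<theta> = L * (1 + e)"
  have \<theta>: "0 \<le> \<theta>" using L e by (simp add: \<theta>_def)
  obtain c where c: "c \<in> charts_at A x" using charts_at_nonempty by blast
  then have cA: "c \<in> A" "x \<in> fst c" by (auto simp: charts_at_def)
  interpret inner_form "coord_metric c x" by (rule coord_metric_inner_form[OF c])
  obtain U r where U: "open U" "x \<in> U"
    and upper: "\<And>z a. z \<in> U \<Longrightarrow> coord_norm c z a \<le> (1 + e) * Q a"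
    and dlow: "\<And>y z. y \<in> U \<Longrightarrow> z \<in> U \<Longrightarrow> (1 - e) * Q (snd c z - snd c y) \<le> d y z"
    by (rule local_geometry[OF c e]) auto
  obtain m C where m: "0 < m" "0 < C" "\<And>a. m * norm a \<le> Q a" "\<And>a. Q a \<le> C * norm a"
    using Q_bounds by blast
  have "open (U \<inter> W)" "x \<in> U \<inter> W" using U W by auto
  then obtain R2 where R2: "R2 > 0" "cball (snd c x) R2 \<subseteq> snd c ` (fst c \<inter> (U \<inter> W))"
    by (rule coord_ball_in_open[OF c])
  define R where "R = R2 / 2"
  have R: "R > 0" using R2 by (simp add: R_def)
  define v where "v \<xi> = u (chart_inv c \<xi>)" for \<xi>
  have inW: "chart_inv c \<xi> \<in> W" "chart_inv c \<xi> \<in> U" "\<xi> \<in> snd c ` fst c" if "\<xi> \<in> cball (snd c x) R2" for \<xi>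
    using R2(2) that cA by (auto simp: chart_inv_chart subset_iff image_iff)
  have v: "continuous_on (cball (snd c x) R2) v"
    unfolding v_def
    by (rule continuous_on_compose2[OF u continuous_on_subset[OF continuous_chart_inv[OF cA(1)]]])
      (use inW in auto)
  obtain M where M: "\<And>\<xi>. \<xi> \<in> cball (snd c x) R2 \<Longrightarrow> \<bar>v \<xi>\<bar> \<le> M"
    using compact_imp_bounded[OF compact_continuous_image[OF v compact_cball]]
    by (auto simp: bounded_iff simp del: mem_cball)
  have M0: "0 \<le> M" using M[of "snd c x"] R2(1) by force
  define N where "N = (2 * M + 1) / (m * R)\<^sup>2"
  have N: "N > 0" "N * (m * R)\<^sup>2 = 2 * M + 1" using M0 m R by (auto simp: N_def)
  have claim: "v \<xi> - v \<eta> \<le> \<theta> * Q (\<xi> - \<eta>) + N * coord_metric c x (\<xi> - \<eta>) (\<xi> - \<eta>)"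
    if \<eta>: "\<eta> \<in> ball (snd c x) R" and \<xi>: "\<xi> \<in> cball \<eta> R" for \<eta> \<xi>
  proof -
    define F where "F \<xi> = \<theta> * Q (\<xi> - \<eta>) + N * coord_metric c x (\<xi> - \<eta>) (\<xi> - \<eta>)" for \<xi>
    have sub_ball: "cball \<eta> R \<subseteq> cball (snd c x) R2"
    proof
      fix \<xi> assume "\<xi> \<in> cball \<eta> R"
      then show "\<xi> \<in> cball (snd c x) R2"
        using \<eta> dist_triangle[of "snd c x" \<xi> \<eta>] by (simp add: R_def)
    qed
    have "continuous_on (cball \<eta> R) (\<lambda>\<xi>. v \<xi> - F \<xi>)"
      unfolding F_def by (intro continuous_intros continuous_on_subset[OF v sub_ball])
    from continuous_attains_sup[OF compact_cball _ this] R(1)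
    obtain \<zeta> where \<zeta>: "\<zeta> \<in> cball \<eta> R" "\<And>\<xi>. \<xi> \<in> cball \<eta> R \<Longrightarrow> v \<xi> - F \<xi> \<le> v \<zeta> - F \<zeta>" by auto
    have \<eta>b: "\<eta> \<in> cball \<eta> R" using R by simp
    have F\<eta>: "F \<eta> = 0" by (simp add: F_def zero_left)
    \<comment> \<open>The size of \<open>N\<close> excludes the boundary. At an interior point other
      than the vertex, testing in the radial direction gives slope \<theta> plus a positive term
      from the paraboloid, while the supergradient bound and the chart distortion allow only
      \<theta>.\<close>
    have "\<zeta> = \<eta>"
    proof (rule ccontr)
      assume ne: "\<zeta> \<noteq> \<eta>"
      have "\<zeta> \<in> ball \<eta> R"
      proof (rule ccontr)
        assume "\<zeta> \<notin> ball \<eta> R"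
        then have "norm (\<zeta> - \<eta>) \<ge> R" by (simp add: dist_norm norm_minus_commute)
        then have "m * R \<le> Q (\<zeta> - \<eta>)"
          using m(1) m(3)[of "\<zeta> - \<eta>"] by (meson mult_left_mono less_imp_le order_trans)
        then have "(m * R)\<^sup>2 \<le> coord_metric c x (\<zeta> - \<eta>) (\<zeta> - \<eta>)"
          using power_mono[of "m * R" "Q (\<zeta> - \<eta>)" 2] m R by (simp add: power2_eq_square Q_square)
        then have "N * (m * R)\<^sup>2 \<le> N * coord_metric c x (\<zeta> - \<eta>) (\<zeta> - \<eta>)"
          using N(1) by (intro mult_left_mono) auto
        moreover have "0 \<le> \<theta> * Q (\<zeta> - \<eta>)" using \<theta> by simp
        ultimately have "2 * M + 1 \<le> F \<zeta>" using N(2) by (simp add: F_def)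
        moreover have "\<bar>v \<zeta>\<bar> \<le> M" "\<bar>v \<eta>\<bar> \<le> M" using M \<zeta>(1) \<eta>b sub_ball by blast+
        ultimately show False using \<zeta>(2)[OF \<eta>b] F\<eta> by linarith
      qed
      let ?V = "ball \<eta> R - {\<eta>}"
      let ?w = "\<lambda>\<xi>. (\<theta> / Q (\<xi> - \<eta>) + 2 * N) *\<^sub>R flat (\<xi> - \<eta>)"
      have V_sub: "\<xi> \<in> cball \<eta> R" if "\<xi> \<in> ?V" for \<xi> using that by auto
      have V: "open ?V" "?V \<subseteq> snd c ` fst c" "\<zeta> \<in> ?V"
        using \<open>\<zeta> \<in> ball \<eta> R\<close> ne V_sub sub_ball inW(3) by (blast intro: open_delete open_ball)+
      have der: "\<forall>\<xi>\<in>?V. (F has_derivative (\<lambda>v. ?w \<xi> \<bullet> v)) (at \<xi>)"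
        unfolding F_def
        by (intro ballI, rule has_derivative_eq_rhs[OF has_derivative_add[OF
                has_derivative_mult_right[OF Q_has_derivative]
                has_derivative_mult_right[OF B_square_has_derivative]]])
          (auto simp: flat_inner fun_eq_iff inner_add_left scaleR_add_left)
      have Qne: "Q (\<xi> - \<eta>) \<noteq> 0" if "\<xi> \<in> ?V" for \<xi>
        using Q_pos[of "\<xi> - \<eta>"] that by auto
      have cont: "continuous_on ?V ?w"
        by (intro continuous_intros) (use Qne in auto)
      have max: "\<forall>\<xi>\<in>?V. u (chart_inv c \<xi>) - F \<xi> \<le> u (chart_inv c \<zeta>) - F \<zeta>"
        using \<zeta>(2) by (simp add: v_def)
      obtain p where p: "p \<in> superdifferential A u (chart_inv c \<zeta>)"
        "\<forall>a. ?w \<zeta> \<bullet> a \<le> cotangent_norm A g (chart_inv c \<zeta>) p * coord_norm c (chart_inv c \<zeta>) a"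
        using superdifferential_test[OF cA(1) V der cont max] by blast
      have Wz: "chart_inv c \<zeta> \<in> W" "chart_inv c \<zeta> \<in> U" using inW \<zeta>(1) sub_ball by blast+
      have cz: "c \<in> charts_at A (chart_inv c \<zeta>)"
        using chart_inv_in(1)[OF cA(1)] V cA(1) by (auto simp: charts_at_def)
      let ?a = "\<zeta> - \<eta>"
      have Qa: "Q ?a > 0" using ne by (intro Q_pos) auto
      have "?w \<zeta> \<bullet> ?a = \<theta> * Q ?a + 2 * N * (Q ?a * Q ?a)"
        using Qa by (simp add: flat_inner Q_square[symmetric] field_simps)
      moreover have "?w \<zeta> \<bullet> ?a \<le> L * ((1 + e) * Q ?a)"
        using spec[OF p(2), of ?a] mult_mono[OF sub[OF Wz(1) p(1)] upper[OF Wz(2), of ?a] L]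
          inner_form.Q_nonneg[OF coord_metric_inner_form[OF cz], of ?a] by linarith
      ultimately have "2 * N * (Q ?a * Q ?a) \<le> 0" by (simp add: \<theta>_def mult_ac)
      then show False using N(1) Qa by (simp add: mult_le_0_iff)
    qed
    then have "v \<xi> - F \<xi> \<le> v \<eta>" using \<zeta>(2)[OF \<xi>] F\<eta> by simp
    then show ?thesis by (simp add: F_def)
  qed
  \<comment> \<open>Points this close have frozen distance at most \<open>e / N\<close>, so the
    quadratic term is at most \<open>e\<close> times the linear one.\<close>
  define s where "s = min (R / 2) (e / (2 * N * C))"
  have s: "s > 0" "2 * s \<le> R" "N * (C * (2 * s)) \<le> e"
  proof -
    show "s > 0" "2 * s \<le> R" using R e N m by (auto simp: s_def)
    have "s \<le> e / (2 * N * C)" by (simp add: s_def)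
    then show "N * (C * (2 * s)) \<le> e" using N m by (simp add: field_simps)
  qed
  let ?U = "U \<inter> (fst c \<inter> snd c -` ball (snd c x) s)"
  show "\<exists>U. open U \<and> x \<in> U \<and> (\<forall>y\<in>U. \<forall>z\<in>U. u z - u y \<le> L' * d y z)"
  proof (intro exI conjI ballI)
    show "open ?U" by (intro open_Int U open_chart_preimage cA open_ball)
    show "x \<in> ?U" using U cA s by auto
    fix y z assume y: "y \<in> ?U" and z: "z \<in> ?U"
    let ?a = "snd c z - snd c y"
    have n: "norm ?a \<le> 2 * s"
      using y z dist_triangle2[of "snd c z" "snd c y" "snd c x"]
      by (auto simp: dist_norm norm_minus_commute)
    have "snd c y \<in> ball (snd c x) R" using y s by auto
    moreover have "snd c z \<in> cball (snd c y) R" using n s by (simp add: dist_norm norm_minus_commute)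
    ultimately have "v (snd c z) - v (snd c y) \<le> \<theta> * Q ?a + N * coord_metric c x ?a ?a" by (rule claim)
    moreover have "v (snd c z) = u z" "v (snd c y) = u y"
      using y z cA by (auto simp: v_def chart_inv_chart)
    moreover have "N * coord_metric c x ?a ?a \<le> e * Q ?a"
    proof -
      have "Q ?a \<le> C * (2 * s)"
        using m(4)[of ?a] mult_left_mono[OF n, of C] m(2) by linarith
      then have "N * Q ?a \<le> N * (C * (2 * s))" using N(1) by (intro mult_left_mono) auto
      then have "N * Q ?a \<le> e" using s(3) by linarith
      then have "N * Q ?a * Q ?a \<le> e * Q ?a" by (intro mult_right_mono) auto
      then show ?thesis by (simp add: Q_square mult.assoc)
    qed
    ultimately have "u z - u y \<le> (\<theta> + e) * Q ?a" by (simp add: distrib_right)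
    also have "\<dots> = L' * ((1 - e) * Q ?a)" using eL by (simp add: \<theta>_def)
    also have "\<dots> \<le> L' * d y z" using dlow y z L L' by (intro mult_left_mono) auto
    finally show "u z - u y \<le> L' * d y z" .
  qed
qed

text \<open>If \<open>u\<close> did not descend with rate \<open>L'\<close>, then adding a regularised cone of slope slightly above
  \<open>L'\<close> would produce an interior minimum, where the slope of a subgradient is too small.\<close>

lemma supersolution_descends:
  assumes W: "open W" "x \<in> W" and u: "continuous_on W u" and L: "0 < L"
    and sup: "\<And>z p. z \<in> W \<Longrightarrow> p \<in> subdifferential A u z \<Longrightarrow> L \<le> cotangent_norm A g z p"
  shows "descends_at u x L"
  unfolding descends_at_def
proof (intro allI impI, rule ccontr)
  fix L' U1 assume L': "L' < L" and U1: "open U1" "x \<in> U1"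
  assume "\<not> (\<exists>y\<in>U1. y \<noteq> x \<and> u y \<le> u x - L' * d x y)"
  then have neg: "u y > u x - L' * d x y" if "y \<in> U1" "y \<noteq> x" for y using that by force
  define L0 where "L0 = max L' 0"
  have L0: "0 \<le> L0" "L' \<le> L0" "L0 < L" using L L' by (auto simp: L0_def)
  \<comment> \<open>With this \<open>e\<close> the subgradient found below has norm at most
    \<open>\<theta> / (1 - e) < L\<close>. The last summand of \<theta> makes the cone outgrow the
    drop \<open>L0 * (1 + e) * Q (\<xi> - \<xi>0)\<close> to which \<open>u\<close> is
    limited.\<close>
  define e where "e = (L - L0) / (2 * (L0 + 1 + L))"
  have e: "0 < e" "e < 1" using L0 by (auto simp: e_def field_simps)
  define \<theta> where "\<theta> = L0 * (1 + e) + e"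
  have \<theta>: "0 < \<theta>" using e L0 by (simp add: \<theta>_def add_nonneg_pos)
  have \<theta>L: "\<theta> / (1 - e) < L"
  proof -
    have half: "a / (2 * k) * k = a / 2" if "0 < k" for a k :: real using that by simp
    have "e * (L0 + 1 + L) = (L - L0) / 2"
      unfolding e_def by (rule half) (use L0 in linarith)
    then have "\<theta> < L * (1 - e)" using L0 by (simp add: \<theta>_def algebra_simps)
    then show ?thesis using e by (simp add: divide_less_eq)
  qed
  obtain c where c: "c \<in> charts_at A x" using charts_at_nonempty by blast
  then have cA: "c \<in> A" "x \<in> fst c" by (auto simp: charts_at_def)
  interpret inner_form "coord_metric c x" by (rule coord_metric_inner_form[OF c])
  obtain U r where U: "open U" "x \<in> U"
    and lower: "\<And>z a. z \<in> U \<Longrightarrow> (1 - e) * Q a \<le> coord_norm c z a"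
    and dup: "\<And>y z. y \<in> U \<Longrightarrow> z \<in> U \<Longrightarrow> d y z \<le> (1 + e) * Q (snd c z - snd c y)"
    by (rule local_geometry[OF c e]) auto
  obtain m C where m: "0 < m" "0 < C" "\<And>a. m * norm a \<le> Q a" "\<And>a. Q a \<le> C * norm a"
    using Q_bounds by blast
  have "open (U \<inter> W \<inter> U1)" "x \<in> U \<inter> W \<inter> U1" using U W U1 by auto
  then obtain R where R: "R > 0" "cball (snd c x) R \<subseteq> snd c ` (fst c \<inter> (U \<inter> W \<inter> U1))"
    by (rule coord_ball_in_open[OF c])
  define \<xi>0 where "\<xi>0 = snd c x"
  define v where "v \<xi> = u (chart_inv c \<xi>)" for \<xi>
  have inW: "chart_inv c \<xi> \<in> W" "chart_inv c \<xi> \<in> U" "chart_inv c \<xi> \<in> U1" "\<xi> \<in> snd c ` fst c"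
    if "\<xi> \<in> cball \<xi>0 R" for \<xi>
    using R(2) that cA unfolding \<xi>0_def by (auto simp: chart_inv_chart subset_iff image_iff)
  have v: "continuous_on (cball \<xi>0 R) v"
    unfolding v_def
    by (rule continuous_on_compose2[OF u continuous_on_subset[OF continuous_chart_inv[OF cA(1)]]])
      (use inW in auto)
  have v0: "v \<xi>0 = u x" using cA by (simp add: v_def \<xi>0_def chart_inv_chart)
  have \<xi>0b: "\<xi>0 \<in> cball \<xi>0 R" using R by simp
  have v_lower: "u x - L0 * (1 + e) * Q (\<xi> - \<xi>0) \<le> v \<xi>" if \<xi>: "\<xi> \<in> cball \<xi>0 R" for \<xi>
  proof (cases "chart_inv c \<xi> = x")
    case True
    then show ?thesis using L0 e by (simp add: v_def)
  next
    case False
    have s: "snd c (chart_inv c \<xi>) = \<xi>" using chart_inv_in(2)[OF cA(1) inW(4)[OF \<xi>]] .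
    have "d x (chart_inv c \<xi>) \<le> (1 + e) * Q (\<xi> - \<xi>0)"
      using dup[OF U(2) inW(2)[OF \<xi>]] by (simp add: s \<xi>0_def)
    then have "L0 * d x (chart_inv c \<xi>) \<le> L0 * ((1 + e) * Q (\<xi> - \<xi>0))"
      using L0 by (intro mult_left_mono) auto
    moreover have "L' * d x (chart_inv c \<xi>) \<le> L0 * d x (chart_inv c \<xi>)"
      using L0 dist_nonneg by (intro mult_right_mono) auto
    ultimately show ?thesis using neg[OF inW(3)[OF \<xi>] False] by (simp add: v_def mult.assoc)
  qed
  \<comment> \<open>The minimum may sit at the vertex, so the cone must be differentiable there. The
    price is an offset \<open>\<theta> * \<delta>\<close> at the centre; it stays below
    \<open>e * (m * R)\<close>, the least gain on the boundary sphere, so the minimum remains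
    interior.\<close>
  define \<delta> where "\<delta> = e * m * R / (2 * \<theta>)"
  have \<delta>: "\<delta> > 0" "\<theta> * \<delta> < e * (m * R)" using e m R \<theta> by (auto simp: \<delta>_def)
  let ?S = "\<lambda>\<xi>. sqrt (coord_metric c x (\<xi> - \<xi>0) (\<xi> - \<xi>0) + \<delta>\<^sup>2)"
  define F where "F \<xi> = - \<theta> * ?S \<xi>" for \<xi>
  have S_ge: "Q (\<xi> - \<xi>0) \<le> ?S \<xi>" for \<xi> by (simp add: form_norm_def)
  have S_pos: "?S \<xi> > 0" for \<xi>
    using nonneg[of "\<xi> - \<xi>0"] \<delta> by (simp add: add_nonneg_pos)
  have F0: "F \<xi>0 = - (\<theta> * \<delta>)" using \<delta> by (simp add: F_def zero_left)
  have "continuous_on (cball \<xi>0 R) (\<lambda>\<xi>. v \<xi> - F \<xi>)"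
    unfolding F_def by (intro continuous_intros v)
  from continuous_attains_inf[OF compact_cball _ this] R(1)
  obtain \<zeta> where \<zeta>: "\<zeta> \<in> cball \<xi>0 R" "\<And>\<xi>. \<xi> \<in> cball \<xi>0 R \<Longrightarrow> v \<zeta> - F \<zeta> \<le> v \<xi> - F \<xi>" by auto
  have \<zeta>ball: "\<zeta> \<in> ball \<xi>0 R"
  proof (rule ccontr)
    assume "\<zeta> \<notin> ball \<xi>0 R"
    then have "norm (\<zeta> - \<xi>0) \<ge> R" by (simp add: dist_norm norm_minus_commute)
    then have "m * R \<le> Q (\<zeta> - \<xi>0)"
      using m(1) m(3)[of "\<zeta> - \<xi>0"] by (meson mult_left_mono less_imp_le order_trans)
    then have "e * (m * R) \<le> e * Q (\<zeta> - \<xi>0)" using e by (intro mult_left_mono) auto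
    moreover have "\<theta> * Q (\<zeta> - \<xi>0) \<le> - F \<zeta>" using S_ge[of \<zeta>] \<theta> by (simp add: F_def)
    moreover have "\<theta> * Q (\<zeta> - \<xi>0) = L0 * (1 + e) * Q (\<zeta> - \<xi>0) + e * Q (\<zeta> - \<xi>0)"
      by (simp add: \<theta>_def distrib_right)
    ultimately show False
      using v_lower[OF \<zeta>(1)] \<zeta>(2)[OF \<xi>0b] F0 v0 \<delta>(2) by linarith
  qed
  let ?V = "ball \<xi>0 R"
  let ?w = "\<lambda>\<xi>. (- (\<theta> / ?S \<xi>)) *\<^sub>R flat (\<xi> - \<xi>0)"
  have V: "open ?V" "?V \<subseteq> snd c ` fst c" "\<zeta> \<in> ?V" using inW \<zeta>ball by auto
  have der: "\<forall>\<xi>\<in>?V. (F has_derivative (\<lambda>v. ?w \<xi> \<bullet> v)) (at \<xi>)"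
    unfolding F_def
    by (intro ballI, rule has_derivative_eq_rhs[OF
          has_derivative_mult_right[OF regularised_cone_has_derivative[OF \<delta>(1)]]])
      (auto simp: flat_inner fun_eq_iff)
  have cont: "continuous_on ?V ?w"
    by (intro continuous_intros) (use S_pos in \<open>auto simp: less_imp_neq[THEN not_sym]\<close>)
  have min: "\<forall>\<xi>\<in>?V. u (chart_inv c \<zeta>) - F \<zeta> \<le> u (chart_inv c \<xi>) - F \<xi>"
    using \<zeta>(2) by (simp add: v_def)
  have slope: "?w \<zeta> \<bullet> a \<le> \<theta> / (1 - e) * coord_norm c (chart_inv c \<zeta>) a" for a
  proof -
    have "?w \<zeta> \<bullet> a = \<theta> / ?S \<zeta> * coord_metric c x (- (\<zeta> - \<xi>0)) a"
      using minus_left[of "\<zeta> - \<xi>0" a] by (simp add: flat_inner)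
    also have "\<dots> \<le> \<theta> / ?S \<zeta> * (Q (\<zeta> - \<xi>0) * Q a)"
      using Cauchy_Schwarz[of "- (\<zeta> - \<xi>0)" a] \<theta> S_pos[of \<zeta>] unfolding Q_minus
      by (intro mult_left_mono) auto
    also have "\<dots> \<le> \<theta> / ?S \<zeta> * (?S \<zeta> * Q a)"
      using \<theta> S_pos[of \<zeta>] S_ge by (intro mult_left_mono mult_right_mono) auto
    also have "\<dots> = \<theta> / (1 - e) * ((1 - e) * Q a)" using S_pos[of \<zeta>] e by simp
    also have "\<dots> \<le> \<theta> / (1 - e) * coord_norm c (chart_inv c \<zeta>) a"
      using lower[OF inW(2)[OF \<zeta>(1)]] \<theta> e by (intro mult_left_mono) auto
    finally show ?thesis .
  qed
  have "0 \<le> \<theta> / (1 - e)" using \<theta> e by simp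
  then obtain p where "p \<in> subdifferential A u (chart_inv c \<zeta>)"
    "cotangent_norm A g (chart_inv c \<zeta>) p \<le> \<theta> / (1 - e)"
    using subdifferential_test[OF cA(1) V der cont min] slope by blast
  then show False using sup[OF inW(1)[OF \<zeta>(1)]] \<theta>L by force
qed

section \<open>From metric properties to viscosity inequalities\<close>

text \<open>Moving from \<open>x\<close> in the coordinate direction \<open>- a\<close>, the test
  function falls no faster than \<open>u\<close>, whose rate of fall is controlled by the Lipschitz
  property. A one-sided derivative then bounds \<open>q a\<close>.\<close>

lemma superdifferential_bound:
  assumes L: "0 \<le> L" and lip: "local_lipschitz_const u x L" and p: "p \<in> superdifferential A u x"
  shows "0 \<le> cotangent_norm A g x p" "cotangent_norm A g x p \<le> L"
proof -
  obtain c where c: "c \<in> charts_at A x" using charts_at_nonempty by blast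
  then have cA: "c \<in> A" "x \<in> fst c" by (auto simp: charts_at_def)
  interpret inner_form "coord_metric c x" by (rule coord_metric_inner_form[OF c])
  obtain \<phi> W where \<phi>: "p = differential A \<phi> x" "open W" "x \<in> W" "C1_function_on A W \<phi>"
    "\<forall>\<^sub>F y in nhds x. \<phi> x - u x \<le> \<phi> y - u y"
    using p unfolding superdifferential_def by blast
  obtain q where q: "(\<phi> \<circ> chart_inv c has_derivative q) (at (snd c x))"
    using C1_function_has_derivative[OF c \<phi>(4,3)] by blast
  show "0 \<le> cotangent_norm A g x p"
    unfolding \<phi>(1) by (rule cotangent_norm_nonneg[OF c q])
  have bound: "q a \<le> L2 * Q a" if L2: "L < L2" for L2 a
  proof -
    define L' where "L' = (L + L2) / 2"
    \<comment> \<open>The gap between \<open>L'\<close> and \<open>L2\<close> absorbs the chart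
      distortion: \<open>L' * (1 + e) \<le> L2\<close>.\<close>
    define e where "e = min (1/2) ((L2 - L') / (L' + 1))"
    have L': "L < L'" "0 < L'" "L' < L2" using L L2 by (auto simp: L'_def)
    have e: "0 < e" "e < 1" using L' by (auto simp: e_def)
    have "e * (L' + 1) \<le> L2 - L'"
    proof -
      have "e \<le> (L2 - L') / (L' + 1)" by (simp add: e_def)
      then show ?thesis using L' by (simp add: pos_le_divide_eq)
    qed
    then have eL: "L' * (1 + e) \<le> L2" using e by (simp add: algebra_simps)
    obtain U r where U: "open U" "x \<in> U"
      and dup: "\<And>y z. y \<in> U \<Longrightarrow> z \<in> U \<Longrightarrow> d y z \<le> (1 + e) * Q (snd c z - snd c y)"
      by (rule local_geometry[OF c e]) auto
    obtain T where T: "open T" "x \<in> T" "\<And>y z. y \<in> T \<Longrightarrow> z \<in> T \<Longrightarrow> u z - u y \<le> L' * d y z"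
      using lip[unfolded local_lipschitz_const_def, rule_format, OF L'(1)] by blast
    obtain S where S: "open S" "x \<in> S" "\<And>y. y \<in> S \<Longrightarrow> \<phi> x - u x \<le> \<phi> y - u y"
      using \<phi>(5) unfolding eventually_nhds by blast
    have "\<forall>\<^sub>F \<xi> in nhds (snd c x). \<xi> \<in> snd c ` (fst c \<inter> (U \<inter> T \<inter> S))"
      using U T S by (intro eventually_chart[OF c]) auto
    moreover have "((\<lambda>t. snd c x - t *\<^sub>R a) \<longlongrightarrow> snd c x - 0 *\<^sub>R a) (at_right 0)"
      by (intro tendsto_intros)
    ultimately have "\<forall>\<^sub>F t in at_right 0. snd c x - t *\<^sub>R a \<in> snd c ` (fst c \<inter> (U \<inter> T \<inter> S))"
      using eventually_compose_filterlim[of _ "nhds (snd c x)"] by simp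
    then have "\<forall>\<^sub>F t in at_right 0. - (L2 * Q a) * t \<le>
        (\<phi> \<circ> chart_inv c) (snd c x - t *\<^sub>R a) - (\<phi> \<circ> chart_inv c) (snd c x - 0 *\<^sub>R a)"
      using eventually_at_right_less[of 0]
    proof eventually_elim
      case (elim t)
      then obtain z where z: "z \<in> fst c" "z \<in> U" "z \<in> T" "z \<in> S" "snd c z = snd c x - t *\<^sub>R a" by force
      have "d z x \<le> (1 + e) * (t * Q a)"
        using dup[OF z(2) U(2)] elim z(5) by (simp add: Q_scale)
      then have "L' * d z x \<le> L' * ((1 + e) * (t * Q a))" using L' by (intro mult_left_mono) auto
      also have "\<dots> = L' * (1 + e) * (t * Q a)" by simp
      also have "\<dots> \<le> L2 * (t * Q a)" using eL elim by (intro mult_right_mono) auto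
      finally have "u x - u z \<le> L2 * Q a * t" using T(3)[OF z(3) T(2)] by (simp add: mult_ac)
      then have "- (L2 * Q a) * t \<le> \<phi> z - \<phi> x" using S(3)[OF z(4)] by simp
      then show ?case using z cA by (simp add: chart_inv_chart flip: z(5))
    qed
    moreover have "((\<lambda>t. (\<phi> \<circ> chart_inv c) (snd c x - t *\<^sub>R a)) has_real_derivative - q a) (at 0)"
    proof -
      have "((\<lambda>t. snd c x - t *\<^sub>R a) has_derivative (\<lambda>t. - (t *\<^sub>R a))) (at (0::real))"
        by (auto intro!: derivative_eq_intros)
      from has_derivative_compose[OF this, of "\<phi> \<circ> chart_inv c" q] q
      have "((\<lambda>t. (\<phi> \<circ> chart_inv c) (snd c x - t *\<^sub>R a)) has_derivative (\<lambda>t. q (- (t *\<^sub>R a)))) (at 0)"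
        by simp
      moreover have "(\<lambda>t. q (- (t *\<^sub>R a))) = (*) (- q a)"
        using linear_neg[OF has_derivative_linear[OF q]] linear_cmul[OF has_derivative_linear[OF q]]
        by (simp add: fun_eq_iff)
      ultimately show ?thesis by (simp add: has_field_derivative_def)
    qed
    ultimately have "- (L2 * Q a) \<le> - q a" by (rule right_derivative_ge[rotated])
    then show ?thesis by simp
  qed
  show "cotangent_norm A g x p \<le> L"
  proof (rule dense_ge)
    fix L2 assume "L < L2"
    then show "cotangent_norm A g x p \<le> L2"
      using bound[of L2] L unfolding \<phi>(1) by (intro cotangent_norm_least[OF c q]) auto
  qed
qed

text \<open>The descending points come from unknown directions, so a directional derivative does not
  suffice; the first-order expansion of the test function is used uniformly in the direction. With a
  gradient of norm below \<open>L\<close> it could not fall as fast as \<open>u\<close>.\<close>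

lemma subdifferential_bound:
  assumes L: "0 < L" and desc: "descends_at u x L" and p: "p \<in> subdifferential A u x"
  shows "L \<le> cotangent_norm A g x p"
proof (rule ccontr)
  assume less: "\<not> L \<le> cotangent_norm A g x p"
  obtain c where c: "c \<in> charts_at A x" using charts_at_nonempty by blast
  then have cA: "c \<in> A" "x \<in> fst c" by (auto simp: charts_at_def)
  interpret inner_form "coord_metric c x" by (rule coord_metric_inner_form[OF c])
  obtain \<phi> W where \<phi>: "p = differential A \<phi> x" "open W" "x \<in> W" "C1_function_on A W \<phi>"
    "\<forall>\<^sub>F y in nhds x. \<phi> y - u y \<le> \<phi> x - u x"
    using p unfolding subdifferential_def by blast
  obtain q where q: "(\<phi> \<circ> chart_inv c has_derivative q) (at (snd c x))"
    using C1_function_has_derivative[OF c \<phi>(4,3)] by blast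
  define N where "N = cotangent_norm A g x p"
  have N: "0 \<le> N" "N < L"
    using cotangent_norm_nonneg[OF c q] less by (auto simp: N_def \<phi>(1))
  have qN: "q a \<ge> - (N * Q a)" for a
    using cotangent_norm_bound[OF c q, of "- a"] linear_neg[OF has_derivative_linear[OF q], of a]
    by (simp add: N_def \<phi>(1) Q_minus)
  \<comment> \<open>Half of the gap \<open>L' - N\<close> pays for the remainder of the expansion,
    through \<epsilon>, and the other half strictly exceeds the distortion loss
    \<open>L' * e\<close>.\<close>
  define L' where "L' = (N + L) / 2"
  have L': "N < L'" "L' < L" "0 < L'" using N by (auto simp: L'_def)
  define e where "e = (L' - N) / (2 * (L' + 1))"
  have e: "0 < e" "e < 1" using N L' by (auto simp: e_def field_simps)
  have eL: "L' * e < (L' - N) / 2"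
  proof -
    have half: "a / (2 * k) * k = a / 2" if "0 < k" for a k :: real using that by simp
    have "e * (L' + 1) = (L' - N) / 2"
      unfolding e_def by (rule half) (use L' in linarith)
    then show ?thesis using e by (simp add: algebra_simps)
  qed
  obtain m C where m: "0 < m" "0 < C" "\<And>a. m * norm a \<le> Q a" "\<And>a. Q a \<le> C * norm a"
    using Q_bounds by blast
  define \<epsilon> where "\<epsilon> = m * (L' - N) / 2"
  have \<epsilon>: "0 < \<epsilon>" using m L' by (simp add: \<epsilon>_def)
  obtain r where r: "r > 0" "\<And>\<xi>. norm (\<xi> - snd c x) < r \<Longrightarrow>
      norm ((\<phi> \<circ> chart_inv c) \<xi> - (\<phi> \<circ> chart_inv c) (snd c x) - q (\<xi> - snd c x)) \<le> \<epsilon> * norm (\<xi> - snd c x)"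
    using q \<epsilon> unfolding has_derivative_at_alt by blast
  obtain U s where U: "open U" "x \<in> U" "U \<subseteq> fst c"
    and dlow: "\<And>y z. y \<in> U \<Longrightarrow> z \<in> U \<Longrightarrow> (1 - e) * Q (snd c z - snd c y) \<le> d y z"
    by (rule local_geometry[OF c e]) auto
  obtain S where S: "open S" "x \<in> S" "\<And>y. y \<in> S \<Longrightarrow> \<phi> y - u y \<le> \<phi> x - u x"
    using \<phi>(5) unfolding eventually_nhds by blast
  let ?T = "U \<inter> S \<inter> (fst c \<inter> snd c -` ball (snd c x) r)"
  have "open ?T" "x \<in> ?T" using U S cA r by (auto intro!: open_Int open_chart_preimage)
  then obtain y where y: "y \<in> ?T" "y \<noteq> x" "u y \<le> u x - L' * d x y"
    using desc L' unfolding descends_at_def by blast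
  define a where "a = snd c y - snd c x"
  have "a \<noteq> 0" using chart_inj[of c y x] y cA by (auto simp: a_def)
  then have Qa: "0 < Q a" by (rule Q_pos)
  have "norm (\<phi> y - \<phi> x - q a) \<le> \<epsilon> * norm a"
    using r(2)[of "snd c y"] y(1) cA
    by (simp add: a_def chart_inv_chart dist_norm norm_minus_commute)
  then have 1: "q a - \<epsilon> * norm a \<le> \<phi> y - \<phi> x" by (simp add: abs_le_iff)
  have "\<epsilon> * norm a = (L' - N) / 2 * (m * norm a)" by (simp add: \<epsilon>_def)
  also have "\<dots> \<le> (L' - N) / 2 * Q a" using L' m by (intro mult_left_mono) auto
  finally have 2: "\<epsilon> * norm a \<le> (L' - N) / 2 * Q a" .
  have "(1 - e) * Q a \<le> d x y" using dlow[OF U(2)] y by (simp add: a_def)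
  then have 3: "L' * ((1 - e) * Q a) \<le> L' * d x y" using L' by (intro mult_left_mono) auto
  have 4: "\<phi> y - \<phi> x \<le> u y - u x" using S(3) y(1) by force
  have "L' * ((1 - e) * Q a) \<le> N * Q a + (L' - N) / 2 * Q a"
    using 1 2 3 4 y(3) qN[of a] by linarith
  then have "(L' * (1 - e)) * Q a \<le> (N + (L' - N) / 2) * Q a" by (simp add: algebra_simps)
  then have "L' * (1 - e) \<le> N + (L' - N) / 2" using Qa by (simp only: mult_le_cancel_right_pos)
  then have "L' - L' * e \<le> N + (L' - N) / 2" by (simp add: right_diff_distrib)
  then show False using eL by argo
qed

section \<open>The two boundary value problems\<close>

lemma eikonal_iff:
  assumes complete: mcomplete and K: "closed K" "K \<noteq> {}"
  shows "continuous_on UNIV u \<and> bdd_below (range u) \<and>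
      viscosity_solution A (UNIV - K) (\<lambda>x v r. cotangent_norm A g x v - 1) u \<and> (\<forall>x\<in>K. u x = 0)
    \<longleftrightarrow> u = set_dist K"
proof (intro iffI; (elim conjE)?)
  assume u: "continuous_on UNIV u" "bdd_below (range u)" "\<forall>x\<in>K. u x = 0"
    and sol: "viscosity_solution A (UNIV - K) (\<lambda>x v r. cotangent_norm A g x v - 1) u"
  have open_compl: "open (- K)" and cont: "continuous_on (- K) u"
    using K u(1) continuous_on_subset by auto
  show "u = set_dist K"
  proof (rule set_dist_unique[OF complete K(2) u(1,2)])
    fix x assume x: "x \<notin> K"
    show "local_lipschitz_const u x 1"
      by (rule subsolution_local_lipschitz[OF open_compl _ cont])
        (use x sol in \<open>auto simp: viscosity_solution_def\<close>)
    show "descends_at u x 1"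
      by (rule supersolution_descends[OF open_compl _ cont])
        (use x sol in \<open>auto simp: viscosity_solution_def\<close>)
  qed (use u in auto)
next
  assume u: "u = set_dist K"
  have "viscosity_solution A (UNIV - K) (\<lambda>x v r. cotangent_norm A g x v - 1) u"
    unfolding viscosity_solution_def
  proof (intro conjI ballI)
    show "continuous_on (UNIV - K) u"
      using continuous_set_dist[OF K(2)] continuous_on_subset u by blast
    fix x v assume x: "x \<in> UNIV - K"
    show "cotangent_norm A g x v - 1 \<le> 0" if "v \<in> superdifferential A u x"
      using superdifferential_bound(2)[OF _ set_dist_local_lipschitz[OF K(2)]] that u by simp
    show "cotangent_norm A g x v - 1 \<ge> 0" if "v \<in> subdifferential A u x"
      using subdifferential_bound[OF _ set_dist_descends[OF K]] that u x by simp
  qed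
  then show "continuous_on UNIV u \<and> bdd_below (range u) \<and>
      viscosity_solution A (UNIV - K) (\<lambda>x v r. cotangent_norm A g x v - 1) u \<and> (\<forall>x\<in>K. u x = 0)"
    using u continuous_set_dist[OF K(2)] set_dist_nonneg[OF K(2)] set_dist_zero
    by (auto intro: bdd_belowI2[of _ 0])
qed

lemma squared_eikonal_iff:
  assumes complete: mcomplete and K: "closed K" "K \<noteq> {}"
  shows "continuous_on UNIV u \<and> {x. u x = 0} = K \<and>
      viscosity_solution A UNIV (\<lambda>x v r. (cotangent_norm A g x v)\<^sup>2 - 2 * r) u \<and> (\<forall>x\<in>K. u x = 0)
    \<longleftrightarrow> u = (\<lambda>x. (set_dist K x)\<^sup>2 / 2)"
proof (intro iffI; (elim conjE)?)
  assume u: "continuous_on UNIV u" and zero: "{x. u x = 0} = K"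
    and sol: "viscosity_solution A UNIV (\<lambda>x v r. (cotangent_norm A g x v)\<^sup>2 - 2 * r) u"
  have sub: "(cotangent_norm A g z p)\<^sup>2 \<le> 2 * u z" if "p \<in> superdifferential A u z" for z p
    using sol that by (auto simp: viscosity_solution_def)
  have sup: "2 * u z \<le> (cotangent_norm A g z p)\<^sup>2" if "p \<in> subdifferential A u z" for z p
    using sol that by (auto simp: viscosity_solution_def)
  have u_nonneg: "0 \<le> u x" for x
  proof (rule ccontr)
    assume "\<not> 0 \<le> u x"
    moreover have "open {x. u x < 0}"
      using u by (intro open_Collect_less continuous_intros)
    ultimately obtain z where "u z < 0" "superdifferential A u z \<noteq> {}"
      using superdifferential_nonempty[of "{x. u x < 0}" x u] u continuous_on_subset by force
    then obtain p where "p \<in> superdifferential A u z" by blast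
    then show False using sub[of p z] \<open>u z < 0\<close> zero_le_power2[of "cotangent_norm A g z p"] by linarith
  qed
  define w where "w x = sqrt (2 * u x)" for x
  have w: "0 \<le> w x" "(w x)\<^sup>2 = 2 * u x" for x using u_nonneg by (auto simp: w_def)
  have w_cont: "continuous_on UNIV w" unfolding w_def by (intro continuous_intros u)
  then have w_isCont: "isCont w x" for x by (simp add: continuous_on_eq_continuous_at)
  have u_eq: "u = (\<lambda>y. (w y)\<^sup>2 / 2)" using w by auto
  have "w = set_dist K"
  proof (rule set_dist_unique[OF complete K(2) w_cont])
    show "bdd_below (range w)" using w(1) by (intro bdd_belowI2[of _ 0])
    show "w k = 0" if "k \<in> K" for k using that zero by (auto simp: w_def)
    fix x assume x: "x \<notin> K"
    \<comment> \<open>Here the inclusion of the zero set in \<open>K\<close> enters: off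
      \<open>K\<close> the factor \<open>w x\<close>, which the passage from \<open>u\<close> to
      \<open>w\<close> divides out, is positive.\<close>
    have pos: "0 < w x" using x zero w(1)[of x] u_nonneg[of x] by (auto simp: w_def less_le)
    have "local_lipschitz_const u x (w x)"
    proof (rule local_lipschitz_const_dense)
      fix L assume L: "w x < L"
      obtain U where U: "open U" "x \<in> U" "\<And>y. y \<in> U \<Longrightarrow> w y < L"
        using isCont_less_nhd[OF w_isCont L] by blast
      have "cotangent_norm A g z p \<le> L" if "z \<in> U" "p \<in> superdifferential A u z" for z p
      proof -
        have "(cotangent_norm A g z p)\<^sup>2 \<le> (w z)\<^sup>2" using sub[OF that(2)] w(2) by simp
        then have "cotangent_norm A g z p \<le> w z" using w(1) by (rule power2_le_imp_le)
        then show ?thesis using U(3)[OF that(1)] by simp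
      qed
      then show "local_lipschitz_const u x L"
        using pos L by (intro subsolution_local_lipschitz[OF U(1,2) continuous_on_subset[OF u]]) auto
    qed
    then show "local_lipschitz_const w x 1"
      unfolding u_eq using w(1) w_isCont pos by (intro local_lipschitz_const_of_half_square) auto
    have "descends_at u x (w x)"
    proof (rule descends_at_dense[OF pos])
      fix L assume L: "0 < L" "L < w x"
      obtain U where U: "open U" "x \<in> U" "\<And>y. y \<in> U \<Longrightarrow> L < w y"
        using isCont_greater_nhd[OF w_isCont L(2)] by blast
      have "L \<le> cotangent_norm A g z p" if z: "z \<in> U" and p: "p \<in> subdifferential A u z" for z p
      proof -
        obtain \<phi> W where \<phi>: "p = differential A \<phi> z" "z \<in> W" "C1_function_on A W \<phi>"
          using p unfolding subdifferential_def by blast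
        obtain c where c: "c \<in> charts_at A z" using charts_at_nonempty by blast
        have "0 \<le> cotangent_norm A g z p"
          unfolding \<phi>(1) by (rule cotangent_norm_nonneg[OF c C1_function_has_derivative[OF c \<phi>(3,2)]])
        moreover have "(w z)\<^sup>2 \<le> (cotangent_norm A g z p)\<^sup>2" using sup[OF p] w(2) by simp
        ultimately have "w z \<le> cotangent_norm A g z p" by (rule power2_le_imp_le[rotated])
        then show ?thesis using U(3)[OF z] by simp
      qed
      then show "descends_at u x L"
        using L by (intro supersolution_descends[OF U(1,2) continuous_on_subset[OF u]]) auto
    qed
    then show "descends_at w x 1"
      unfolding u_eq using w(1) pos by (intro descends_at_of_half_square) auto
  qed
  then show "u = (\<lambda>x. (set_dist K x)\<^sup>2 / 2)" using u_eq by simp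
next
  assume u: "u = (\<lambda>x. (set_dist K x)\<^sup>2 / 2)"
  note cont = continuous_set_dist[OF K(2)] and nn = set_dist_nonneg[OF K(2)]
  have isC: "isCont (set_dist K) x" for x using cont by (simp add: continuous_on_eq_continuous_at)
  have "{x. u x = 0} = K"
    using set_dist_pos[OF K] set_dist_zero by (force simp: u)
  moreover have "continuous_on UNIV u" unfolding u by (intro continuous_intros cont) auto
  moreover have "viscosity_solution A UNIV (\<lambda>x v r. (cotangent_norm A g x v)\<^sup>2 - 2 * r) u"
    unfolding viscosity_solution_def
  proof (intro conjI ballI)
    fix x v
    have lip: "local_lipschitz_const u x (set_dist K x)"
      unfolding u by (intro local_lipschitz_const_half_square nn isC set_dist_local_lipschitz K)
    show "(cotangent_norm A g x v)\<^sup>2 - 2 * u x \<le> 0" if v: "v \<in> superdifferential A u x"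
      using power_mono[OF superdifferential_bound(2)[OF nn lip v] superdifferential_bound(1)[OF nn lip v], of 2]
      by (simp add: u)
    show "(cotangent_norm A g x v)\<^sup>2 - 2 * u x \<ge> 0" if v: "v \<in> subdifferential A u x"
    \<comment> \<open>On \<open>K\<close> the equation needs no descent: \<open>u x = 0\<close>
      makes this inequality trivial. For supergradients the Lipschitz constant
      \<open>set_dist K x = 0\<close> already forces the norm to vanish there.\<close>
    proof (cases "x \<in> K")
      case True
      then show ?thesis by (simp add: u set_dist_zero)
    next
      case False
      have pos: "0 < set_dist K x" by (rule set_dist_pos[OF K False])
      have "descends_at u x (set_dist K x)"
        unfolding u by (intro descends_at_half_square nn isC pos set_dist_descends K False)
      from power_mono[OF subdifferential_bound[OF pos this v] nn, of 2]
      show ?thesis by (simp add: u)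
    qed
  qed fact
  ultimately show "continuous_on UNIV u \<and> {x. u x = 0} = K \<and>
      viscosity_solution A UNIV (\<lambda>x v r. (cotangent_norm A g x v)\<^sup>2 - 2 * r) u \<and> (\<forall>x\<in>K. u x = 0)"
    by blast
qed

end

theorem theorem3p1:
  fixes A :: "('m::{t2_space, second_countable_topology}, 'e::euclidean_space) chart set"
    and g :: "('m, 'e) metric_tensor"
    and K :: "'m set"
  assumes "riemannian_manifold A g"
    and "connected (UNIV :: 'm set)"
    and "Metric_space.mcomplete UNIV (riemannian_dist A g)"
    and "closed K" and "K \<noteq> {}"
  shows "(\<forall>u :: 'm \<Rightarrow> real.
            (continuous_on UNIV u \<and> bdd_below (range u) \<and>
             viscosity_solution A (UNIV - K) (\<lambda>x v r. cotangent_norm A g x v - 1) u \<and>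
             (\<forall>x\<in>K. u x = 0))
            \<longleftrightarrow> u = dist_to_set A g K) \<and>
         (\<forall>u :: 'm \<Rightarrow> real.
            (continuous_on UNIV u \<and> {x. u x = 0} = K \<and>
             viscosity_solution A UNIV (\<lambda>x v r. (cotangent_norm A g x v)\<^sup>2 - 2 * r) u \<and>
             (\<forall>x\<in>K. u x = 0))
            \<longleftrightarrow> u = (\<lambda>x. (dist_to_set A g K x)\<^sup>2 / 2))"
proof -
  interpret connected_riemannian_manifold A g
    using assms(1,2) by (simp add: connected_riemannian_manifold_def connected_riemannian_manifold_axioms_def)
  show ?thesis
    unfolding dist_to_set_eq
    using eikonal_iff[OF assms(3,4,5)] squared_eikonal_iff[OF assms(3,4,5)] by blast
qed

end
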